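(* Fix $\alpha \in (0,1)$ and let $\lambda = (1-\alpha)/(2\alpha)$. Let $k = k(\lambda)$ be the spectral radius order of $\lambda$. Let $N_\alpha(d)$ denote the maximum number of lines through the origin in $\mathbb{R}^d$ such that any two of them form the angle $\arccos\alpha$. Then: (a) if $k < \infty$, there exists $d_0 = d_0(\alpha)$ such that $N_\alpha(d) = \lfloor k(d-1)/(k-1) \rfloor$ for all $d > d_0$; (b) if $k = \infty$, then $N_\alpha(d) = d + o(d)$ as $d \to \infty$.
   Context: The spectral radius order $k(\lambda)$ of a real number $\lambda > 0$ is the smallest integer $k$ such that there exists a (finite simple) graph on $k$ vertices whose adjacency matrix has spectral radius (largest eigenvalue) exactly $\lambda$; if no such graph exists, $k(\lambda) = \infty$. Equivalently, $N_\alpha(d)$ is the maximum number of unit vectors in $\mathbb{R}^d$ whose pairwise inner products all lie in $\{\alpha, -\alpha\}$. *)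

theory Defs
  imports
    Complex_Main
    "HOL-Library.Extended_Nat"
    "HOL-Library.Landau_Symbols"
    "Jordan_Normal_Form.Spectral_Radius"
    "Graph_Theory.Pair_Digraph"
begin

section \<open>Spectral radius order\<close>

text \<open>
  The locale \<^locale>\<open>pair_graph\<close> describes finite simple graphs (symmetric, loop-free, each edge
  given by its two arcs). Isomorphic graphs have the same spectral radius, so graphs on \<open>n\<close>
  vertices are taken with vertex set \<open>{..<n}\<close>, which also indexes the adjacency matrix.
\<close>

definition adjacency_matrix :: "nat \<Rightarrow> nat pair_pre_digraph \<Rightarrow> real mat" where
  "adjacency_matrix n G = mat n n (\<lambda>(i, j). if (i, j) \<in> parcs G then 1 else 0)"

text \<open>
  The largest real eigenvalue. The maximum is over a finite set, which is nonempty for \<open>n > 0\<close>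
  because the matrix is real symmetric.
\<close>

definition graph_spectral_radius :: "nat \<Rightarrow> nat pair_pre_digraph \<Rightarrow> real" where
  "graph_spectral_radius n G = Max (spectrum (adjacency_matrix n G))"

text \<open>In \<^typ>\<open>enat\<close> the infimum of the empty set is \<open>\<infinity>\<close>, and otherwise it is the least element.\<close>

definition spectral_radius_order :: "real \<Rightarrow> enat" where
  "spectral_radius_order lam =
     Inf {enat n | n. n > 0 \<and>
       (\<exists>G. pair_graph G \<and> pverts G = {..<n} \<and> graph_spectral_radius n G = lam)}"


section \<open>Equiangular lines with a fixed angle\<close>

text \<open>
  The dimension \<open>d\<close> varies in the asymptotic statements, so the space of real \<open>d\<close>-tuples is
  \<open>carrier_vec d\<close> with the scalar product of \<^theory>\<open>Jordan_Normal_Form.Matrix\<close>.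
\<close>

definition lines_through_origin :: "nat \<Rightarrow> real vec set set" where
  "lines_through_origin d =
     {L. \<exists>v \<in> carrier_vec d. v \<noteq> 0\<^sub>v d \<and> L = range (\<lambda>c. c \<cdot>\<^sub>v v)}"

definition euclid_norm :: "real vec \<Rightarrow> real" where
  "euclid_norm v = sqrt (scalar_prod v v)"

text \<open>
  The absolute value selects the angle in \<open>[0, \<pi>/2]\<close>; the value does not depend on the nonzero
  vectors \<open>u\<close> and \<open>v\<close> chosen on the two lines.
\<close>

definition lines_form_angle :: "nat \<Rightarrow> real \<Rightarrow> real vec set \<Rightarrow> real vec set \<Rightarrow> bool" where
  "lines_form_angle d \<theta> L M \<longleftrightarrow>
     (\<forall>u \<in> L - {0\<^sub>v d}. \<forall>v \<in> M - {0\<^sub>v d}.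
        arccos (\<bar>scalar_prod u v\<bar> / (euclid_norm u * euclid_norm v)) = \<theta>)"

definition equiangular_lines :: "nat \<Rightarrow> real \<Rightarrow> real vec set set \<Rightarrow> bool" where
  "equiangular_lines d \<theta> S \<longleftrightarrow>
     S \<subseteq> lines_through_origin d \<and>
     (\<forall>L \<in> S. \<forall>M \<in> S. L \<noteq> M \<longrightarrow> lines_form_angle d \<theta> L M)"

text \<open>
  For \<open>0 < \<alpha> < 1\<close> the sizes are bounded in terms of \<open>d\<close>, so this is a maximum over a finite
  nonempty set and no infinite family is disregarded.
\<close>

definition max_equiangular :: "real \<Rightarrow> nat \<Rightarrow> nat" where
  "max_equiangular \<alpha> d = Max {card S | S. finite S \<and> equiangular_lines d (arccos \<alpha>) S}"

end

theory Submission
  imports Defs "HOL-Library.Ramsey"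
begin

text \<open>
  Unit vectors along the lines have Gram matrix \<open>2 * \<alpha> * (l * I - A + J / 2)\<close>, where \<open>A\<close> is the adjacency
  matrix of the graph of negative inner products. After suitable sign changes this graph has bounded
  degree: with respect to a large independent set (Ramsey), every vertex can be switched to have few
  neighbours in it, and then a large star would contradict positive semidefiniteness.

  The number of lines exceeds the dimension by at most the nullity of the Gram matrix. If the
  spectral radius of the graph is at most \<open>l\<close>, eigenvectors for \<open>l\<close> live on components of spectral
  radius \<open>l\<close>, which have at least \<open>k\<close> vertices each and contribute one dimension each; one dimension
  is lost because kernel vectors have coefficient sum zero. Otherwise a single component has
  spectral radius above \<open>l\<close> and carries all kernel vectors with coefficient sum zero, and \<open>l\<close> is its
  second eigenvalue, whose multiplicity is sublinear: deleting a net and a bounded number of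
  vertices reduces all local spectral radii below \<open>l\<close>, and closed walks are counted locally. For the
  lower bound, \<open>l * I - A\<close> for disjoint copies of a \<open>k\<close>-vertex graph of spectral radius \<open>l\<close>
  and isolated vertices is a Gram matrix of low rank.
\<close>

section \<open>Linear algebra with real-valued functions on a finite set\<close>

text \<open>The term \<open>J / 2\<close> shapes the upper bound: being of rank one it lets a single
  eigenvalue of \<open>A\<close> exceed \<open>l\<close>, and then the multiplicity of
  \<open>l\<close> is no longer controlled by component sizes. Sublinearity of that multiplicity
  needs connectedness (disjoint copies of one graph have linear multiplicity) and bounded degree (so
  that few centres are bad). Switching supplies the latter, because sign changes leave the lines
  alone. A net at distance \<open>2 * \<rho>\<close> makes every remaining vertex lose a closed walk
  of length \<open>4 * \<rho>\<close>, so locally \<open>l ^ (4 * \<rho>)\<close> drops by one. The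
  ratio \<open>1 - 1 / l ^ (4 * \<rho>)\<close> does not depend on the graph, and a high power
  \<open>s\<close> of it is as small as desired. The choices are made in the order \<alpha>,
  \<Delta>, \<epsilon>, \<rho>, \<open>s\<close>, and only then \<open>d\<close>. Nothing is
  diagonalized: eigenvalue bounds are bounds on quadratic forms, dimensions are counted through
  homogeneous linear conditions, and deleting vertices means asking eigenvectors to vanish there,
  which takes the place of interlacing.\<close>

lemma underdetermined_system:
  fixes X :: "'a set" and \<Phi> :: "('a \<Rightarrow> real) set"
  assumes "finite X" "finite \<Phi>" "card \<Phi> < card X"
  shows "\<exists>x. (\<forall>u. u \<notin> X \<longrightarrow> x u = 0) \<and> (\<exists>u. x u \<noteq> 0) \<and> (\<forall>\<phi>\<in>\<Phi>. (\<Sum>u\<in>X. \<phi> u * x u) = 0)"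
  using assms
proof (induction "card X" arbitrary: \<Phi> X)
  case 0
  then show ?case by simp
next
  case (Suc n)
  show ?case
  proof (cases "\<exists>\<psi>\<in>\<Phi>. \<exists>p\<in>X. \<psi> p \<noteq> 0")
    case False
    obtain p where "p \<in> X" using Suc.prems by fastforce
    with False show ?thesis by (intro exI[of _ "\<lambda>u. if u = p then 1 else 0"]) auto
  next
    case True
    then obtain \<psi> p where \<psi>: "\<psi> \<in> \<Phi>" and p: "p \<in> X" "\<psi> p \<noteq> 0" by auto
    define X' where "X' = X - {p}"
    \<comment> \<open>Gaussian elimination: subtracting a multiple of \<psi> removes the unknown
      \<open>p\<close>, which \<open>y\<close> below recovers from the equation \<psi>.\<close>
    define g where "g = (\<lambda>\<phi> u. \<phi> u - \<phi> p / \<psi> p * \<psi> u)"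
    have X': "X = insert p X'" "p \<notin> X'" "finite X'" "card X' = n"
      using p Suc.prems Suc.hyps unfolding X'_def by auto
    have "card (g ` (\<Phi> - {\<psi>})) \<le> card (\<Phi> - {\<psi>})"
      using Suc.prems by (intro card_image_le) auto
    also have "\<dots> < card X'"
proof -
      have "card (\<Phi> - {\<psi>}) = card \<Phi> - 1" "card \<Phi> > 0"
        using \<psi> Suc.prems by (auto simp: card_gt_0_iff)
      then show ?thesis using Suc.prems Suc.hyps(2) X'(4) by linarith
    qed
    finally obtain x where x: "\<forall>u. u \<notin> X' \<longrightarrow> x u = 0" "\<exists>u. x u \<noteq> 0"
      "\<forall>\<phi>\<in>g ` (\<Phi> - {\<psi>}). (\<Sum>u\<in>X'. \<phi> u * x u) = 0"
      using Suc.hyps(1)[of X' "g ` (\<Phi> - {\<psi>})"] X' Suc.prems by auto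
    define y where "y = x(p := - (\<Sum>u\<in>X'. \<psi> u * x u) / \<psi> p)"
    have yX': "(\<Sum>u\<in>X'. \<phi> u * y u) = (\<Sum>u\<in>X'. \<phi> u * x u)" for \<phi>
      using X' by (intro sum.cong) (auto simp: y_def)
    have yp: "y p = - (\<Sum>u\<in>X'. \<psi> u * x u) / \<psi> p" by (simp add: y_def)
    have split: "(\<Sum>u\<in>X. \<phi> u * y u) = \<phi> p * y p + (\<Sum>u\<in>X'. \<phi> u * x u)" for \<phi>
      using X' yX' by simp
    have "(\<Sum>u\<in>X. \<phi> u * y u) = 0" if "\<phi> \<in> \<Phi>" for \<phi>
    proof (cases "\<phi> = \<psi>")
      case True
      then show ?thesis unfolding split yp using p by simp
    next
      case False
      then have "(\<Sum>u\<in>X'. g \<phi> u * x u) = 0" using x(3) that by auto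
      moreover have "(\<Sum>u\<in>X'. g \<phi> u * x u)
          = (\<Sum>u\<in>X'. \<phi> u * x u) - \<phi> p / \<psi> p * (\<Sum>u\<in>X'. \<psi> u * x u)"
        unfolding g_def sum_distrib_left sum_subtractf[symmetric]
        by (intro sum.cong) (auto simp: algebra_simps)
      ultimately show ?thesis unfolding split yp by simp
    qed
    moreover have "\<exists>u. y u \<noteq> 0" using x(1,2) X'(2) unfolding y_def by (metis fun_upd_apply)
    moreover have "\<forall>u. u \<notin> X \<longrightarrow> y u = 0" using x(1) X' p unfolding y_def by auto
    ultimately show ?thesis by blast
  qed
qed

section \<open>Inner products of coordinate vectors\<close>

text \<open>Only the coordinates below \<open>d\<close> count, so functions on \<^typ>\<open>nat\<close> serve as vectors of every
  dimension.\<close>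

definition dot :: "nat \<Rightarrow> (nat \<Rightarrow> real) \<Rightarrow> (nat \<Rightarrow> real) \<Rightarrow> real" where
  "dot d p q = (\<Sum>c<d. p c * q c)"

lemma dot_commute: "dot d p q = dot d q p"
  unfolding dot_def by (simp add: mult.commute)

lemma dot_self_nonneg: "0 \<le> dot d p p"
  unfolding dot_def by (intro sum_nonneg) auto

lemma dot_self_eq_0_iff: "dot d p p = 0 \<longleftrightarrow> (\<forall>c<d. p c = 0)"
  unfolding dot_def by (subst sum_nonneg_eq_0_iff) auto

lemma dot_scale: "dot d (\<lambda>c. a * p c) (\<lambda>c. b * q c) = a * b * dot d p q"
  unfolding dot_def sum_distrib_left by (intro sum.cong) auto

lemma dot_sum_right: "dot d p (\<lambda>c. \<Sum>w\<in>V. x w * f w c) = (\<Sum>w\<in>V. x w * dot d p (f w))"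
  unfolding dot_def sum_distrib_left by (subst sum.swap) (simp add: mult_ac)

lemma dot_sum_sum: 
  "dot d (\<lambda>c. \<Sum>w\<in>V. x w * f w c) (\<lambda>c. \<Sum>w\<in>V. y w * f w c)
     = (\<Sum>u\<in>V. \<Sum>w\<in>V. x u * y w * dot d (f u) (f w))"
proof -
  have "dot d (\<lambda>c. \<Sum>w\<in>V. x w * f w c) (f u) = (\<Sum>w\<in>V. x w * dot d (f w) (f u))" for u
    using dot_sum_right[of d "f u" x f V] by (simp add: dot_commute)
  then have "dot d (\<lambda>c. \<Sum>w\<in>V. x w * f w c) (\<lambda>c. \<Sum>w\<in>V. y w * f w c)
      = (\<Sum>w\<in>V. \<Sum>u\<in>V. x u * y w * dot d (f u) (f w))"
    by (simp add: dot_sum_right sum_distrib_left mult_ac dot_commute)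
  also have "\<dots> = (\<Sum>u\<in>V. \<Sum>w\<in>V. x u * y w * dot d (f u) (f w))"
    by (rule sum.swap)
  finally show ?thesis .
qed

lemma dot_diff_scaled:
  "dot d (\<lambda>c. p c - t * q c) (\<lambda>c. p c - t * q c) = dot d p p - 2 * t * dot d p q + t\<^sup>2 * dot d q q"
  unfolding dot_def sum_distrib_left sum_subtractf[symmetric] sum.distrib[symmetric]
  by (intro sum.cong) (auto simp: algebra_simps power2_eq_square)

lemma dot_Cauchy_Schwarz: "(dot d p q)\<^sup>2 \<le> dot d p p * dot d q q"
proof (cases "dot d q q = 0")
  case True
  then have "dot d p q = 0" unfolding dot_self_eq_0_iff unfolding dot_def by simp
  with True show ?thesis by simp
next
  case False
  then have pos: "dot d q q > 0" using dot_self_nonneg[of d q] by simp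
  have "0 \<le> dot d p p - 2 * (dot d p q / dot d q q) * dot d p q + (dot d p q / dot d q q)\<^sup>2 * dot d q q"
    using dot_self_nonneg dot_diff_scaled by metis
  also have "\<dots> = dot d p p - (dot d p q)\<^sup>2 / dot d q q"
    using pos by (simp add: power2_eq_square field_simps)
  finally show ?thesis using pos by (simp add: field_simps)
qed

text \<open>First-order condition at a minimum. It turns equality in a quadratic form inequality
  into a linear equation.\<close>

lemma linear_term_vanishes:
  fixes b c :: real
  assumes "\<And>t. 0 \<le> 2 * t * b + t\<^sup>2 * c"
  shows "b = 0"
proof (rule ccontr)
  assume b: "b \<noteq> 0"
  \<comment> \<open>\<open>C\<close> is a positive upper bound of \<open>c\<close>; the majorant
    \<open>2 * t * b + t\<^sup>2 * C\<close> is smallest, and negative, at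
    \<open>t = - b / C\<close>.\<close>
  define C where "C = \<bar>c\<bar> + 1"
  have C: "C > 0" "c \<le> C" unfolding C_def by auto
  have "0 \<le> 2 * (- b / C) * b + (- b / C)\<^sup>2 * c" using assms .
  also have "\<dots> \<le> 2 * (- b / C) * b + (- b / C)\<^sup>2 * C"
    using C by (intro add_left_mono mult_left_mono) auto
  also have "\<dots> = - b\<^sup>2 / C" using C by (simp add: power2_eq_square field_simps)
  finally show False using b C by (simp add: divide_less_0_iff field_simps)
qed

lemma sum_power2_le_power2_sum:
  fixes a :: "'a \<Rightarrow> real"
  assumes "finite V" "\<And>u. u \<in> V \<Longrightarrow> 0 \<le> a u"
  shows "(\<Sum>u\<in>V. (a u)\<^sup>2) \<le> (\<Sum>u\<in>V. a u)\<^sup>2"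
proof -
  have "(\<Sum>u\<in>V. (a u)\<^sup>2) = (\<Sum>u\<in>V. a u * a u)" by (simp add: power2_eq_square)
  also have "\<dots> \<le> (\<Sum>u\<in>V. a u * (\<Sum>w\<in>V. a w))"
    using assms by (intro sum_mono mult_left_mono member_le_sum) auto
  also have "\<dots> = (\<Sum>u\<in>V. a u)\<^sup>2" by (simp add: sum_distrib_right power2_eq_square)
  finally show ?thesis .
qed

section \<open>Switching to bounded degree\<close>

lemma dot_sum_const:
  assumes "finite P" "\<And>u. u \<in> P \<Longrightarrow> dot d (f u) (f u) = 1"
    "\<And>u w. u \<in> P \<Longrightarrow> w \<in> P \<Longrightarrow> u \<noteq> w \<Longrightarrow> dot d (f u) (f w) = \<beta>"
  shows "(\<Sum>u\<in>P. \<Sum>w\<in>P. dot d (f u) (f w)) = card P * (1 + (real (card P) - 1) * \<beta>)"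
proof -
  have "(\<Sum>w\<in>P. dot d (f u) (f w)) = 1 + (real (card P) - 1) * \<beta>" if "u \<in> P" for u
  proof -
    have "(\<Sum>w\<in>P. dot d (f u) (f w)) = dot d (f u) (f u) + (\<Sum>w\<in>P-{u}. dot d (f u) (f w))"
      using assms(1) that by (simp add: sum.remove)
    also have "(\<Sum>w\<in>P-{u}. dot d (f u) (f w)) = (\<Sum>w\<in>P-{u}. \<beta>)"
      using assms(3) that by (intro sum.cong) auto
    also have "\<dots> = (real (card P) - 1) * \<beta>"
      using that assms(1) by (simp add: of_nat_diff card_gt_0_iff Suc_le_eq) (metis One_nat_def Suc_leI card_gt_0_iff empty_iff of_nat_1 of_nat_diff)
    finally show ?thesis using assms(2) that by simp
  qed
  then show ?thesis by simp
qed

lemma quadratic_form_split: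
  fixes g :: "'a \<Rightarrow> 'a \<Rightarrow> real"
  assumes "finite P" "finite Q" "P \<inter> Q = {}" "\<And>u w. g u w = g w u"
  shows "(\<Sum>u\<in>P\<union>Q. \<Sum>w\<in>P\<union>Q. g u w) 
    = (\<Sum>u\<in>P. \<Sum>w\<in>P. g u w) + 2 * (\<Sum>u\<in>P. \<Sum>w\<in>Q. g u w) + (\<Sum>u\<in>Q. \<Sum>w\<in>Q. g u w)"
proof -
  have "(\<Sum>u\<in>Q. \<Sum>w\<in>P. g u w) = (\<Sum>u\<in>P. \<Sum>w\<in>Q. g w u)" by (rule sum.swap)
  also have "\<dots> = (\<Sum>u\<in>P. \<Sum>w\<in>Q. g u w)" using assms(4) by (intro sum.cong refl) auto
  finally show ?thesis using assms(1-3) by (simp add: sum.union_disjoint sum.distrib)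
qed

text \<open>The sum of the vectors over \<open>P\<close> has squared length
  \<open>card P * (1 - (card P - 1) * \<alpha>)\<close>, which cannot be negative.\<close>

lemma negative_clique_bounded:
  assumes "finite P" "\<And>u. u \<in> P \<Longrightarrow> dot d (f u) (f u) = 1" "\<alpha> > 0"
    "\<And>u w. u \<in> P \<Longrightarrow> w \<in> P \<Longrightarrow> u \<noteq> w \<Longrightarrow> dot d (f u) (f w) = - \<alpha>"
  shows "card P \<le> 1 / \<alpha> + 1"
proof (cases "card P = 0")
  case True then show ?thesis using assms by simp
next
  case False
  have "0 \<le> dot d (\<lambda>c. \<Sum>w\<in>P. 1 * f w c) (\<lambda>c. \<Sum>w\<in>P. 1 * f w c)" by (rule dot_self_nonneg)
  also have "\<dots> = card P * (1 + (real (card P) - 1) * (-\<alpha>))"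
    unfolding dot_sum_sum using dot_sum_const[OF assms(1,2,4)] by simp
  finally have "0 \<le> 1 + (real (card P) - 1) * (-\<alpha>)" using False by (simp add: zero_le_mult_iff)
  then show ?thesis using assms(3) by (simp add: field_simps)
qed

text \<open>The difference of the averages over \<open>P\<close> and \<open>Q\<close> is short if both sets are large, but its inner
  product with \<open>v\<close> is \<open>- 2 * \<alpha>\<close>.\<close>

lemma mixed_signs_bounded:
  assumes P: "finite P" "P \<noteq> {}" and Q: "finite Q" "Q \<noteq> {}" and PQ: "P \<inter> Q = {}"
    and unit: "\<And>u. u \<in> P \<union> Q \<Longrightarrow> dot d (f u) (f u) = 1" 
    and ind: "\<And>u w. u \<in> P \<union> Q \<Longrightarrow> w \<in> P \<union> Q \<Longrightarrow> u \<noteq> w \<Longrightarrow> dot d (f u) (f w) = \<alpha>"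
    and v: "dot d v v = 1" "\<And>u. u \<in> P \<Longrightarrow> dot d v (f u) = - \<alpha>" "\<And>u. u \<in> Q \<Longrightarrow> dot d v (f u) = \<alpha>"
  shows "4 * \<alpha>\<^sup>2 \<le> (1 - \<alpha>) * (1 / card P + 1 / card Q)"
proof -
  define p q where "p = real (card P)" and "q = real (card Q)"
  have pq: "p > 0" "q > 0" using P Q by (auto simp: p_def q_def card_gt_0_iff)
  define x where "x u = (if u \<in> P then 1 / p else - 1 / q)" for u
  define s where "s = (\<lambda>c. \<Sum>w\<in>P\<union>Q. x w * f w c)"
  have xQ: "x u = - 1 / q" if "u \<in> Q" for u using that PQ by (auto simp: x_def)
  have xP: "x u = 1 / p" if "u \<in> P" for u using that by (auto simp: x_def)
  have "dot d v s = (\<Sum>w\<in>P. x w * dot d v (f w)) + (\<Sum>w\<in>Q. x w * dot d v (f w))"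
    unfolding s_def dot_sum_right using P Q PQ by (simp add: sum.union_disjoint)
  also have "(\<Sum>w\<in>P. x w * dot d v (f w)) = (\<Sum>w\<in>P. 1 / p * (-\<alpha>))"
    using v xP by (intro sum.cong) auto
  also have "(\<Sum>w\<in>Q. x w * dot d v (f w)) = (\<Sum>w\<in>Q. - 1 / q * \<alpha>)"
    using v xQ by (intro sum.cong) auto
  finally have vs: "dot d v s = - 2 * \<alpha>" using pq by (simp add: p_def q_def)
  have "dot d s s = (\<Sum>u\<in>P. \<Sum>w\<in>P. x u * x w * dot d (f u) (f w))
     + 2 * (\<Sum>u\<in>P. \<Sum>w\<in>Q. x u * x w * dot d (f u) (f w))
     + (\<Sum>u\<in>Q. \<Sum>w\<in>Q. x u * x w * dot d (f u) (f w))"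
    unfolding s_def dot_sum_sum using P Q PQ
    by (intro quadratic_form_split) (auto simp: dot_commute mult.commute)
  also have "(\<Sum>u\<in>P. \<Sum>w\<in>P. x u * x w * dot d (f u) (f w)) 
      = 1 / p\<^sup>2 * (\<Sum>u\<in>P. \<Sum>w\<in>P. dot d (f u) (f w))"
    unfolding sum_distrib_left using xP by (intro sum.cong) (auto simp: power2_eq_square)
  also have "(\<Sum>u\<in>P. \<Sum>w\<in>P. dot d (f u) (f w)) = p * (1 + (p - 1) * \<alpha>)"
    unfolding p_def using P unit ind by (intro dot_sum_const) auto
  also have "(\<Sum>u\<in>Q. \<Sum>w\<in>Q. x u * x w * dot d (f u) (f w)) 
      = 1 / q\<^sup>2 * (\<Sum>u\<in>Q. \<Sum>w\<in>Q. dot d (f u) (f w))"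
    unfolding sum_distrib_left using xQ by (intro sum.cong) (auto simp: power2_eq_square)
  also have "(\<Sum>u\<in>Q. \<Sum>w\<in>Q. dot d (f u) (f w)) = q * (1 + (q - 1) * \<alpha>)"
    unfolding q_def using Q unit ind by (intro dot_sum_const) auto
  also have "(\<Sum>u\<in>P. \<Sum>w\<in>Q. x u * x w * dot d (f u) (f w)) = (\<Sum>u\<in>P. \<Sum>w\<in>Q. - \<alpha> / (p * q))"
  proof (intro sum.cong refl)
    fix u w assume "u \<in> P" "w \<in> Q"
    moreover then have "u \<noteq> w" using PQ by auto
    ultimately show "x u * x w * dot d (f u) (f w) = - \<alpha> / (p * q)"
      using xP xQ ind by simp
  qed
  also have "\<dots> = - \<alpha>" using pq by (simp add: p_def q_def)
  finally have "dot d s s = 1 / p\<^sup>2 * (p * (1 + (p - 1) * \<alpha>)) + 2 * - \<alpha> + 1 / q\<^sup>2 * (q * (1 + (q - 1) * \<alpha>))" .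
  \<comment> \<open>The weights sum to zero, so the constant part \<alpha> of the Gram matrix
    cancels and only the diagonal excess \<open>1 - \<alpha>\<close> remains.\<close>
  also have "\<dots> = (1 - \<alpha>) * (1 / p + 1 / q)"
    using pq by (simp add: field_simps power2_eq_square)
  finally have ss: "dot d s s = (1 - \<alpha>) * (1 / p + 1 / q)" .
  show ?thesis using dot_Cauchy_Schwarz[of d v s] unfolding vs ss v(1) 
    by (simp add: p_def q_def power2_eq_square)
qed

text \<open>The star from \<open>v\<close> to \<open>Y\<close> has spectral radius \<open>sqrt (card Y)\<close>; the set \<open>I\<close> only serves to
  balance the coefficient sum at negligible cost.\<close>

lemma star_bounded:
  assumes Y: "finite Y" "card Y = m" and I: "finite I" "card I \<ge> 4 * m" 
    and disj: "Y \<inter> I = {}" "v \<notin> Y" "v \<notin> I" and m: "m > 0"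
    and unit: "\<And>u. u \<in> insert v (Y \<union> I) \<Longrightarrow> dot d (f u) (f u) = 1"
    and neg: "\<And>y. y \<in> Y \<Longrightarrow> dot d (f v) (f y) = - \<alpha>"
    and pos: "\<And>u. u \<in> I \<Longrightarrow> dot d (f v) (f u) = \<alpha>"
      "\<And>u w. u \<in> Y \<union> I \<Longrightarrow> w \<in> Y \<union> I \<Longrightarrow> u \<noteq> w \<Longrightarrow> dot d (f u) (f w) = \<alpha>"
    and \<alpha>: "0 < \<alpha>" "\<alpha> < 1"
  shows "sqrt m \<le> (1 - \<alpha>) / \<alpha>"
proof -
  define L where "L = real (card I)"
  \<comment> \<open>Weight \<open>a\<close> at the centre and 1 on the leaves is the top eigenvector
    of the star.\<close>
  define a where "a = sqrt (real m)"
  have a: "a > 0" "a * a = m" using m by (auto simp: a_def)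
  have L: "L \<ge> 4 * m" "L > 0" using I m by (auto simp: L_def)
  define b where "b = (a + m) / L"
  define x where "x u = (if u = v then a else if u \<in> Y then 1 else - b)" for u
  define s where "s = (\<lambda>c. \<Sum>w\<in>insert v (Y\<union>I). x w * f w c)"
  define g where "g u w = x u * x w * dot d (f u) (f w)" for u w
  have gs: "g u w = g w u" for u w unfolding g_def by (simp add: dot_commute mult_ac)
  have xs: "x v = a" "\<And>u. u \<in> Y \<Longrightarrow> x u = 1" "\<And>u. u \<in> I \<Longrightarrow> x u = - b"
    using disj by (auto simp: x_def)
  have "dot d s s = (\<Sum>u\<in>{v} \<union> (Y \<union> I). \<Sum>w\<in>{v} \<union> (Y \<union> I). g u w)"
    unfolding s_def dot_sum_sum g_def by simp
  also have "\<dots> = g v v + 2 * ((\<Sum>w\<in>Y. g v w) + (\<Sum>w\<in>I. g v w)) 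
     + ((\<Sum>u\<in>Y. \<Sum>w\<in>Y. g u w) + 2 * (\<Sum>u\<in>Y. \<Sum>w\<in>I. g u w) + (\<Sum>u\<in>I. \<Sum>w\<in>I. g u w))"
  proof -
    have "(\<Sum>u\<in>{v} \<union> (Y \<union> I). \<Sum>w\<in>{v} \<union> (Y \<union> I). g u w)
      = (\<Sum>u\<in>{v}. \<Sum>w\<in>{v}. g u w) + 2 * (\<Sum>u\<in>{v}. \<Sum>w\<in>Y \<union> I. g u w) + (\<Sum>u\<in>Y \<union> I. \<Sum>w\<in>Y \<union> I. g u w)"
      using Y I disj gs by (intro quadratic_form_split) auto
    moreover have "(\<Sum>u\<in>Y \<union> I. \<Sum>w\<in>Y \<union> I. g u w)
      = (\<Sum>u\<in>Y. \<Sum>w\<in>Y. g u w) + 2 * (\<Sum>u\<in>Y. \<Sum>w\<in>I. g u w) + (\<Sum>u\<in>I. \<Sum>w\<in>I. g u w)"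
      using Y I disj gs by (intro quadratic_form_split) auto
    moreover have "(\<Sum>w\<in>Y \<union> I. g v w) = (\<Sum>w\<in>Y. g v w) + (\<Sum>w\<in>I. g v w)"
      using Y I disj by (simp add: sum.union_disjoint)
    ultimately show ?thesis by simp
  qed
  also have "g v v = a\<^sup>2" using unit unfolding g_def xs by (simp add: power2_eq_square)
  also have "(\<Sum>w\<in>Y. g v w) = (\<Sum>w\<in>Y. - a * \<alpha>)"
    unfolding g_def using xs neg by (intro sum.cong) auto
  also have "(\<Sum>w\<in>I. g v w) = (\<Sum>w\<in>I. - a * b * \<alpha>)"
    unfolding g_def using xs pos by (intro sum.cong) auto
  also have "(\<Sum>u\<in>Y. \<Sum>w\<in>Y. g u w) = (\<Sum>u\<in>Y. \<Sum>w\<in>Y. dot d (f u) (f w))"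
    unfolding g_def using xs by (intro sum.cong) auto
  also have "\<dots> = card Y * (1 + (real (card Y) - 1) * \<alpha>)"
    using Y unit pos by (intro dot_sum_const) auto
  also have "(\<Sum>u\<in>I. \<Sum>w\<in>I. g u w) = b\<^sup>2 * (\<Sum>u\<in>I. \<Sum>w\<in>I. dot d (f u) (f w))"
    unfolding g_def sum_distrib_left using xs by (intro sum.cong) (auto simp: power2_eq_square)
  also have "(\<Sum>u\<in>I. \<Sum>w\<in>I. dot d (f u) (f w)) = card I * (1 + (real (card I) - 1) * \<alpha>)"
    using I unit pos by (intro dot_sum_const) auto
  also have "(\<Sum>u\<in>Y. \<Sum>w\<in>I. g u w) = (\<Sum>u\<in>Y. \<Sum>w\<in>I. - b * \<alpha>)"
  proof (intro sum.cong refl)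
    fix u w assume "u \<in> Y" "w \<in> I"
    moreover then have "u \<noteq> w" using disj by auto
    ultimately show "g u w = - b * \<alpha>" unfolding g_def using xs pos by simp
  qed
  finally have "dot d s s = a\<^sup>2 + 2 * (m * (- a * \<alpha>) + L * (- a * b * \<alpha>))
     + (m * (1 + (real m - 1) * \<alpha>) + 2 * (m * (L * (- b * \<alpha>))) + b\<^sup>2 * (L * (1 + (L - 1) * \<alpha>)))"
    using Y unfolding L_def by simp
  \<comment> \<open>Diagonal excess, constant part \<alpha>, and the correction for the
    \<open>m\<close> edges, whose entries are \<open>- \<alpha>\<close> instead of \<alpha>. The
    choice of \<open>b\<close> makes the middle term vanish.\<close>
  also have "\<dots> = (1 - \<alpha>) * (a * a + m + b * b * L) + \<alpha> * (a + m - b * L)\<^sup>2 - 4 * \<alpha> * m * a"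
    by (simp add: algebra_simps power2_eq_square)
  also have "a + m - b * L = 0" using L unfolding b_def by simp
  also have "a * a + m = 2 * m" using a by simp
  finally have "dot d s s = (1 - \<alpha>) * (2 * m + b * b * L) - 4 * \<alpha> * m * a" by simp
  moreover
  \<comment> \<open>Here \<open>card I \<ge> 4 * m\<close> enters:
    \<open>(a + m)\<^sup>2 \<le> 4 * m\<^sup>2 \<le> m * L\<close>.\<close>
  have "b * b * L \<le> 2 * m"
  proof -
    have "a \<le> m" using m unfolding a_def by (simp add: real_sqrt_le_iff[of "real m" "(real m)\<^sup>2", simplified] real_le_lsqrt power2_eq_square)
    then have "(a + m) * (a + m) \<le> (2 * real m) * (2 * real m)" using a by (intro mult_mono) auto
    also have "\<dots> \<le> m * L" using L m by (simp add: mult_left_mono algebra_simps)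
    finally have "(a + m) * (a + m) / L \<le> m" using L by (simp add: pos_divide_le_eq)
    then have "b * b * L \<le> m" using L unfolding b_def by simp
    then show ?thesis using m by linarith
  qed
  then have "(1 - \<alpha>) * (2 * m + b * b * L) \<le> (1 - \<alpha>) * (4 * m)"
    using \<alpha> by (intro mult_left_mono) auto
  ultimately have "0 \<le> (1 - \<alpha>) * (4 * m) - 4 * \<alpha> * m * a"
    using dot_self_nonneg[of d s] by simp
  then have "\<alpha> * a * (4 * m) \<le> (1 - \<alpha>) * (4 * m)" by (simp add: algebra_simps)
  then have "\<alpha> * a \<le> 1 - \<alpha>" using m by (simp add: mult_le_cancel_right)
  then show ?thesis using \<alpha> unfolding a_def by (simp add: field_simps)
qed

text \<open>Ramsey applied to the pairs with inner product \<alpha>: the alternative to a clique is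
  a set with all inner products \<open>- \<alpha>\<close>, which
  \<open>negative_clique_bounded\<close> keeps small. The number \<open>R\<close> serves all
  dimensions \<open>d\<close> at once.\<close>

lemma large_independent_set:
  fixes \<alpha> :: real assumes "\<alpha> > 0"
  shows "\<exists>R. \<forall>(V::'a set) f d. finite V \<and> card V \<ge> R \<and> (\<forall>u\<in>V. dot d (f u) (f u) = 1) \<and>
    (\<forall>u\<in>V. \<forall>w\<in>V. u \<noteq> w \<longrightarrow> \<bar>dot d (f u) (f w)\<bar> = \<alpha>) \<longrightarrow>
    (\<exists>I\<subseteq>V. card I = L \<and> (\<forall>u\<in>I. \<forall>w\<in>I. u \<noteq> w \<longrightarrow> dot d (f u) (f w) = \<alpha>))"
proof -
  define m where "m = nat \<lceil>1 / \<alpha> + 2\<rceil>"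
  have m: "real m > 1 / \<alpha> + 1" unfolding m_def by linarith
  obtain R where R: "\<And>(V::'a set) (E::'a set set). finite V \<Longrightarrow> card V \<ge> R \<Longrightarrow>
      (\<exists>I \<subseteq> V. card I = L \<and> clique I E \<or> card I = m \<and> indep I E)"
    using ramsey2[of L m, where 'a='a] by blast
  show ?thesis
  proof (intro exI[of _ R] allI impI; elim conjE)
    fix V :: "'a set" and f :: "'a \<Rightarrow> nat \<Rightarrow> real" and d
    assume V: "finite V" "card V \<ge> R" "\<forall>u\<in>V. dot d (f u) (f u) = 1"
      "\<forall>u\<in>V. \<forall>w\<in>V. u \<noteq> w \<longrightarrow> \<bar>dot d (f u) (f w)\<bar> = \<alpha>"
    define E where "E = {{u, w} | u w. dot d (f u) (f w) = \<alpha>}"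
    have E: "{u, w} \<in> E \<longleftrightarrow> dot d (f u) (f w) = \<alpha>" for u w
      unfolding E_def by (auto simp: doubleton_eq_iff dot_commute)
    obtain I where I: "I \<subseteq> V" "card I = L \<and> clique I E \<or> card I = m \<and> indep I E"
      using R[OF V(1,2)] by blast
    have "\<not> (card I = m \<and> indep I E)"
    proof
      assume *: "card I = m \<and> indep I E"
      have "card I \<le> 1 / \<alpha> + 1"
      proof (rule negative_clique_bounded)
        show "finite I" using I V finite_subset by blast
        fix u w assume "u \<in> I" "w \<in> I" "u \<noteq> w"
        then have "dot d (f u) (f w) \<noteq> \<alpha>" "\<bar>dot d (f u) (f w)\<bar> = \<alpha>"
          using * V(4) I(1) E unfolding indep_def by blast+
        then show "dot d (f u) (f w) = - \<alpha>" by linarith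
      qed (use V I assms in auto)
      then show False using m * by simp
    qed
    then show "\<exists>I\<subseteq>V. card I = L \<and> (\<forall>u\<in>I. \<forall>w\<in>I. u \<noteq> w \<longrightarrow> dot d (f u) (f w) = \<alpha>)"
      using I E unfolding clique_def by blast
  qed
qed

text \<open>Many negative neighbours of \<open>v\<close> outside \<open>I\<close> would contain
  \<open>m\<close> leaves of a star. Removing from \<open>I\<close> the vertex \<open>v\<close> and
  the at most \<open>c\<close> negative neighbours of each of \<open>v\<close> and the leaves costs
  \<open>c * (m + 1) + 1\<close> vertices and leaves the \<open>4 * m\<close> that
  \<open>star_bounded\<close> wants.\<close>

lemma degree_bounded_given_independent_set:
  assumes V: "finite V" "\<And>u. u \<in> V \<Longrightarrow> dot d (h u) (h u) = 1"
      "\<And>u w. u \<in> V \<Longrightarrow> w \<in> V \<Longrightarrow> u \<noteq> w \<Longrightarrow> \<bar>dot d (h u) (h w)\<bar> = \<alpha>"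
    and I: "I \<subseteq> V" "card I \<ge> 4 * m + c * (m + 1) + 1"
      "\<And>u w. u \<in> I \<Longrightarrow> w \<in> I \<Longrightarrow> u \<noteq> w \<Longrightarrow> dot d (h u) (h w) = \<alpha>"
      "\<And>u. u \<in> V - I \<Longrightarrow> card {w \<in> I. dot d (h u) (h w) < 0} \<le> c"
    and \<alpha>: "0 < \<alpha>" "\<alpha> < 1" and m: "m > 0" "sqrt m > (1 - \<alpha>) / \<alpha>"
    and R: "\<And>U. U \<subseteq> V \<Longrightarrow> card U \<ge> R \<Longrightarrow>
      \<exists>Y\<subseteq>U. card Y = m \<and> (\<forall>u\<in>Y. \<forall>w\<in>Y. u \<noteq> w \<longrightarrow> dot d (h u) (h w) = \<alpha>)"
    and v: "v \<in> V"
  shows "card {w \<in> V. w \<noteq> v \<and> dot d (h v) (h w) < 0} \<le> R + c"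
proof -
  define N where "N = {w \<in> V. w \<noteq> v \<and> dot d (h v) (h w) < 0}"
  define neg where "neg u = {w \<in> I. w \<noteq> u \<and> dot d (h u) (h w) < 0}" for u
  have fI: "finite I" using I V finite_subset by blast
  have neg: "card (neg u) \<le> c" "finite (neg u)" if "u \<in> V" for u
  proof -
    show "finite (neg u)" using fI by (simp add: neg_def)
    show "card (neg u) \<le> c"
    proof (cases "u \<in> I")
      case True
      then have "neg u = {}" unfolding neg_def using I(3)[of u] \<alpha> by fastforce
      then show ?thesis by simp
    next
      case False
      then have "card {w \<in> I. dot d (h u) (h w) < 0} \<le> c" using I(4) that by blast
      moreover have "card (neg u) \<le> card {w \<in> I. dot d (h u) (h w) < 0}"
        unfolding neg_def using fI by (intro card_mono) auto
      ultimately show ?thesis by linarith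
    qed
  qed
  have sgn: "dot d (h u) (h w) = \<alpha> \<or> dot d (h u) (h w) = - \<alpha>" if "u \<in> V" "w \<in> V" "u \<noteq> w" for u w
    using V(3)[OF that] by linarith
  have "\<not> R \<le> card (N - I)"
  proof
    assume "R \<le> card (N - I)"
    then obtain Y where Y: "Y \<subseteq> N - I" "card Y = m"
      "\<And>u w. u \<in> Y \<Longrightarrow> w \<in> Y \<Longrightarrow> u \<noteq> w \<Longrightarrow> dot d (h u) (h w) = \<alpha>"
      using R[of "N - I"] unfolding N_def by blast
    have YV: "Y \<subseteq> V" "v \<notin> Y" using Y unfolding N_def by auto
    then have fY: "finite Y" using V finite_subset by blast
    define I' where "I' = I - ({v} \<union> (\<Union>u\<in>insert v Y. neg u))"
    have "card ({v} \<union> (\<Union>u\<in>insert v Y. neg u)) \<le> 1 + card (\<Union>u\<in>insert v Y. neg u)"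
      by (rule order_trans[OF card_Un_le]) simp
    also have "card (\<Union>u\<in>insert v Y. neg u) \<le> (\<Sum>u\<in>insert v Y. card (neg u))"
      using fY by (intro card_UN_le) auto
    also have "\<dots> \<le> (\<Sum>u\<in>insert v Y. c)" using neg v YV by (intro sum_mono) auto
    also have "\<dots> = c * (m + 1)" using fY YV Y by simp
    finally have "card ({v} \<union> (\<Union>u\<in>insert v Y. neg u)) \<le> 1 + c * (m + 1)" by simp
    then have I'4: "card I' \<ge> 4 * m"
      unfolding I'_def using I(2) diff_card_le_card_Diff[of "{v} \<union> (\<Union>u\<in>insert v Y. neg u)" I] neg v YV fY
      by (simp add: subset_eq)
    have "sqrt m \<le> (1 - \<alpha>) / \<alpha>"
    proof (rule star_bounded[OF fY Y(2) _ I'4])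
      show "finite I'" unfolding I'_def using fI by simp
      show "Y \<inter> I' = {}" "v \<notin> Y" "v \<notin> I'" unfolding I'_def using Y YV by auto
      fix y assume "y \<in> Y"
      then have "y \<in> V" "dot d (h v) (h y) < 0" "y \<noteq> v" using Y unfolding N_def by auto
      then show "dot d (h v) (h y) = - \<alpha>" using sgn[of v y] v \<alpha> by auto
    next
      fix u assume u: "u \<in> I'"
      then have "\<not> dot d (h v) (h u) < 0" "u \<noteq> v" "u \<in> V" unfolding I'_def neg_def using I by auto
      then show "dot d (h v) (h u) = \<alpha>" using sgn[of v u] v \<alpha> by auto
    next
      have YI: "dot d (h u) (h w) = \<alpha>" if "u \<in> Y" "w \<in> I'" for u w
      proof -
        have uw: "u \<noteq> w" "w \<in> I" "u \<in> V" using that Y YV unfolding I'_def by auto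
        then have "\<not> dot d (h u) (h w) < 0" using that unfolding I'_def neg_def by auto
        then show ?thesis using sgn[of u w] uw I \<alpha> by auto
      qed
      fix u w assume "u \<in> Y \<union> I'" "w \<in> Y \<union> I'" "u \<noteq> w"
      then show "dot d (h u) (h w) = \<alpha>"
        using Y(3) YI I(3) dot_commute[of d "h u" "h w"] unfolding I'_def by auto
    next
      fix u assume "u \<in> insert v (Y \<union> I')"
      then show "dot d (h u) (h u) = 1" using V(2) v YV I unfolding I'_def by auto
    qed (use m \<alpha> in auto)
    then show False using m by simp
  qed
  moreover have "card (N \<inter> I) \<le> c"
  proof -
    have "card (N \<inter> I) \<le> card (neg v)" using neg[OF v] by (intro card_mono) (auto simp: N_def neg_def)
    then show ?thesis using neg[OF v] by linarith
  qed
  moreover have "card N \<le> card (N - I) + card (N \<inter> I)"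
    by (metis Un_Diff_Int card_Un_le)
  ultimately show ?thesis unfolding N_def by linarith
qed

theorem bounded_degree_switching:
  fixes \<alpha> :: real assumes \<alpha>: "0 < \<alpha>" "\<alpha> < 1"
  shows "\<exists>\<Delta>. \<forall>(V::'a set) f d. finite V \<and> (\<forall>u\<in>V. dot d (f u) (f u) = 1) \<and>
    (\<forall>u\<in>V. \<forall>w\<in>V. u \<noteq> w \<longrightarrow> \<bar>dot d (f u) (f w)\<bar> = \<alpha>) \<longrightarrow>
    (\<exists>\<sigma>. (\<forall>u. \<sigma> u = 1 \<or> \<sigma> u = (-1::real)) \<and>
      (\<forall>u\<in>V. card {w \<in> V. w \<noteq> u \<and> dot d (\<lambda>c. \<sigma> u * f u c) (\<lambda>c. \<sigma> w * f w c) < 0} \<le> \<Delta>))"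
proof -
  \<comment> \<open>With more than \<open>c\<close> vertices of each sign,
    \<open>mixed_signs_bounded\<close> fails; with \<open>m\<close> leaves,
    \<open>star_bounded\<close> fails.\<close>
  define c where "c = nat \<lceil>(1 - \<alpha>) / (2 * \<alpha>\<^sup>2)\<rceil>"
  define m where "m = nat \<lceil>((1 - \<alpha>) / \<alpha>)\<^sup>2\<rceil> + 1"
  have "real m > ((1 - \<alpha>) / \<alpha>)\<^sup>2" unfolding m_def by linarith
  then have m: "m > 0" "sqrt m > (1 - \<alpha>) / \<alpha>"
    unfolding m_def using \<alpha> by (auto intro: real_less_rsqrt)
  define L where "L = 4 * m + c * (m + 1) + 1"
  obtain R where R: "\<forall>(V::'a set) f d. finite V \<and> card V \<ge> R \<and> (\<forall>u\<in>V. dot d (f u) (f u) = 1) \<and>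
    (\<forall>u\<in>V. \<forall>w\<in>V. u \<noteq> w \<longrightarrow> \<bar>dot d (f u) (f w)\<bar> = \<alpha>) \<longrightarrow>
    (\<exists>I\<subseteq>V. card I = m \<and> (\<forall>u\<in>I. \<forall>w\<in>I. u \<noteq> w \<longrightarrow> dot d (f u) (f w) = \<alpha>))"
    using large_independent_set[OF \<alpha>(1)] by blast
  obtain R' where R': "\<forall>(V::'a set) f d. finite V \<and> card V \<ge> R' \<and> (\<forall>u\<in>V. dot d (f u) (f u) = 1) \<and>
    (\<forall>u\<in>V. \<forall>w\<in>V. u \<noteq> w \<longrightarrow> \<bar>dot d (f u) (f w)\<bar> = \<alpha>) \<longrightarrow>
    (\<exists>I\<subseteq>V. card I = L \<and> (\<forall>u\<in>I. \<forall>w\<in>I. u \<noteq> w \<longrightarrow> dot d (f u) (f w) = \<alpha>))"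
    using large_independent_set[OF \<alpha>(1)] by blast
  show ?thesis
  \<comment> \<open>\<open>R'\<close> covers vertex sets too small to contain the independent set,
    where every degree is below \<open>R'\<close> anyway.\<close>
  proof (intro exI[of _ "max R' (R + c)"] allI impI; elim conjE)
    fix V :: "'a set" and f :: "'a \<Rightarrow> nat \<Rightarrow> real" and d
    assume V: "finite V" "\<forall>u\<in>V. dot d (f u) (f u) = 1"
      "\<forall>u\<in>V. \<forall>w\<in>V. u \<noteq> w \<longrightarrow> \<bar>dot d (f u) (f w)\<bar> = \<alpha>"
    show "\<exists>\<sigma>. (\<forall>u. \<sigma> u = 1 \<or> \<sigma> u = -1) \<and>
      (\<forall>u\<in>V. card {w \<in> V. w \<noteq> u \<and> dot d (\<lambda>c. \<sigma> u * f u c) (\<lambda>c. \<sigma> w * f w c) < 0} \<le> max R' (R + c))"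
    proof (cases "card V \<ge> R'")
      case False
      have "card {w \<in> V. P w} \<le> max R' (R + c)" for P
        using card_mono[OF V(1), of "{w \<in> V. P w}"] False by auto
      then show ?thesis by (intro exI[of _ "\<lambda>_. 1"]) simp
    next
      case True
      then have "\<exists>I\<subseteq>V. card I = L \<and> (\<forall>u\<in>I. \<forall>w\<in>I. u \<noteq> w \<longrightarrow> dot d (f u) (f w) = \<alpha>)"
        using R'[THEN spec, of V, THEN spec, of f, THEN spec, of d] V by (elim mp) (intro conjI)
      then obtain I where I: "I \<subseteq> V" "card I = L" "\<And>u w. u \<in> I \<Longrightarrow> w \<in> I \<Longrightarrow> u \<noteq> w \<Longrightarrow> dot d (f u) (f w) = \<alpha>"
        by blast
      have fI: "finite I" using I V finite_subset by blast
      \<comment> \<open>A vertex outside \<open>I\<close> with more than \<open>c\<close> negative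
        neighbours in \<open>I\<close> has at most \<open>c\<close> positive ones; flipping it
        exchanges the two kinds.\<close>
      define \<sigma> where "\<sigma> u = (if u \<notin> I \<and> card {w \<in> I. dot d (f u) (f w) < 0} > c then -1 else 1 :: real)" for u
      define h where "h u = (\<lambda>c. \<sigma> u * f u c)" for u
      have hh: "dot d (h u) (h w) = \<sigma> u * \<sigma> w * dot d (f u) (f w)" for u w
        unfolding h_def by (rule dot_scale)
      have \<sigma>: "\<sigma> u = 1 \<or> \<sigma> u = -1" for u unfolding \<sigma>_def by auto
      have h1: "dot d (h u) (h u) = 1" if "u \<in> V" for u
        unfolding hh using \<sigma>[of u] V(2) that by auto
      have h2: "\<bar>dot d (h u) (h w)\<bar> = \<alpha>" if "u \<in> V" "w \<in> V" "u \<noteq> w" for u w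
        unfolding hh using \<sigma>[of u] \<sigma>[of w] V(3) that by auto
      have sI: "\<sigma> u = 1" if "u \<in> I" for u using that by (simp add: \<sigma>_def)
      have few: "card {w \<in> I. dot d (h u) (h w) < 0} \<le> c" if u: "u \<in> V - I" for u
      proof (cases "\<sigma> u = 1")
        case True
        then have "card {w \<in> I. dot d (f u) (f w) < 0} \<le> c" using u by (auto simp: \<sigma>_def split: if_splits)
        moreover have "{w \<in> I. dot d (h u) (h w) < 0} = {w \<in> I. dot d (f u) (f w) < 0}"
          using sI True unfolding hh by auto
        ultimately show ?thesis by simp
      next
        case False
        then have s: "\<sigma> u = -1" using \<sigma> by blast
        define Q where "Q = {w \<in> I. dot d (f u) (f w) < 0}"
        define P where "P = {w \<in> I. dot d (h u) (h w) < 0}"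
        have Q: "card Q > c" using False by (auto simp: \<sigma>_def Q_def split: if_splits)
        have P: "P = {w \<in> I. dot d (f u) (f w) > 0}" unfolding P_def hh using s sI by auto
        have huw: "dot d (h u) (h w) = \<alpha> \<or> dot d (h u) (h w) = - \<alpha>" if "w \<in> I" for w
        proof -
          have "u \<noteq> w" "w \<in> V" using u that I by auto
          then show ?thesis using h2[of u w] u by auto
        qed
        show ?thesis
        proof (rule ccontr)
          assume "\<not> card {w \<in> I. dot d (h u) (h w) < 0} \<le> c"
          then have cP: "card P > c" by (simp add: P_def)
          have "4 * \<alpha>\<^sup>2 \<le> (1 - \<alpha>) * (1 / card P + 1 / card Q)"
          proof (rule mixed_signs_bounded)
            show "finite P" "finite Q" "P \<inter> Q = {}" using fI P by (auto simp: Q_def)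
            show "P \<noteq> {}" "Q \<noteq> {}" using cP Q by auto
            show "dot d (h w) (h w) = 1" if "w \<in> P \<union> Q" for w
              using that I h1 unfolding P Q_def by auto
            show "dot d (h w) (h w') = \<alpha>" if "w \<in> P \<union> Q" "w' \<in> P \<union> Q" "w \<noteq> w'" for w w'
              using that I(3)[of w w'] sI[of w] sI[of w'] unfolding P Q_def hh by auto
            show "dot d (h u) (h u) = 1" using h1 u by auto
            show "dot d (h u) (h w) = - \<alpha>" if "w \<in> P" for w
              using that huw[of w] \<alpha> by (auto simp: P_def)
            show "dot d (h u) (h w) = \<alpha>" if "w \<in> Q" for w
              using that huw[of w] sI[of w] s \<alpha> by (auto simp: Q_def hh)
          qed
          also have "\<dots> \<le> (1 - \<alpha>) * (1 / (c + 1) + 1 / (c + 1))"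
            using \<alpha> cP Q by (intro mult_left_mono add_mono divide_left_mono) auto
          finally have "4 * \<alpha>\<^sup>2 * (c + 1) \<le> 2 * (1 - \<alpha>)" by (simp add: field_simps)
          moreover have "(1 - \<alpha>) / (2 * \<alpha>\<^sup>2) < real c + 1" unfolding c_def by linarith
          ultimately show False using \<alpha> by (simp add: field_simps)
        qed
      qed
      have "card {w \<in> V. w \<noteq> v \<and> dot d (h v) (h w) < 0} \<le> R + c" if v: "v \<in> V" for v
      proof (rule degree_bounded_given_independent_set[OF V(1) h1 h2 I(1) _ _ few \<alpha> m _ v])
        show "4 * m + c * (m + 1) + 1 \<le> card I" using I(2) by (simp add: L_def)
        show "dot d (h u) (h w) = \<alpha>" if "u \<in> I" "w \<in> I" "u \<noteq> w" for u w
          using that I(3) sI unfolding hh by simp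
        fix U assume U: "U \<subseteq> V" "R \<le> card U"
        then have "finite U" using V finite_subset by blast
        then show "\<exists>Y\<subseteq>U. card Y = m \<and> (\<forall>u\<in>Y. \<forall>w\<in>Y. u \<noteq> w \<longrightarrow> dot d (h u) (h w) = \<alpha>)"
        proof (intro R[THEN spec, of U, THEN spec, of h, THEN spec, of d, THEN mp] conjI ballI impI)
          show "finite U" "R \<le> card U" by fact+
        next
          fix u assume "u \<in> U" then show "dot d (h u) (h u) = 1" using h1 U(1) by blast
        next
          fix u w assume "u \<in> U" "w \<in> U" "u \<noteq> w"
          then show "\<bar>dot d (h u) (h w)\<bar> = \<alpha>" using h2 U(1) by blast
        qed
      qed auto
      then have "\<forall>u\<in>V. card {w \<in> V. w \<noteq> u \<and> dot d (\<lambda>c. \<sigma> u * f u c) (\<lambda>c. \<sigma> w * f w c) < 0} \<le> max R' (R + c)"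
        unfolding h_def by (simp only: le_max_iff_disj) blast
      with \<sigma> show ?thesis by blast
    qed
  qed
qed

section \<open>Adjacency operators\<close>

text \<open>Vectors of an induced subgraph are functions vanishing outside its vertex set, so that
  all subgraphs share one space and need no reindexing.\<close>

definition supp :: "'a set \<Rightarrow> ('a \<Rightarrow> real) \<Rightarrow> bool" where
  "supp S x \<longleftrightarrow> (\<forall>u. u \<notin> S \<longrightarrow> x u = 0)"

definition cut :: "'a set \<Rightarrow> ('a \<Rightarrow> real) \<Rightarrow> 'a \<Rightarrow> real" where
  "cut S x = (\<lambda>u. if u \<in> S then x u else 0)"

definition ind :: "'a \<Rightarrow> 'a \<Rightarrow> real" where
  "ind v = (\<lambda>u. if u = v then 1 else 0)"

lemma supp_cut [simp]: "supp S (cut S x)" by (auto simp: supp_def cut_def)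
lemma cut_supp: "supp S x \<Longrightarrow> cut S x = x" by (auto simp: supp_def cut_def)
lemma supp_mono: "supp S x \<Longrightarrow> S \<subseteq> T \<Longrightarrow> supp T x" by (auto simp: supp_def)
lemma supp_ind: "v \<in> S \<Longrightarrow> supp S (ind v)" by (auto simp: supp_def ind_def)

locale fin_graph =
  fixes V :: "'a set" and E :: "'a \<Rightarrow> 'a \<Rightarrow> bool"
  assumes fin: "finite V"
    and E_sym: "E u w \<Longrightarrow> E w u"
    and E_irrefl: "\<not> E u u"
    and E_V: "E u w \<Longrightarrow> u \<in> V"
begin

definition ip :: "('a \<Rightarrow> real) \<Rightarrow> ('a \<Rightarrow> real) \<Rightarrow> real" where
  "ip x y = (\<Sum>u\<in>V. x u * y u)"

definition A :: "('a \<Rightarrow> real) \<Rightarrow> 'a \<Rightarrow> real" where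
  "A x u = (\<Sum>w\<in>V. of_bool (E u w) * x w)"

text \<open>The adjacency operator of the subgraph induced by \<open>S\<close>, as a compression of
  \<open>A\<close>.\<close>

definition AS :: "'a set \<Rightarrow> ('a \<Rightarrow> real) \<Rightarrow> 'a \<Rightarrow> real" where
  "AS S x = cut S (A (cut S x))"

text \<open>The largest eigenvalue of the subgraph induced by \<open>S\<close> is at most \<open>\<mu>\<close>; the quadratic form
  suffices for everything below except the identification with the spectrum.\<close>

definition qle :: "real \<Rightarrow> 'a set \<Rightarrow> bool" where
  "qle \<mu> S \<longleftrightarrow> (\<forall>x. supp S x \<longrightarrow> ip x (A x) \<le> \<mu> * ip x x)"

lemma E_V2: "E u w \<Longrightarrow> w \<in> V" using E_sym E_V by blast

lemma ip_commute: "ip x y = ip y x"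
  unfolding ip_def by (simp add: mult.commute)

lemma ip_add: "ip (\<lambda>u. a * x u + b * y u) z = a * ip x z + b * ip y z"
  unfolding ip_def by (simp add: sum_distrib_left sum.distrib algebra_simps)

lemma ip_add2: "ip z (\<lambda>u. a * x u + b * y u) = a * ip z x + b * ip z y"
  using ip_add ip_commute by metis

lemma A_add: "A (\<lambda>u. a * x u + b * y u) = (\<lambda>u. a * A x u + b * A y u)"
  unfolding A_def by (simp add: sum_distrib_left sum.distrib algebra_simps)

lemma ip_A: "ip x (A y) = ip (A x) y"
proof -
  have "ip x (A y) = (\<Sum>u\<in>V. \<Sum>w\<in>V. x u * of_bool (E u w) * y w)"
    unfolding ip_def A_def by (simp add: sum_distrib_left mult_ac)
  also have "\<dots> = (\<Sum>w\<in>V. \<Sum>u\<in>V. x u * of_bool (E u w) * y w)" by (rule sum.swap)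
  also have "\<dots> = (\<Sum>w\<in>V. \<Sum>u\<in>V. x u * of_bool (E w u) * y w)"
    using E_sym by (intro sum.cong) (auto simp: of_bool_def)
  also have "\<dots> = ip (A x) y"
    unfolding ip_def A_def sum_distrib_right by (intro sum.cong refl) (simp add: mult_ac)
  finally show ?thesis .
qed

lemma ip_self_nonneg: "0 \<le> ip x x"
  unfolding ip_def by (intro sum_nonneg) auto

lemma ip_self_eq_0: "ip x x = 0 \<Longrightarrow> supp V x \<Longrightarrow> x u = 0"
  unfolding ip_def supp_def using fin by (subst (asm) sum_nonneg_eq_0_iff) auto

lemma ip_self_pos: "supp V x \<Longrightarrow> x u \<noteq> 0 \<Longrightarrow> 0 < ip x x"
  using ip_self_eq_0[of x u] ip_self_nonneg[of x] by linarith

lemma ip_ind: "v \<in> V \<Longrightarrow> ip (ind v) x = x v"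
  unfolding ip_def ind_def using fin by (simp add: if_distrib[of "\<lambda>a. a * _"] sum.delta' cong: if_cong)

lemma ip_cut: "ip (cut S x) y = ip x (cut S y)"
  unfolding ip_def cut_def by (intro sum.cong) auto

lemma ip_AS: "ip x (AS S y) = ip (AS S x) y"
  unfolding AS_def by (metis ip_cut ip_A)

lemma ip_AS_supp: "supp S x \<Longrightarrow> supp S y \<Longrightarrow> ip x (AS S y) = ip x (A y)"
  unfolding AS_def by (metis ip_cut cut_supp)

lemma AS_supp [simp]: "supp S (AS S x)" unfolding AS_def by simp

lemma AS_pow_supp: "supp S x \<Longrightarrow> supp S ((AS S ^^ r) x)"
  by (induction r) auto

lemma ip_AS_pow: "ip x ((AS S ^^ r) y) = ip ((AS S ^^ r) x) y"
proof (induction r arbitrary: x)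
  case (Suc r)
  have "ip x ((AS S ^^ Suc r) y) = ip ((AS S ^^ r) (AS S x)) y"
    using Suc by (simp add: ip_AS)
  then show ?case by (simp add: funpow_swap1)
qed simp

lemma A_mono: "(\<And>w. x w \<le> y w) \<Longrightarrow> A x u \<le> A y u"
  unfolding A_def by (intro sum_mono mult_left_mono) auto

lemma A_nonneg: "(\<And>w. 0 \<le> x w) \<Longrightarrow> 0 \<le> A x u"
  unfolding A_def by (intro sum_nonneg) auto

lemma A_ge_nbr: "(\<And>w. 0 \<le> x w) \<Longrightarrow> E u w \<Longrightarrow> x w \<le> A x u"
proof -
  assume *: "\<And>w. 0 \<le> x w" "E u w"
  have "of_bool (E u w) * x w \<le> (\<Sum>w\<in>V. of_bool (E u w) * x w)"
    using * fin E_V2 by (intro member_le_sum) auto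
  then show ?thesis using * by (simp add: A_def)
qed

lemma ip_abs: "ip (\<lambda>u. \<bar>x u\<bar>) (\<lambda>u. \<bar>x u\<bar>) = ip x x"
  unfolding ip_def by simp

lemma abs_A_le: "\<bar>A x u\<bar> \<le> A (\<lambda>u. \<bar>x u\<bar>) u"
  unfolding A_def by (rule order_trans[OF sum_abs]) (auto intro!: sum_mono simp: abs_mult)

lemma abs_ip_A_le: "\<bar>ip x (A x)\<bar> \<le> ip (\<lambda>u. \<bar>x u\<bar>) (A (\<lambda>u. \<bar>x u\<bar>))"
proof -
  have "\<bar>ip x (A x)\<bar> \<le> (\<Sum>u\<in>V. \<bar>x u * A x u\<bar>)" unfolding ip_def by (rule sum_abs)
  also have "\<dots> \<le> ip (\<lambda>u. \<bar>x u\<bar>) (A (\<lambda>u. \<bar>x u\<bar>))"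
    unfolding ip_def abs_mult by (intro sum_mono mult_left_mono abs_A_le) auto
  finally show ?thesis .
qed

lemma ip_A_add:
  "ip (\<lambda>u. a * x u + b * y u) (A (\<lambda>u. a * x u + b * y u))
     = a\<^sup>2 * ip x (A x) + 2 * a * b * ip y (A x) + b\<^sup>2 * ip y (A y)"
proof -
  have "ip x (A y) = ip y (A x)" by (metis ip_A ip_commute)
  then show ?thesis
    unfolding A_add ip_add ip_add2 by (simp add: algebra_simps power2_eq_square)
qed

lemma ip_self_add:
  "ip (\<lambda>u. a * x u + b * y u) (\<lambda>u. a * x u + b * y u)
     = a\<^sup>2 * ip x x + 2 * a * b * ip y x + b\<^sup>2 * ip y y"
  unfolding ip_add ip_add2 using ip_commute[of x y] by (simp add: algebra_simps power2_eq_square)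

lemma supp_comb: "supp S x \<Longrightarrow> supp S y \<Longrightarrow> supp S (\<lambda>u. a * x u + b * y u)"
  by (auto simp: supp_def)

text \<open>A maximizer of the Rayleigh quotient is stationary. The variation is in the direction
  \<open>ind u\<close>, which is admissible only for \<open>u\<close> in \<open>S\<close>, so the
  eigenvalue equation is obtained only there.\<close>

lemma qle_extremal:
  assumes "S \<subseteq> V" "qle \<mu> S" "supp S y" "\<mu> * ip y y \<le> ip y (A y)" "u \<in> S"
  shows "A y u = \<mu> * y u"
proof -
  have 0: "ip y (A y) = \<mu> * ip y y" using assms unfolding qle_def by (intro antisym) auto
  have u: "u \<in> V" "supp S (ind u)" using assms by (auto intro: supp_ind)
  have "0 \<le> 2 * t * (\<mu> * ip (ind u) y - ip (ind u) (A y)) + t\<^sup>2 * (\<mu> * ip (ind u) (ind u) - ip (ind u) (A (ind u)))" for t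
  proof -
    have "supp S (\<lambda>v. 1 * y v + t * ind u v)" using assms u by (intro supp_comb) auto
    then have "ip (\<lambda>v. 1 * y v + t * ind u v) (A (\<lambda>v. 1 * y v + t * ind u v))
       \<le> \<mu> * ip (\<lambda>v. 1 * y v + t * ind u v) (\<lambda>v. 1 * y v + t * ind u v)"
      using assms(2) unfolding qle_def by blast
    then show ?thesis unfolding ip_A_add ip_self_add using 0 by (simp add: algebra_simps)
  qed
  then have "\<mu> * ip (ind u) y - ip (ind u) (A y) = 0" by (rule linear_term_vanishes)
  then show ?thesis using u by (simp add: ip_ind)
qed

text \<open>For a nonnegative matrix the upper bound \<mu> on the form also bounds its absolute
  value. Applying this to \<open>\<mu> * x + z\<close> and \<open>\<mu> * x - z\<close> with
  \<open>z = AS S x\<close> and adding up gives the operator norm without eigenvectors.\<close>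

lemma qle_AS_norm:
  assumes "qle \<mu> S" "\<mu> > 0" "supp S x"
  shows "ip (AS S x) (AS S x) \<le> \<mu>\<^sup>2 * ip x x"
proof -
  define z where "z = AS S x"
  have z: "supp S z" unfolding z_def by simp
  have q: "\<bar>ip y (A y)\<bar> \<le> \<mu> * ip y y" if "supp S y" for y
  proof -
    have "supp S (\<lambda>u. \<bar>y u\<bar>)" using that by (auto simp: supp_def)
    then show ?thesis using abs_ip_A_le[of y] assms(1) ip_abs[of y] unfolding qle_def
      by (metis order_trans)
  qed
  have 1: "ip z (A x) = ip z z" unfolding z_def using assms(3) by (metis ip_AS_supp AS_supp)
  have p: "ip (\<lambda>u. \<mu> * x u + 1 * z u) (A (\<lambda>u. \<mu> * x u + 1 * z u))
      \<le> \<mu> * ip (\<lambda>u. \<mu> * x u + 1 * z u) (\<lambda>u. \<mu> * x u + 1 * z u)"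
    using q[OF supp_comb[OF assms(3) z]] by (meson abs_le_D1)
  have m: "- ip (\<lambda>u. \<mu> * x u + (-1) * z u) (A (\<lambda>u. \<mu> * x u + (-1) * z u))
      \<le> \<mu> * ip (\<lambda>u. \<mu> * x u + (-1) * z u) (\<lambda>u. \<mu> * x u + (-1) * z u)"
    using q[OF supp_comb[OF assms(3) z]] by (meson abs_le_D2)
  have "4 * \<mu> * ip z z \<le> 2 * \<mu> * (\<mu>\<^sup>2 * ip x x + ip z z)"
    using p m unfolding ip_A_add ip_self_add 1 by (simp add: algebra_simps)
  then have "2 * \<mu> * ip z z \<le> 2 * \<mu> * (\<mu>\<^sup>2 * ip x x)" by (simp add: algebra_simps)
  then show ?thesis using assms(2) unfolding z_def by simp
qed

lemma qle_AS_pow_norm: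
  assumes "qle \<mu> S" "\<mu> > 0" "supp S x"
  shows "ip ((AS S ^^ r) x) ((AS S ^^ r) x) \<le> \<mu> ^ (2 * r) * ip x x"
proof (induction r)
  case (Suc r)
  have "ip ((AS S ^^ Suc r) x) ((AS S ^^ Suc r) x) \<le> \<mu>\<^sup>2 * ip ((AS S ^^ r) x) ((AS S ^^ r) x)"
    using qle_AS_norm[OF assms(1,2)] AS_pow_supp[OF assms(3)] by simp
  also have "\<dots> \<le> \<mu>\<^sup>2 * (\<mu> ^ (2 * r) * ip x x)" using Suc by (intro mult_left_mono) auto
  finally show ?case by (simp add: power2_eq_square mult_ac)
qed simp

section \<open>Walks and balls\<close>

text \<open>Walks of length \<open>t\<close> inside \<open>S\<close> are the pairs in
  \<open>Rel S ^^ t\<close>; the value at \<open>w\<close> of \<open>(AS S ^^ t) (ind u)\<close>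
  counts those from \<open>u\<close> to \<open>w\<close>.\<close>

definition Rel :: "'a set \<Rightarrow> ('a \<times> 'a) set" where
  "Rel S = {(u, w). E u w \<and> u \<in> S \<and> w \<in> S}"

lemma Rel_sym: "(u, w) \<in> Rel S ^^ t \<Longrightarrow> (w, u) \<in> Rel S ^^ t"
proof (induction t arbitrary: w)
  case (Suc t)
  then obtain v where "(u, v) \<in> Rel S ^^ t" "(v, w) \<in> Rel S" by auto
  then have "(v, u) \<in> Rel S ^^ t" "(w, v) \<in> Rel S" using Suc.IH E_sym by (auto simp: Rel_def)
  then show ?case by (meson relpow_Suc_I2)
qed auto

lemma AS_nonneg: "(\<And>w. 0 \<le> x w) \<Longrightarrow> 0 \<le> AS S x u"
  unfolding AS_def cut_def by (auto intro!: A_nonneg)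

lemma AS_pow_nonneg: "(\<And>w. 0 \<le> x w) \<Longrightarrow> 0 \<le> (AS S ^^ r) x u"
  by (induction r arbitrary: u) (auto intro!: AS_nonneg)

lemma AS_mono:
  assumes "S \<subseteq> T" "\<And>w. 0 \<le> x w" "\<And>w. x w \<le> y w"
  shows "AS S x u \<le> AS T y u"
proof -
  have y: "\<And>w. 0 \<le> y w" using assms order_trans by blast
  have "A (cut S x) u \<le> A (cut T y) u"
    using assms y by (intro A_mono) (auto simp: cut_def)
  then show ?thesis
    using assms(1) AS_nonneg[of y T u] y unfolding AS_def by (auto simp: cut_def)
qed

lemma AS_pow_mono:
  assumes "S \<subseteq> T" "\<And>w. 0 \<le> x w"
  shows "(AS S ^^ r) x u \<le> (AS T ^^ r) x u"
  by (induction r arbitrary: u) (auto intro!: AS_mono assms AS_pow_nonneg)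

text \<open>A surplus of one walk at \<open>w\<close> is passed on to each neighbour of
  \<open>w\<close> in \<open>T\<close>.\<close>

lemma AS_gap_step:
  assumes "S \<subseteq> T" "\<And>w. 0 \<le> x w" "\<And>w. x w \<le> y w" "x w + 1 \<le> y w" "(w, w') \<in> Rel T"
  shows "AS S x w' + 1 \<le> AS T y w'"
proof -
  have y: "\<And>w. 0 \<le> y w" using assms order_trans by blast
  have w: "w \<in> T" "w' \<in> T" "E w' w" using assms(5) E_sym by (auto simp: Rel_def)
  have "AS S x w' + 1 \<le> A (cut S x) w' + 1" 
    using A_nonneg[of "cut S x" w'] assms(2) unfolding AS_def by (auto simp: cut_def)
  also have "1 \<le> A (\<lambda>u. cut T y u - cut S x u) w'"
  proof -
    have "1 \<le> cut T y w - cut S x w" using w assms(4) assms(2)[of w] by (auto simp: cut_def)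
    also have "\<dots> \<le> A (\<lambda>u. cut T y u - cut S x u) w'"
      using w assms y by (intro A_ge_nbr) (auto simp: cut_def)
    finally show ?thesis .
  qed
  also have "A (cut S x) w' + A (\<lambda>u. cut T y u - cut S x u) w' = A (cut T y) w'"
    unfolding A_def by (simp add: sum.distrib[symmetric] algebra_simps)
  finally show ?thesis using w by (simp add: AS_def cut_def)
qed

lemma walk_AS_pow: "u \<in> S \<Longrightarrow> (u, w) \<in> Rel S ^^ t \<Longrightarrow> 1 \<le> (AS S ^^ t) (ind u) w"
proof (induction t arbitrary: w)
  case (Suc t)
  then obtain v where v: "(u, v) \<in> Rel S ^^ t" "(v, w) \<in> Rel S" by auto
  have n: "0 \<le> (AS S ^^ t) (ind u) w" for w by (intro AS_pow_nonneg) (auto simp: ind_def)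
  have "AS S (\<lambda>_. 0) w + 1 \<le> AS S ((AS S ^^ t) (ind u)) w"
    using v Suc.IH[OF Suc.prems(1) v(1)] n by (intro AS_gap_step[of S S _ _ v]) auto
  moreover have "0 \<le> AS S (\<lambda>_. 0) w" by (intro AS_nonneg) simp
  ultimately show ?case by simp
qed (auto simp: ind_def)

text \<open>At the exit point \<open>w\<close> the graph on \<open>T\<close> has a walk and the
  graph on \<open>S\<close> has none. The surplus survives the remaining \<open>r - t\<close> steps
  by moving along edges of \<open>T\<close>, so its final position \<open>v\<close> is not
  controlled.\<close>

lemma AS_pow_gap:
  assumes ST: "S \<subseteq> T" and u: "u \<in> S" and w: "(u, w) \<in> Rel T ^^ t" "w \<notin> S" "t \<le> r"
  shows "\<exists>v\<in>T. (AS S ^^ r) (ind u) v + 1 \<le> (AS T ^^ r) (ind u) v"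
proof -
  have n: "0 \<le> ind u w" for w by (auto simp: ind_def)
  have "\<exists>v v'. (v, v') \<in> Rel T \<and> (AS S ^^ (t + j)) (ind u) v + 1 \<le> (AS T ^^ (t + j)) (ind u) v" for j
  proof (induction j)
    case 0
    \<comment> \<open>\<open>u\<close> lies in \<open>S\<close> and \<open>w\<close> does not, so
      the walk has a last edge, along which the surplus can step back.\<close>
    have "t > 0" using u w by (cases t) auto
    then obtain s where s: "t = Suc s" by (cases t) auto
    then obtain v where "(v, w) \<in> Rel T" using w by auto
    then have "(w, v) \<in> Rel T" using E_sym by (auto simp: Rel_def)
    moreover have "(AS S ^^ t) (ind u) w = 0"
      using AS_pow_supp[OF supp_ind[OF u]] w(2) by (auto simp: supp_def)
    moreover have "1 \<le> (AS T ^^ t) (ind u) w" using walk_AS_pow u ST w by blast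
    ultimately show ?case by (intro exI[of _ w] exI[of _ v]) simp
  next
    case (Suc j)
    then obtain v v' where v: "(v, v') \<in> Rel T" "(AS S ^^ (t + j)) (ind u) v + 1 \<le> (AS T ^^ (t + j)) (ind u) v"
      by auto
    have "(v', v) \<in> Rel T" using v E_sym by (auto simp: Rel_def)
    moreover have "(AS S ^^ Suc (t + j)) (ind u) v' + 1 \<le> (AS T ^^ Suc (t + j)) (ind u) v'"
      using v by (auto intro!: AS_gap_step[OF ST, of _ _ v] AS_pow_nonneg AS_pow_mono[OF ST] simp: n)
    ultimately show ?case by (metis add_Suc_right)
  qed
  from this[of "r - t"] w(3) obtain v v' where "(v, v') \<in> Rel T" "(AS S ^^ r) (ind u) v + 1 \<le> (AS T ^^ r) (ind u) v"
    by auto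
  then show ?thesis by (auto simp: Rel_def)
qed

lemma AS_pow_eval: "w \<in> V \<Longrightarrow> (AS S ^^ r) x w = (\<Sum>u\<in>V. (AS S ^^ r) (ind w) u * x u)"
  using ip_AS_pow[of "ind w" r S x] ip_ind[of w "(AS S ^^ r) x"] unfolding ip_def by simp

lemma AS_pow_ind_sym:
  assumes "u \<in> V" "w \<in> V"
  shows "(AS S ^^ r) (ind u) w = (AS S ^^ r) (ind w) u"
  using ip_AS_pow[of "ind w" r S "ind u"] assms by (metis ip_ind ip_commute)

text \<open>A vertex of \<open>S\<close> with a short walk in \<open>T\<close> that leaves \<open>S\<close> has more closed walks of length \<open>2 * r\<close>
  in \<open>T\<close> than in \<open>S\<close>, so that \<open>A_T^(2r) - A_S^(2r)\<close> dominates the identity on \<open>S\<close>.\<close>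

lemma exit_reduces_norm:
  assumes ST: "S \<subseteq> T" "T \<subseteq> V" and q: "qle \<mu> T" "\<mu> > 0"
    and ex: "\<And>u. u \<in> S \<Longrightarrow> \<exists>t w. (u, w) \<in> Rel T ^^ t \<and> w \<notin> S \<and> t \<le> r"
    and x: "supp S x" "\<And>u. 0 \<le> x u"
  shows "ip ((AS S ^^ r) x) ((AS S ^^ r) x) + ip x x \<le> \<mu> ^ (2 * r) * ip x x"
proof -
  define y z where "y = (AS T ^^ r) x" and "z = (AS S ^^ r) x"
  define D where "D w u = (AS T ^^ r) (ind w) u - (AS S ^^ r) (ind w) u" for w u
  have n: "0 \<le> ind u w" for u w :: 'a by (auto simp: ind_def)
  have D0: "0 \<le> D w u" for w u unfolding D_def using AS_pow_mono[OF ST(1) n] by simp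
  have z0: "0 \<le> z w" for w unfolding z_def using x by (intro AS_pow_nonneg) auto
  have yz: "y w = z w + (\<Sum>u\<in>V. D w u * x u)" if "w \<in> V" for w
    unfolding y_def z_def D_def using that
    by (simp add: AS_pow_eval[of w] sum.distrib[symmetric] algebra_simps)
  have s0: "0 \<le> (\<Sum>u\<in>V. D w u * x u)" for w using D0 x by (intro sum_nonneg) auto
  \<comment> \<open>By \<open>AS_pow_gap\<close> and symmetry, each column of \<open>D\<close>
    belonging to a vertex of \<open>S\<close> has an entry at least 1.\<close>
  have "ip x x \<le> (\<Sum>u\<in>V. (\<Sum>w\<in>V. (D w u)\<^sup>2) * (x u)\<^sup>2)"
    unfolding ip_def
  proof (intro sum_mono)
    fix u assume u: "u \<in> V"
    show "x u * x u \<le> (\<Sum>w\<in>V. (D w u)\<^sup>2) * (x u)\<^sup>2"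
    proof (cases "u \<in> S")
      case True
      obtain v where v: "v \<in> T" "(AS S ^^ r) (ind u) v + 1 \<le> (AS T ^^ r) (ind u) v"
        using AS_pow_gap[OF ST(1) True] ex[OF True] by blast
      then have vV: "v \<in> V" using ST by auto
      have "1 \<le> D v u" unfolding D_def using v AS_pow_ind_sym[OF u vV] by simp
      then have "1 \<le> (D v u)\<^sup>2" by simp
      also have "\<dots> \<le> (\<Sum>w\<in>V. (D w u)\<^sup>2)" using fin vV by (intro member_le_sum) auto
      finally have "1 * (x u)\<^sup>2 \<le> (\<Sum>w\<in>V. (D w u)\<^sup>2) * (x u)\<^sup>2" by (intro mult_right_mono) auto
      then show ?thesis by (simp add: power2_eq_square)
    next
      case False then show ?thesis using x by (simp add: supp_def)
    qed
  qed
  also have "\<dots> = (\<Sum>w\<in>V. \<Sum>u\<in>V. (D w u * x u)\<^sup>2)"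
    by (subst sum.swap) (simp add: sum_distrib_right power_mult_distrib)
  also have "\<dots> \<le> (\<Sum>w\<in>V. (\<Sum>u\<in>V. D w u * x u)\<^sup>2)"
    using D0 x fin by (intro sum_mono sum_power2_le_power2_sum) auto
  finally have 1: "ip x x \<le> (\<Sum>w\<in>V. (\<Sum>u\<in>V. D w u * x u)\<^sup>2)" .
  \<comment> \<open>\<open>y\<close> is \<open>z\<close> plus the image of \<open>x\<close> under
    \<open>D\<close>; both are nonnegative, so the cross term may be dropped.\<close>
  have "ip z z + (\<Sum>w\<in>V. (\<Sum>u\<in>V. D w u * x u)\<^sup>2) \<le> ip y y"
    unfolding ip_def sum.distrib[symmetric]
  proof (intro sum_mono)
    fix w assume "w \<in> V"
    then show "z w * z w + (\<Sum>u\<in>V. D w u * x u)\<^sup>2 \<le> y w * y w"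
      using yz[of w] mult_nonneg_nonneg[OF z0[of w] s0[of w]] by (simp add: algebra_simps power2_eq_square)
  qed
  also have "ip y y \<le> \<mu> ^ (2 * r) * ip x x"
    unfolding y_def using qle_AS_pow_norm[OF q] supp_mono[OF x(1) ST(1)] by blast
  finally show ?thesis using 1 unfolding z_def by simp
qed

section \<open>Nets and eigenvalue multiplicity\<close>

definition ball :: "'a set \<Rightarrow> 'a \<Rightarrow> nat \<Rightarrow> 'a set" where
  "ball S v r = {w. \<exists>t\<le>r. (v, w) \<in> Rel S ^^ t}"

lemma ball_center: "v \<in> ball S v r"
  unfolding ball_def by (auto intro: exI[of _ 0])

lemma walk_end: "v \<in> S \<Longrightarrow> (v, w) \<in> Rel S ^^ t \<Longrightarrow> w \<in> S"
  by (cases t) (auto simp: Rel_def)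

lemma ball_subset: "v \<in> S \<Longrightarrow> ball S v r \<subseteq> S"
  unfolding ball_def using walk_end by blast

lemma ball_mono: "r \<le> r' \<Longrightarrow> ball S v r \<subseteq> ball S v r'"
  unfolding ball_def using order_trans by blast

lemma ball_step: "u \<in> ball S v r \<Longrightarrow> (u, w) \<in> Rel S \<Longrightarrow> w \<in> ball S v (Suc r)"
  unfolding ball_def by (auto intro: relpow_Suc_I)

lemma ball_Suc_subset: "ball S v (Suc r) \<subseteq> (\<Union>u\<in>ball S v r. insert u {w. E u w})"
proof
  fix w assume "w \<in> ball S v (Suc r)"
  then obtain t where t: "t \<le> Suc r" "(v, w) \<in> Rel S ^^ t" by (auto simp: ball_def)
  show "w \<in> (\<Union>u\<in>ball S v r. insert u {w. E u w})"
  proof (cases "t \<le> r")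
    case True
    then have "w \<in> ball S v r" using t by (auto simp: ball_def)
    then show ?thesis by blast
  next
    case False
    then have "t = Suc r" using t by simp
    then obtain u where "(v, u) \<in> Rel S ^^ r" "(u, w) \<in> Rel S" using t by auto
    then have "u \<in> ball S v r" "E u w" by (auto simp: ball_def Rel_def)
    then show ?thesis by blast
  qed
qed

lemma finite_nbrs: "finite {w. E u w}"
  by (rule finite_subset[OF _ fin]) (auto intro: E_V2)

lemma ball_card:
  assumes "\<And>u. card {w. E u w} \<le> \<Delta>"
  shows "finite (ball S v r) \<and> card (ball S v r) \<le> (\<Delta> + 1) ^ r"
proof (induction r)
  case 0
  have "ball S v 0 = {v}" by (auto simp: ball_def)
  then show ?case by simp
next
  case (Suc r)
  have f: "finite (\<Union>u\<in>ball S v r. insert u {w. E u w})" using Suc finite_nbrs by auto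
  have "card (ball S v (Suc r)) \<le> card (\<Union>u\<in>ball S v r. insert u {w. E u w})"
    using f ball_Suc_subset by (intro card_mono)
  also have "\<dots> \<le> (\<Sum>u\<in>ball S v r. card (insert u {w. E u w}))"
    using Suc by (intro card_UN_le) auto
  also have "\<dots> \<le> (\<Sum>u\<in>ball S v r. \<Delta> + 1)"
  proof (intro sum_mono)
    fix u show "card (insert u {w. E u w}) \<le> \<Delta> + 1"
      using assms[of u] card_insert_le_m1[of "\<Delta> + 1" "{w. E u w}" u] finite_nbrs[of u] by simp
  qed
  also have "\<dots> \<le> (\<Delta> + 1) ^ r * (\<Delta> + 1)" using Suc by (simp del: One_nat_def)
  finally show ?case using finite_subset[OF ball_Suc_subset f] by (simp add: mult.commute)
qed

text \<open>A walk of at most \<open>r\<close> steps from \<open>v\<close> stays in the ball of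
  radius \<open>r\<close>, so local spectral radii suffice for counting closed walks at
  \<open>v\<close>.\<close>

lemma AS_pow_ball:
  assumes v: "v \<in> S" and S: "S \<subseteq> V" and j: "j \<le> r"
  shows "(AS S ^^ j) (ind v) = (AS (ball S v r) ^^ j) (ind v) \<and> supp (ball S v j) ((AS S ^^ j) (ind v))"
  using j
proof (induction j)
  case 0
  show ?case by (auto intro!: supp_ind ball_center)
next
  case (Suc j)
  define x where "x = (AS S ^^ j) (ind v)"
  define B where "B = ball S v r"
  have x: "x = (AS B ^^ j) (ind v)" "supp (ball S v j) x" using Suc by (auto simp: x_def B_def)
  have jB: "ball S v (Suc j) \<subseteq> B" "ball S v j \<subseteq> B" unfolding B_def using Suc.prems by (intro ball_mono; simp)+
  have BS: "B \<subseteq> S" unfolding B_def using v by (rule ball_subset)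
  have cutS: "cut S x = x" "cut B x = x" using cut_supp supp_mono[OF x(2)] jB(2) order_trans[OF jB(2) BS] by blast+
  have nz: "u \<in> ball S v (Suc j)" if u: "u \<in> S" "A x u \<noteq> 0" for u
  proof -
    obtain w where w: "E u w" "x w \<noteq> 0" using u(2) unfolding A_def
      by (auto elim!: sum.not_neutral_contains_not_neutral split: if_splits)
    then have wb: "w \<in> ball S v j" using x(2) by (auto simp: supp_def)
    then have "w \<in> S" using ball_subset[OF v] by blast
    then have "(w, u) \<in> Rel S" using w E_sym u by (auto simp: Rel_def)
    then show ?thesis using ball_step wb by blast
  qed
  have *: "AS S x u = AS B x u \<and> (u \<notin> ball S v (Suc j) \<longrightarrow> AS S x u = 0)" for u
    unfolding AS_def cutS using nz[of u] jB BS by (auto simp: cut_def)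
  have "AS S x = AS B x" using * by blast
  moreover have "supp (ball S v (Suc j)) (AS S x)" unfolding supp_def using * by blast
  ultimately show ?case using x unfolding x_def B_def by simp
qed

lemma walk_append: "(u, x) \<in> Rel S ^^ i \<Longrightarrow> (x, w) \<in> Rel S ^^ j \<Longrightarrow> (u, w) \<in> Rel S ^^ (i + j)"
  unfolding relpow_add by (rule relcompI)

lemma walk_in_ball:
  assumes "i + t \<le> r" "(v, u) \<in> Rel S ^^ i" "(u, w) \<in> Rel S ^^ t"
  shows "(u, w) \<in> Rel (ball S v r) ^^ t"
  using assms(1,3)
proof (induction t arbitrary: w)
  case (Suc t)
  then obtain x where x: "(u, x) \<in> Rel S ^^ t" "(x, w) \<in> Rel S" by auto
  have "(v, x) \<in> Rel S ^^ (i + t)" using assms(2) x(1) by (rule walk_append)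
  moreover have "(v, w) \<in> Rel S ^^ (i + Suc t)" using assms(2) Suc.prems(2) by (rule walk_append)
  ultimately have "x \<in> ball S v r" "w \<in> ball S v r" unfolding ball_def using Suc.prems(1)
    by (auto simp del: relpow.simps intro: exI[of _ "i + t"] exI[of _ "i + Suc t"])
  then have "(x, w) \<in> Rel (ball S v r)" using x by (auto simp: Rel_def)
  moreover have "(u, x) \<in> Rel (ball S v r) ^^ t" using Suc x by auto
  ultimately show ?case by (rule relpow_Suc_I[rotated])
qed auto

definition conn :: "'a set \<Rightarrow> bool" where
  "conn C \<longleftrightarrow> (\<forall>u\<in>C. \<forall>w\<in>C. \<exists>t. (u, w) \<in> Rel C ^^ t)"

text \<open>As long as the ball does not fill \<open>C\<close>, some edge leaves it and the next
  radius gains a vertex.\<close>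

lemma conn_ball_card:
  assumes C: "C \<subseteq> V" "conn C" "u \<in> C"
  shows "min (r + 1) (card C) \<le> card (ball C u r)"
proof (induction r)
  case 0
  have "ball C u 0 = {u}" by (auto simp: ball_def)
  then show ?case by simp
next
  case (Suc r)
  have fC: "finite C" using C fin finite_subset by blast
  have fb: "finite (ball C u r')" for r' using ball_subset[OF C(3)] fC finite_subset by blast
  show ?case
  proof (cases "\<exists>x y. x \<in> ball C u r \<and> (x, y) \<in> Rel C \<and> y \<notin> ball C u r")
    case True
    then obtain x y where xy: "x \<in> ball C u r" "(x, y) \<in> Rel C" "y \<notin> ball C u r" by blast
    then have "y \<in> ball C u (Suc r)" using ball_step by blast
    then have "insert y (ball C u r) \<subseteq> ball C u (Suc r)" using ball_mono[of r "Suc r"] by auto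
    then have "card (insert y (ball C u r)) \<le> card (ball C u (Suc r))" using fb by (intro card_mono)
    then show ?thesis using Suc xy fb by simp
  next
    case False
    have "w \<in> ball C u r" if "(u, w) \<in> Rel C ^^ t" for t w
      using that
    proof (induction t arbitrary: w)
      case 0 then show ?case by (simp add: ball_center)
    next
      case (Suc t)
      then obtain x where "(u, x) \<in> Rel C ^^ t" "(x, w) \<in> Rel C" by auto
      then show ?case using False Suc.IH by blast
    qed
    then have "C \<subseteq> ball C u r" using C unfolding conn_def by blast
    then have "C \<subseteq> ball C u (Suc r)" using ball_mono[of r "Suc r"] by fastforce
    then have "card C \<le> card (ball C u (Suc r))" using fb by (intro card_mono)
    then show ?thesis by simp
  qed
qed

text \<open>\<open>T\<close> is a largest set of centres of pairwise disjoint balls of radius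
  \<rho>. Disjointness limits its size, and maximality makes every other ball meet one of them, at
  distance at most \<open>2 * \<rho>\<close>.\<close>

lemma net_exists:
  assumes C: "C \<subseteq> V" and big: "\<And>u. u \<in> C \<Longrightarrow> \<rho> + 1 \<le> card (ball C u \<rho>)"
  shows "\<exists>T\<subseteq>C. card T * (\<rho> + 1) \<le> card C \<and> (\<forall>u\<in>C. \<exists>w\<in>T. \<exists>t\<le>2*\<rho>. (u, w) \<in> Rel C ^^ t)"
proof -
  define P where "P T \<longleftrightarrow> T \<subseteq> C \<and> (\<forall>u\<in>T. \<forall>w\<in>T. u \<noteq> w \<longrightarrow> ball C u \<rho> \<inter> ball C w \<rho> = {})" for T
  have fC: "finite C" using C fin finite_subset by blast
  have "P {}" by (simp add: P_def)
  moreover have "\<forall>T. P T \<longrightarrow> card T < Suc (card C)" using fC card_mono by (auto simp: P_def less_Suc_eq_le)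
  ultimately obtain T where T: "P T" "\<And>T'. P T' \<Longrightarrow> card T' \<le> card T"
    using ex_has_greatest_nat[of P "{}" card "Suc (card C)"] by metis
  have TC: "T \<subseteq> C" "finite T" using T fC finite_subset unfolding P_def by blast+
  have fb: "finite (ball C u \<rho>)" if "u \<in> C" for u using ball_subset[OF that] fC finite_subset by blast
  have "card T * (\<rho> + 1) = (\<Sum>u\<in>T. \<rho> + 1)" by simp
  also have "\<dots> \<le> (\<Sum>u\<in>T. card (ball C u \<rho>))" using big TC by (intro sum_mono) auto
  also have "\<dots> = card (\<Union>u\<in>T. ball C u \<rho>)"
    using TC T(1) fb by (intro card_UN_disjoint[symmetric]) (auto simp: P_def)
  also have "\<dots> \<le> card C" using fC ball_subset TC by (intro card_mono) blast+
  finally have 1: "card T * (\<rho> + 1) \<le> card C" .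
  have 2: "\<exists>w\<in>T. \<exists>t\<le>2*\<rho>. (u, w) \<in> Rel C ^^ t" if u: "u \<in> C" for u
  proof -
    have "\<exists>w\<in>T. ball C u \<rho> \<inter> ball C w \<rho> \<noteq> {}"
    proof (rule ccontr)
      assume no: "\<not> ?thesis"
      then have "u \<notin> T" using ball_center by blast
      moreover have "ball C u \<rho> \<inter> ball C w \<rho> = {}" "ball C w \<rho> \<inter> ball C u \<rho> = {}" if "w \<in> T" for w
        using no that by blast+
      then have "P (insert u T)" using T(1) u unfolding P_def by simp
      ultimately show False using T(2)[of "insert u T"] TC by simp
    qed
    then obtain w x where wx: "w \<in> T" "x \<in> ball C u \<rho>" "x \<in> ball C w \<rho>" by blast
    then obtain i j where w: "w \<in> T" "i \<le> \<rho>" "j \<le> \<rho>" "(u, x) \<in> Rel C ^^ i" "(w, x) \<in> Rel C ^^ j"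
      unfolding ball_def by blast
    then have "(u, w) \<in> Rel C ^^ (i + j)" by (intro walk_append[OF w(4)] Rel_sym[OF w(5)])
    moreover have "i + j \<le> 2 * \<rho>" using w by simp
    ultimately show ?thesis using w(1) by blast
  qed
  show ?thesis using 1 2 TC by blast
qed

text \<open>Taking absolute values does not decrease the quadratic form; nonnegativity of the
  witness is what \<open>no_two_violators\<close> relies on.\<close>

lemma not_qle_witness:
  assumes "\<not> qle \<mu> S"
  shows "\<exists>x. supp S x \<and> (\<forall>u. 0 \<le> x u) \<and> \<mu> * ip x x < ip x (A x)"
proof -
  obtain x where x: "supp S x" "\<mu> * ip x x < ip x (A x)" using assms by (auto simp: qle_def not_le)
  have "\<mu> * ip (\<lambda>u. \<bar>x u\<bar>) (\<lambda>u. \<bar>x u\<bar>) < ip (\<lambda>u. \<bar>x u\<bar>) (A (\<lambda>u. \<bar>x u\<bar>))"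
    using x(2) abs_ip_A_le[of x] unfolding ip_abs by linarith
  then show ?thesis using x by (intro exI[of _ "\<lambda>u. \<bar>x u\<bar>"]) (auto simp: supp_def)
qed

section \<open>Orthonormal families and closed walks\<close>

definition orthonormal :: "nat \<Rightarrow> (nat \<Rightarrow> 'a \<Rightarrow> real) \<Rightarrow> bool" where
  "orthonormal m e \<longleftrightarrow> (\<forall>i<m. \<forall>j<m. ip (e i) (e j) = (if i = j then 1 else 0))"

lemma Bessel:
  assumes e: "orthonormal m e"
  shows "(\<Sum>i<m. (ip y (e i))\<^sup>2) \<le> ip y y"
proof -
  define c where "c i = ip y (e i)" for i
  define s where "s = (\<lambda>u. \<Sum>i<m. c i * e i u)"
  have ys: "ip z s = (\<Sum>i<m. c i * ip z (e i))" for z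
    unfolding ip_def s_def sum_distrib_left by (subst sum.swap) (simp add: mult_ac)
  have es: "ip (e j) s = c j" if "j < m" for j
  proof -
    have "ip (e j) s = (\<Sum>i<m. if i = j then c i else 0)"
      unfolding ys using e that by (intro sum.cong) (auto simp: orthonormal_def)
    then show ?thesis using that by simp
  qed
  have ss: "ip s s = (\<Sum>i<m. (c i)\<^sup>2)"
    unfolding ys by (intro sum.cong) (auto simp: es ip_commute[of s] power2_eq_square)
  have "0 \<le> ip (\<lambda>u. 1 * y u + (-1) * s u) (\<lambda>u. 1 * y u + (-1) * s u)" by (rule ip_self_nonneg)
  also have "\<dots> = ip y y - 2 * ip y s + ip s s" unfolding ip_self_add by (simp add: ip_commute)
  also have "ip y s = (\<Sum>i<m. (c i)\<^sup>2)" unfolding ys by (simp add: c_def power2_eq_square)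
  finally show ?thesis unfolding ss by (simp add: c_def)
qed

text \<open>The right side is the trace of the \<open>2 * r\<close>-th power of \<open>AS H\<close>,
  and the left side is the share of the given eigenvectors. Bessel for each column avoids completing
  them to a basis.\<close>

lemma eigenfamily_trace_bound:
  assumes H: "H \<subseteq> V" and e: "orthonormal m e" "\<And>i. i < m \<Longrightarrow> supp H (e i)"
    and eig: "\<And>i u. i < m \<Longrightarrow> AS H (e i) u = l * e i u"
  shows "m * l ^ (2 * r) \<le> (\<Sum>v\<in>H. ip ((AS H ^^ r) (ind v)) ((AS H ^^ r) (ind v)))"
proof -
  have lin: "AS H (\<lambda>u. a * x u) = (\<lambda>u. a * AS H x u)" for a x
  proof -
    have "cut H (\<lambda>u. a * x u) = (\<lambda>u. a * cut H x u)" by (auto simp: cut_def)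
    then show ?thesis unfolding AS_def by (auto simp: cut_def A_def sum_distrib_left mult_ac)
  qed
  have pow: "(AS H ^^ r) (e i) = (\<lambda>u. l ^ r * e i u)" if "i < m" for i
  proof (induction r)
    case (Suc r)
    have "AS H (e i) = (\<lambda>u. l * e i u)" using eig that by auto
    then have "(AS H ^^ Suc r) (e i) = (\<lambda>u. l ^ r * (l * e i u))" using Suc lin[of "l ^ r" "e i"] by simp
    then show ?case by (simp add: mult_ac)
  qed simp
  have "m * l ^ (2 * r) = (\<Sum>i<m. l ^ (2 * r) * ip (e i) (e i))"
    using e(1) by (simp add: orthonormal_def)
  also have "\<dots> = (\<Sum>i<m. \<Sum>v\<in>H. (l ^ r * e i v)\<^sup>2)"
  proof (intro sum.cong refl)
    fix i assume i: "i \<in> {..<m}"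
    have "ip (e i) (e i) = (\<Sum>v\<in>H. e i v * e i v)"
      unfolding ip_def using H fin e(2)[of i] i by (intro sum.mono_neutral_right) (auto simp: supp_def)
    then show "l ^ (2 * r) * ip (e i) (e i) = (\<Sum>v\<in>H. (l ^ r * e i v)\<^sup>2)"
      unfolding mult_2 power_add by (simp add: sum_distrib_left power_mult_distrib power2_eq_square mult_ac)
  qed
  also have "\<dots> = (\<Sum>i<m. \<Sum>v\<in>H. (ip ((AS H ^^ r) (ind v)) (e i))\<^sup>2)"
  proof (intro sum.cong refl)
    fix i v assume "i \<in> {..<m}" "v \<in> H"
    then have "ip (ind v) ((AS H ^^ r) (e i)) = l ^ r * e i v"
      using H pow[of i] ip_ind[of v] by auto
    then show "(l ^ r * e i v)\<^sup>2 = (ip ((AS H ^^ r) (ind v)) (e i))\<^sup>2"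
      using ip_AS_pow[of "ind v" r H "e i"] by simp
  qed
  also have "\<dots> = (\<Sum>v\<in>H. \<Sum>i<m. (ip ((AS H ^^ r) (ind v)) (e i))\<^sup>2)" by (rule sum.swap)
  also have "\<dots> \<le> (\<Sum>v\<in>H. ip ((AS H ^^ r) (ind v)) ((AS H ^^ r) (ind v)))"
    by (intro sum_mono Bessel e)
  finally show ?thesis .
qed

end

section \<open>At most one region of spectral radius above \<open>l\<close>\<close>

text \<open>Up to the factor \<open>2 * \<alpha>\<close>, the Gram matrix of unit vectors along the lines is \<open>l * I - A + J / 2\<close>,
  where \<open>J\<close> is the all-ones matrix and edges are the pairs with inner product \<open>- \<alpha>\<close>.\<close>

locale balanced_graph = fin_graph +
  fixes l :: real
  assumes l_pos: "l > 0"
    and psd: "supp V x \<Longrightarrow> ip x (A x) \<le> l * ip x x + (\<Sum>u\<in>V. x u)\<^sup>2 / 2"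
begin

text \<open>A combination of \<open>x\<close> and \<open>y\<close> with coefficient sum zero would contradict \<open>psd\<close>.\<close>

lemma no_two_violators:
  assumes x: "supp V x" "\<And>u. 0 \<le> x u" "l * ip x x < ip x (A x)"
    and y: "supp V y" "\<And>u. 0 \<le> y u" "l * ip y y \<le> ip y (A y)" "y v \<noteq> 0"
    and orth: "ip y x = 0" "ip y (A x) = 0"
  shows False
proof -
  have pos: "0 < (\<Sum>u\<in>V. z u)" if "supp V z" "\<And>u. 0 \<le> z u" "z v \<noteq> 0" for z :: "'a \<Rightarrow> real" and v
  proof -
    have "v \<in> V" using that by (auto simp: supp_def)
    then have "z v \<le> (\<Sum>u\<in>V. z u)" using that fin by (intro member_le_sum) auto
    then show ?thesis using that(2)[of v] that(3) by linarith
  qed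
  define a b where "a = (\<Sum>u\<in>V. y u)" and "b = - (\<Sum>u\<in>V. x u)"
  have a: "a > 0" unfolding a_def using pos y by blast
  define z where "z = (\<lambda>u. a * x u + b * y u)"
  have "(\<Sum>u\<in>V. z u) = a * (\<Sum>u\<in>V. x u) + b * (\<Sum>u\<in>V. y u)"
    unfolding z_def by (simp add: sum.distrib sum_distrib_left)
  then have "(\<Sum>u\<in>V. z u) = 0" by (simp add: a_def b_def)
  moreover have "supp V z" unfolding z_def by (intro supp_comb x y)
  ultimately have "ip z (A z) \<le> l * ip z z" using psd[of z] by simp
  then have "a\<^sup>2 * ip x (A x) + b\<^sup>2 * ip y (A y) \<le> l * (a\<^sup>2 * ip x x + b\<^sup>2 * ip y y)"
    unfolding z_def ip_A_add ip_self_add by (simp add: orth)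
  then have "a\<^sup>2 * (ip x (A x) - l * ip x x) + b\<^sup>2 * (ip y (A y) - l * ip y y) \<le> 0"
    by (simp add: algebra_simps)
  \<comment> \<open>Strictness comes from \<open>x\<close> alone; \<open>y\<close> may attain
    equality, as an eigenvector for \<open>l\<close> does.\<close>
  moreover have "0 < a\<^sup>2 * (ip x (A x) - l * ip x x)" using a x by simp
  moreover have "0 \<le> b\<^sup>2 * (ip y (A y) - l * ip y y)" using y by simp
  ultimately show False by linarith
qed

lemma orth_disjoint: "supp S x \<Longrightarrow> supp T y \<Longrightarrow> S \<inter> T = {} \<Longrightarrow> ip y x = 0"
  unfolding ip_def supp_def by (intro sum.neutral) auto

lemma orth_no_edges:
  assumes "supp S x" "supp T y" "\<And>u w. u \<in> S \<Longrightarrow> w \<in> T \<Longrightarrow> \<not> E w u"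
  shows "ip y (A x) = 0"
proof -
  have "y u * A x u = 0" for u
  proof (cases "u \<in> T")
    case True
    then have "A x u = 0" unfolding A_def using assms by (intro sum.neutral) (auto simp: supp_def)
    then show ?thesis by simp
  qed (use assms in \<open>auto simp: supp_def\<close>)
  then show ?thesis unfolding ip_def by simp
qed

text \<open>Two violating balls whose centres are more than \<open>2 * R + 1\<close> apart are
  disjoint with no edge between them, against \<open>no_two_violators\<close>. So all violating
  centres lie in one ball, whose size the degree bounds.\<close>

lemma violating_centers_bounded:
  assumes deg: "\<And>u. card {w. E u w} \<le> \<Delta>" and C: "C \<subseteq> V"
  shows "card {v \<in> C. \<not> qle l (ball C v R)} \<le> (\<Delta> + 1) ^ (2 * R + 1)"
proof (cases "{v \<in> C. \<not> qle l (ball C v R)} = {}")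
  case False
  then obtain a where a: "a \<in> C" "\<not> qle l (ball C a R)" by blast
  have "{v \<in> C. \<not> qle l (ball C v R)} \<subseteq> ball C a (2 * R + 1)"
  proof (rule ccontr)
    assume "\<not> ?thesis"
    then obtain b where b: "b \<in> C" "\<not> qle l (ball C b R)" "b \<notin> ball C a (2 * R + 1)" by blast
    have far: "u \<noteq> w \<and> \<not> E w u" if u: "u \<in> ball C a R" and w: "w \<in> ball C b R" for u w
    proof -
      obtain i j where ij: "i \<le> R" "j \<le> R" "(a, u) \<in> Rel C ^^ i" "(w, b) \<in> Rel C ^^ j"
        using u w unfolding ball_def using Rel_sym by blast
      have uw: "u \<in> C" "w \<in> C" using u w ball_subset a b by blast+
      have "u \<noteq> w"
      proof
        assume "u = w"
        then have "(a, b) \<in> Rel C ^^ (i + j)" using ij(3,4) by (blast intro: walk_append)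
        then show False using b(3) ij by (auto simp: ball_def)
      qed
      moreover have "\<not> E w u"
      proof
        assume "E w u"
        then have "(u, w) \<in> Rel C" using uw E_sym by (auto simp: Rel_def)
        then have "(a, w) \<in> Rel C ^^ Suc i" using ij by (intro relpow_Suc_I)
        then have "(a, b) \<in> Rel C ^^ (Suc i + j)" using ij(4) by (rule walk_append)
        then have "\<exists>t\<le>2 * R + 1. (a, b) \<in> Rel C ^^ t" using ij(1,2) by (intro exI[of _ "Suc i + j"] conjI) auto
        then show False using b(3) by (simp add: ball_def)
      qed
      ultimately show ?thesis by blast
    qed
    obtain x where x: "supp (ball C a R) x" "\<And>u. 0 \<le> x u" "l * ip x x < ip x (A x)"
      using not_qle_witness a by blast
    obtain y where y: "supp (ball C b R) y" "\<And>u. 0 \<le> y u" "l * ip y y < ip y (A y)"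
      using not_qle_witness b by blast
    have sV: "supp V x" "supp V y" using x y ball_subset a b C by (meson supp_mono subset_trans)+
    have "\<exists>v. y v \<noteq> 0" using y(3) by (rule contrapos_pp) (simp add: ip_def)
    then obtain v where "y v \<noteq> 0" by blast
    moreover have "ip y x = 0" using far x y by (intro orth_disjoint) auto
    moreover have "ip y (A x) = 0" using far by (intro orth_no_edges[OF x(1) y(1)]) auto
    ultimately show False using no_two_violators[OF sV(1) x(2,3) sV(2) y(2)] y(3) by fastforce
  qed
  then have "card {v \<in> C. \<not> qle l (ball C v R)} \<le> card (ball C a (2 * R + 1))"
    using ball_card[OF deg, of C a "2 * R + 1"] by (intro card_mono) auto
  then show ?thesis using ball_card[OF deg, of C a "2 * R + 1"] by linarith
qed (simp only: card.empty zero_le)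

text \<open>\<open>T\<close> consists of a net and of the vertices whose ball has spectral radius above \<open>l\<close>. On \<open>C - T\<close>
  all balls have spectral radius smaller than \<open>l\<close> by a definite amount, and a trace estimate with
  long closed walks bounds the multiplicity of \<open>l\<close>.\<close>

lemma multiplicity_bound:
  assumes deg: "\<And>u. card {w. E u w} \<le> \<Delta>" and C: "C \<subseteq> V" "conn C" "\<rho> + 1 \<le> card C"
  obtains T where "T \<subseteq> C" "real (card T) \<le> real ((\<Delta> + 1) ^ (4 * \<rho> * (s + 1) + 1)) + card C / real (\<rho> + 1)"
    "\<And>m e. orthonormal m e \<Longrightarrow> \<forall>i<m. supp (C - T) (e i) \<Longrightarrow> \<forall>i<m. \<forall>u\<in>V. A (e i) u = l * e i u \<Longrightarrow>
       real m \<le> card C * (max 0 (1 - 1 / l ^ (4 * \<rho>))) ^ s"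
proof -
  \<comment> \<open>The trace uses balls of radius \<open>2 * \<rho> * s\<close> in
    \<open>C - T\<close>; a further \<open>2 * \<rho>\<close> leaves room for the walk from any of
    their vertices to the net.\<close>
  define R where "R = 2 * \<rho> * (s + 1)"
  define U where "U = {v \<in> C. \<not> qle l (ball C v R)}"
  have U: "card U \<le> (\<Delta> + 1) ^ (2 * R + 1)" unfolding U_def by (intro violating_centers_bounded deg C)
  have fC: "finite C" using C fin finite_subset by blast
  have "\<rho> + 1 \<le> card (ball C u \<rho>)" if "u \<in> C" for u
    using conn_ball_card[OF C(1,2) that, of \<rho>] C(3) by simp
  then obtain N where N: "N \<subseteq> C" "card N * (\<rho> + 1) \<le> card C" "\<And>u. u \<in> C \<Longrightarrow> \<exists>w\<in>N. \<exists>t\<le>2*\<rho>. (u, w) \<in> Rel C ^^ t"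
    using net_exists[OF C(1)] by metis
  define T where "T = U \<union> N"
  have "real (card N) * (\<rho> + 1) \<le> card C" using N(2) by (metis of_nat_le_iff of_nat_mult)
  then have "real (card N) \<le> card C / real (\<rho> + 1)" by (simp add: field_simps)
  moreover have "card T \<le> card U + card N" unfolding T_def by (rule card_Un_le)
  moreover have "real (card U) \<le> (\<Delta> + 1) ^ (4 * \<rho> * (s + 1) + 1)"
  proof -
    have "2 * R + 1 = 4 * \<rho> * (s + 1) + 1" by (simp add: R_def)
    then have "card U \<le> (\<Delta> + 1) ^ (4 * \<rho> * (s + 1) + 1)" using U by simp
    then show ?thesis by (simp only: of_nat_le_iff)
  qed
  ultimately have cT: "real (card T) \<le> real ((\<Delta> + 1) ^ (4 * \<rho> * (s + 1) + 1)) + card C / real (\<rho> + 1)"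
    by linarith
  define H where "H = C - T"
  \<comment> \<open>The factor by which the squared norm grows in \<open>2 * \<rho>\<close> steps:
    \<open>l ^ (4 * \<rho>)\<close>, less the one that \<open>exit_reduces_norm\<close>
    gains.\<close>
  define K where "K = l ^ (4 * \<rho>) - 1"
  have H: "H \<subseteq> V" "H \<subseteq> C" unfolding H_def using C by auto
  have gap: "ip ((AS B ^^ (2 * \<rho>)) x) ((AS B ^^ (2 * \<rho>)) x) \<le> K * ip x x"
    if v: "v \<in> H" and B: "B = ball H v (2 * \<rho> * s)" and x: "supp B x" "\<And>u. 0 \<le> x u" for v B x
  proof -
    have vC: "v \<in> C" using v H by auto
    have rel: "Rel H \<subseteq> Rel C" using H by (auto simp: Rel_def)
    have relp: "Rel H ^^ t \<subseteq> Rel C ^^ t" for t by (induction t) (use rel in auto)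
    have BH: "B \<subseteq> H" unfolding B using ball_subset[OF v] .
    have sub: "B \<subseteq> ball C v R" 
    proof
      fix u assume "u \<in> B"
      then obtain t where "t \<le> 2 * \<rho> * s" "(v, u) \<in> Rel C ^^ t" using relp unfolding B ball_def by blast
      moreover then have "t \<le> R" unfolding R_def by simp
      ultimately show "u \<in> ball C v R" unfolding ball_def by blast
    qed
    have q: "qle l (ball C v R)" using v vC unfolding H_def T_def U_def by auto
    have bV: "ball C v R \<subseteq> V" using ball_subset[OF vC] C by blast
    have "ip ((AS B ^^ (2 * \<rho>)) x) ((AS B ^^ (2 * \<rho>)) x) + ip x x \<le> l ^ (2 * (2 * \<rho>)) * ip x x"
    proof (rule exit_reduces_norm[OF sub bV q l_pos _ x])
      fix u assume u: "u \<in> B"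
      then obtain i where i: "i \<le> 2 * \<rho> * s" "(v, u) \<in> Rel C ^^ i" using relp unfolding B ball_def by blast
      obtain w t where w: "w \<in> N" "t \<le> 2 * \<rho>" "(u, w) \<in> Rel C ^^ t" using N(3)[of u] u BH H by blast
      have "(u, w) \<in> Rel (ball C v R) ^^ t"
        using w i by (intro walk_in_ball[of i]) (auto simp: R_def)
      moreover have "w \<notin> B" using BH w unfolding H_def T_def by auto
      ultimately show "\<exists>t w. (u, w) \<in> Rel (ball C v R) ^^ t \<and> w \<notin> B \<and> t \<le> 2 * \<rho>" using w by blast
    qed
    then show ?thesis unfolding K_def by (simp add: algebra_simps)
  qed
  \<comment> \<open>\<open>s\<close> rounds of \<open>2 * \<rho>\<close> steps each, all inside one
    local ball \<open>B\<close>; nonnegativity of the vector is kept so that \<open>gap\<close>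
    applies again.\<close>
  have trace: "ip ((AS H ^^ (2 * \<rho> * s)) (ind v)) ((AS H ^^ (2 * \<rho> * s)) (ind v)) \<le> K ^ s \<and> 0 \<le> K"
    if v: "v \<in> H" for v
  proof -
    define B where "B = ball H v (2 * \<rho> * s)"
    have vB: "v \<in> B" unfolding B_def by (rule ball_center)
    have vV: "v \<in> V" using v H by auto
    have i1: "ip (ind v) (ind v) = 1" using ip_ind[OF vV] by (simp add: ind_def)
    have n: "0 \<le> ind v w" for w by (simp add: ind_def)
    have K: "0 \<le> K" using gap[OF v B_def supp_ind[OF vB] n] ip_self_nonneg[of "(AS B ^^ (2 * \<rho>)) (ind v)"] i1 by simp
    have "ip ((AS B ^^ (2 * \<rho> * j)) (ind v)) ((AS B ^^ (2 * \<rho> * j)) (ind v)) \<le> K ^ j" for j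
    proof (induction j)
      case 0 then show ?case using i1 by simp
    next
      case (Suc j)
      define x where "x = (AS B ^^ (2 * \<rho> * j)) (ind v)"
      have x: "supp B x" "0 \<le> x u" for u
        unfolding x_def using AS_pow_supp[OF supp_ind[OF vB]] AS_pow_nonneg[OF n] by auto
      have "(AS B ^^ (2 * \<rho> * Suc j)) (ind v) = (AS B ^^ (2 * \<rho>)) x"
        unfolding x_def by (simp add: funpow_add)
      then have "ip ((AS B ^^ (2 * \<rho> * Suc j)) (ind v)) ((AS B ^^ (2 * \<rho> * Suc j)) (ind v)) \<le> K * ip x x"
        using gap[OF v B_def x] by simp
      also have "\<dots> \<le> K * K ^ j" using Suc K unfolding x_def by (intro mult_left_mono)
      finally show ?case by simp
    qed
    then show ?thesis using AS_pow_ball[OF v H(1), of "2 * \<rho> * s" "2 * \<rho> * s"] K unfolding B_def by simp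
  qed
  \<comment> \<open>For empty \<open>H\<close> the number \<open>K\<close> may be negative; the
    truncation by \<open>max 0\<close> keeps the bound valid there, with
    \<open>m = 0\<close>.\<close>
  have key: "real m \<le> card C * (max 0 (1 - 1 / l ^ (4 * \<rho>))) ^ s"
    if e: "orthonormal m e" "\<forall>i<m. supp (C - T) (e i)" "\<forall>i<m. \<forall>u\<in>V. A (e i) u = l * e i u" for m e
  proof (cases "H = {}")
    case True
    have "m = 0"
    proof (rule ccontr)
      assume "m \<noteq> 0"
      then have "supp {} (e 0)" "ip (e 0) (e 0) = 1" using e True unfolding H_def orthonormal_def by auto
      then show False by (simp add: ip_def supp_def)
    qed
    then show ?thesis by simp
  next
    case False
    then have K: "K \<ge> 0" using trace by blast
    have "AS H (e i) u = l * e i u" if "i < m" for i u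
    proof -
      have s: "supp H (e i)" using e that unfolding H_def by auto
      have "AS H (e i) u = (if u \<in> H then A (e i) u else 0)"
        unfolding AS_def cut_supp[OF s] by (simp add: cut_def)
      then show ?thesis using e(3) that H s by (auto simp: supp_def)
    qed
    then have "m * l ^ (2 * (2 * \<rho> * s)) \<le> (\<Sum>v\<in>H. ip ((AS H ^^ (2 * \<rho> * s)) (ind v)) ((AS H ^^ (2 * \<rho> * s)) (ind v)))"
      using e by (intro eigenfamily_trace_bound H) (auto simp: H_def)
    also have "\<dots> \<le> (\<Sum>v\<in>H. K ^ s)" using trace by (intro sum_mono) auto
    also have "\<dots> \<le> card C * K ^ s" using K card_mono[OF fC H(2)] by (simp add: mult_right_mono)
    also have "K = (1 - 1 / l ^ (4 * \<rho>)) * l ^ (4 * \<rho>)" unfolding K_def using l_pos by (simp add: algebra_simps)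
    finally have "m * l ^ (4 * \<rho> * s) \<le> card C * (1 - 1 / l ^ (4 * \<rho>)) ^ s * l ^ (4 * \<rho> * s)"
      by (simp add: power_mult_distrib power_mult mult_ac flip: power_mult)
    then have "m \<le> card C * (1 - 1 / l ^ (4 * \<rho>)) ^ s" using l_pos by (simp add: mult_le_cancel_right)
    moreover have "0 \<le> 1 - 1 / l ^ (4 * \<rho>)" using K l_pos unfolding K_def by (simp add: field_simps)
    ultimately show ?thesis by (simp add: max_def)
  qed
  have "T \<subseteq> C" using N by (auto simp: T_def U_def)
  then show thesis
  proof (rule that)
    fix m e assume "orthonormal m e" "\<forall>i<m. supp (C - T) (e i)" "\<forall>i<m. \<forall>u\<in>V. A (e i) u = l * e i u"
    then show "real m \<le> card C * (max 0 (1 - 1 / l ^ (4 * \<rho>))) ^ s" by (rule key)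
  qed (rule cT)
qed

end

section \<open>Eigenvectors and components\<close>

context fin_graph
begin

definition eigen :: "real \<Rightarrow> ('a \<Rightarrow> real) \<Rightarrow> bool" where
  "eigen \<mu> x \<longleftrightarrow> supp V x \<and> (\<forall>u. A x u = \<mu> * x u)"

definition closed_set :: "'a set \<Rightarrow> bool" where
  "closed_set C \<longleftrightarrow> C \<subseteq> V \<and> (\<forall>u w. u \<in> C \<longrightarrow> E u w \<longrightarrow> w \<in> C)"

definition comp :: "'a \<Rightarrow> 'a set" where
  "comp u = {w. \<exists>t. (u, w) \<in> Rel V ^^ t}"

lemma A_outside: "u \<notin> V \<Longrightarrow> A x u = 0"
  unfolding A_def using E_V by (intro sum.neutral) auto

lemma eigenI: "supp V x \<Longrightarrow> (\<And>u. u \<in> V \<Longrightarrow> A x u = \<mu> * x u) \<Longrightarrow> eigen \<mu> x"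
  unfolding eigen_def by (metis A_outside mult_zero_right supp_def)

lemma eigen_comb: "eigen \<mu> x \<Longrightarrow> eigen \<mu> y \<Longrightarrow> eigen \<mu> (\<lambda>u. a * x u + b * y u)"
  unfolding eigen_def by (auto simp: supp_comb A_add algebra_simps)

lemma eigen_ip: "eigen \<mu> x \<Longrightarrow> ip x (A x) = \<mu> * ip x x"
  unfolding eigen_def ip_def by (simp add: sum_distrib_left mult_ac)

lemma closed_compl: "closed_set C \<Longrightarrow> closed_set (V - C)"
  unfolding closed_set_def using E_sym E_V2 by blast

lemma A_cut_closed: "closed_set C \<Longrightarrow> A (cut C x) = cut C (A x)"
proof
  fix u assume C: "closed_set C"
  show "A (cut C x) u = cut C (A x) u"
  proof (cases "u \<in> C")
    case True
    then show ?thesis using C unfolding A_def closed_set_def cut_def by (auto intro!: sum.cong)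
  next
    case False
    then have "\<not> E u w" if "w \<in> C" for w using C that E_sym unfolding closed_set_def by blast
    then have "A (cut C x) u = 0" unfolding A_def by (intro sum.neutral) (auto simp: cut_def)
    then show ?thesis using False by (simp add: cut_def)
  qed
qed

lemma eigen_cut:
  assumes C: "closed_set C" and x: "eigen \<mu> x"
  shows "eigen \<mu> (cut C x)"
proof (rule eigenI)
  show "supp V (cut C x)" using C by (auto simp: supp_def cut_def closed_set_def)
  show "A (cut C x) u = \<mu> * cut C x u" for u
    using A_cut_closed[OF C] x by (auto simp: cut_def eigen_def)
qed

text \<open>If \<mu> bounds the whole form, the absolute value of an eigenvector attains that bound
  too, hence is stationary. This is the source of the Perron-Frobenius facts below.\<close>

lemma eigen_abs:
  assumes "qle \<mu> V" "eigen \<mu> x"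
  shows "eigen \<mu> (\<lambda>u. \<bar>x u\<bar>)"
proof (rule eigenI)
  show s: "supp V (\<lambda>u. \<bar>x u\<bar>)" using assms by (auto simp: supp_def eigen_def)
  have "\<mu> * ip (\<lambda>u. \<bar>x u\<bar>) (\<lambda>u. \<bar>x u\<bar>) \<le> ip (\<lambda>u. \<bar>x u\<bar>) (A (\<lambda>u. \<bar>x u\<bar>))"
    using abs_ip_A_le[of x] eigen_ip[OF assms(2)] unfolding ip_abs by linarith
  then show "A (\<lambda>u. \<bar>x u\<bar>) u = \<mu> * \<bar>x u\<bar>" if "u \<in> V" for u
    using qle_extremal[OF subset_refl assms(1) s] that by blast
qed

lemma comp_self: "u \<in> comp u"
  unfolding comp_def by (auto intro: exI[of _ 0])

lemma comp_subset: "u \<in> V \<Longrightarrow> comp u \<subseteq> V"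
  unfolding comp_def using walk_end by blast

lemma comp_eq: "w \<in> comp u \<Longrightarrow> comp w = comp u"
  unfolding comp_def using walk_append Rel_sym by blast

lemma comp_closed: "u \<in> V \<Longrightarrow> closed_set (comp u)"
  unfolding closed_set_def
proof (intro conjI allI impI)
  fix v w assume u: "u \<in> V" "v \<in> comp u" "E v w"
  then obtain t where "(u, v) \<in> Rel V ^^ t" unfolding comp_def by blast
  moreover have "(v, w) \<in> Rel V" using u E_V E_V2 by (auto simp: Rel_def)
  ultimately have "(u, w) \<in> Rel V ^^ Suc t" by (rule relpow_Suc_I)
  then show "w \<in> comp u" unfolding comp_def by blast
qed (rule comp_subset)

lemma comp_conn:
  assumes u: "u \<in> V" shows "conn (comp u)"
proof -
  have *: "(v, w) \<in> Rel (comp u) ^^ t \<and> w \<in> comp u" if "v \<in> comp u" "(v, w) \<in> Rel V ^^ t" for v w t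
    using that(2)
  proof (induction t arbitrary: w)
    case 0 then show ?case using that by simp
  next
    case (Suc t)
    then obtain x where x: "(v, x) \<in> Rel V ^^ t" "(x, w) \<in> Rel V" by auto
    then have xc: "(v, x) \<in> Rel (comp u) ^^ t" "x \<in> comp u" using Suc by auto
    moreover have "w \<in> comp u" using comp_closed[OF u] x xc unfolding closed_set_def Rel_def by blast
    ultimately have "(x, w) \<in> Rel (comp u)" using x by (auto simp: Rel_def)
    then have "(v, w) \<in> Rel (comp u) ^^ Suc t" by (rule relpow_Suc_I[OF xc(1)])
    then show ?case using \<open>w \<in> comp u\<close> by blast
  qed
  show ?thesis unfolding conn_def
  proof (intro ballI)
    fix v w assume vw: "v \<in> comp u" "w \<in> comp u"
    then have "w \<in> comp v" using comp_eq by blast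
    then obtain t where "(v, w) \<in> Rel V ^^ t" unfolding comp_def by blast
    then show "\<exists>t. (v, w) \<in> Rel (comp u) ^^ t" using * vw by blast
  qed
qed

text \<open>At a zero of the nonnegative eigenvector given by the absolute values, the sum over the
  neighbours is zero, so all of them are zeros. Hence one linear condition per component suffices to
  kill an eigenvector.\<close>

lemma eigen_zero_propagates:
  assumes q: "qle \<mu> V" and x: "eigen \<mu> x" "x u = 0" and w: "w \<in> comp u"
  shows "x w = 0"
proof -
  obtain t where "(u, w) \<in> Rel V ^^ t" using w unfolding comp_def by blast
  then show ?thesis
  proof (induction t arbitrary: w)
    case 0 then show ?case using x by simp
  next
    case (Suc t)
    then obtain v where v: "(u, v) \<in> Rel V ^^ t" "(v, w) \<in> Rel V" by auto
    then have "x v = 0" using Suc by blast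
    then have "A (\<lambda>u. \<bar>x u\<bar>) v = 0" using eigen_abs[OF q x(1)] by (simp add: eigen_def)
    moreover have "\<bar>x w\<bar> \<le> A (\<lambda>u. \<bar>x u\<bar>) v" using v by (intro A_ge_nbr) (auto simp: Rel_def)
    ultimately show ?case by simp
  qed
qed

text \<open>The sum of \<open>x\<close> and its absolute value is an eigenvector that vanishes where
  \<open>x\<close> is negative, hence on the whole component.\<close>

lemma eigen_constant_sign:
  assumes q: "qle \<mu> V" and x: "eigen \<mu> x"
  shows "(\<forall>w\<in>comp u. x w \<ge> 0) \<or> (\<forall>w\<in>comp u. x w \<le> 0)"
proof (rule disjCI)
  assume "\<not> (\<forall>w\<in>comp u. x w \<le> 0)"
  then obtain v where v: "v \<in> comp u" "x v > 0" by (auto simp: not_le)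
  define y where "y = (\<lambda>u. 1 * x u + 1 * \<bar>x u\<bar>)"
  have y: "eigen \<mu> y" unfolding y_def by (intro eigen_comb x eigen_abs q)
  show "\<forall>w\<in>comp u. x w \<ge> 0"
  proof (rule ccontr)
    assume "\<not> (\<forall>w\<in>comp u. x w \<ge> 0)"
    then obtain w where w: "w \<in> comp u" "x w < 0" by (auto simp: not_le)
    then have "y w = 0" by (simp add: y_def)
    moreover have "v \<in> comp w" using v comp_eq[OF w(1)] by simp
    ultimately have "y v = 0" using eigen_zero_propagates[OF q y] by blast
    then show False using v by (simp add: y_def)
  qed
qed

text \<open>In a smallest violating closed set, a harmless component could be split off: the rest is
  harmless by minimality, and the forms of the two parts add up without a cross term.\<close>

lemma violating_component_exists:
  assumes "\<not> qle \<mu> V"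
  shows "\<exists>u\<in>V. \<not> qle \<mu> (comp u)"
proof -
  define P where "P C \<longleftrightarrow> closed_set C \<and> \<not> qle \<mu> C" for C
  have "P V" unfolding P_def closed_set_def using assms E_V2 by auto
  then obtain C where C: "P C" "\<And>D. P D \<Longrightarrow> card C \<le> card D"
    using ex_has_least_nat[of P V card] by metis
  have cl: "closed_set C" "C \<subseteq> V" using C by (auto simp: P_def closed_set_def)
  have fC: "finite C" using cl fin finite_subset by blast
  have small: "qle \<mu> D" if "closed_set D" "D \<subset> C" for D
    using C(2)[of D] that psubset_card_mono[OF fC that(2)] by (auto simp: P_def)
  have "C \<noteq> {}"
  proof
    assume "C = {}"
    then have "qle \<mu> C" unfolding qle_def supp_def ip_def by simp
    then show False using C by (simp add: P_def)
  qed
  then obtain u where u: "u \<in> C" by blast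
  then have uV: "u \<in> V" using cl by blast
  have "w \<in> C" if "(u, w) \<in> Rel V ^^ t" for t w
    using that
  proof (induction t arbitrary: w)
    case (Suc t)
    then obtain x where "(u, x) \<in> Rel V ^^ t" "(x, w) \<in> Rel V" by auto
    then show ?case using Suc.IH cl(1) unfolding closed_set_def Rel_def by blast
  qed (use u in simp)
  then have sub: "comp u \<subseteq> C" unfolding comp_def by blast
  have "\<not> qle \<mu> (comp u)"
  proof
    assume qu: "qle \<mu> (comp u)"
    have cu: "closed_set (comp u)" using uV by (rule comp_closed)
    have "closed_set (C - comp u)" using cl(1) cu E_sym unfolding closed_set_def by blast
    moreover have "C - comp u \<subset> C" using u comp_self by blast
    ultimately have qd: "qle \<mu> (C - comp u)" using small by blast
    have "qle \<mu> C" unfolding qle_def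
    proof (intro allI impI)
      fix x assume x: "supp C x"
      define y z where "y = cut (comp u) x" and "z = cut (C - comp u) x"
      have xyz: "x = (\<lambda>u. 1 * y u + 1 * z u)"
        using x sub by (auto simp: y_def z_def cut_def supp_def fun_eq_iff)
      have "ip z y = 0" unfolding ip_def by (intro sum.neutral) (auto simp: y_def z_def cut_def)
      moreover have "ip z (A y) = 0"
        unfolding y_def A_cut_closed[OF cu] ip_def by (intro sum.neutral) (auto simp: z_def cut_def)
      moreover have "ip y (A y) \<le> \<mu> * ip y y" using qu unfolding qle_def y_def by simp
      moreover have "ip z (A z) \<le> \<mu> * ip z z" using qd unfolding qle_def z_def by simp
      ultimately show "ip x (A x) \<le> \<mu> * ip x x"
        unfolding xyz ip_A_add ip_self_add by (simp add: algebra_simps)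
    qed
    then show False using C(1) by (simp add: P_def)
  qed
  then show ?thesis using uV by blast
qed

end

text \<open>\<open>rank\<close> says that the kernel of \<open>l * I - A + J / 2\<close> has
  codimension at most \<open>d\<close>: it contains a nonzero vector satisfying the further
  conditions \<Phi> whenever they are fewer than \<open>card V - d\<close>.\<close>

locale gram_graph = balanced_graph +
  fixes d :: nat
  assumes rank: "finite \<Phi> \<Longrightarrow> card \<Phi> + d < card V \<Longrightarrow>
    \<exists>x. supp V x \<and> (\<exists>u. x u \<noteq> 0) \<and> (\<forall>\<phi>\<in>\<Phi>. ip \<phi> x = 0) \<and>
      (\<forall>u\<in>V. A x u = l * x u + (\<Sum>u\<in>V. x u) / 2)"
begin

text \<open>The witness \<open>c\<close> is the number of components carrying an eigenvector for
  \<open>l\<close>. Kernel vectors satisfying \<open>c - 1\<close> point conditions vanish, so the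
  kernel has dimension at most \<open>c - 1\<close>.\<close>

lemma bound_if_radius_le:
  assumes q: "qle l V" and k: "\<And>u x. eigen l x \<Longrightarrow> x u \<noteq> 0 \<Longrightarrow> k \<le> card (comp u)"
  shows "card V \<le> d \<or> (\<exists>c>0. card V + 1 \<le> d + c \<and> k * c \<le> card V)"
proof -
  define Q where "Q = comp ` {u. \<exists>x. eigen l x \<and> x u \<noteq> 0}"
  have "{u. \<exists>x. eigen l x \<and> x u \<noteq> 0} \<subseteq> V" by (auto simp: eigen_def supp_def)
  then have QV: "Q \<subseteq> comp ` V" unfolding Q_def by blast
  then have fQ: "finite Q" using fin finite_surj by blast
  have sub: "C \<subseteq> V" if "C \<in> Q" for C using QV that comp_subset by blast
  have disj: "C = D \<or> C \<inter> D = {}" if "C \<in> Q" "D \<in> Q" for C D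
    using that comp_eq unfolding Q_def by blast
  have "k * card Q = (\<Sum>C\<in>Q. k)" by simp
  also have "\<dots> \<le> (\<Sum>C\<in>Q. card C)" using k unfolding Q_def by (intro sum_mono) auto
  also have "\<dots> = card (\<Union>Q)"
    
  proof (rule card_Union_disjoint[symmetric])
    show "pairwise disjnt Q" using disj unfolding pairwise_def disjnt_def by blast
    show "finite C" if "C \<in> Q" for C using sub[OF that] fin finite_subset by blast
  qed
  also have "\<dots> \<le> card V" using sub fin by (intro card_mono) auto
  finally have kQ: "k * card Q \<le> card V" .
  \<comment> \<open>Pairing the kernel equation with \<open>x\<close> leaves half the squared
    coefficient sum on the wrong side of the form bound, so the sum is zero.\<close>
  have kernel: "eigen l x \<and> (\<Sum>u\<in>V. x u) = 0"
    if x: "supp V x" "\<forall>u\<in>V. A x u = l * x u + (\<Sum>u\<in>V. x u) / 2" for x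
  proof -
    define t where "t = (\<Sum>u\<in>V. x u)"
    have "ip x (A x) = (\<Sum>u\<in>V. l * (x u * x u) + x u * t / 2)"
      unfolding ip_def using x(2) by (intro sum.cong) (auto simp: algebra_simps t_def)
    also have "\<dots> = l * ip x x + t * t / 2"
      unfolding ip_def sum.distrib sum_distrib_left[symmetric] sum_divide_distrib[symmetric]
        sum_distrib_right[symmetric] t_def[symmetric] by simp
    finally have "t * t / 2 \<le> 0" using q x unfolding qle_def by fastforce
    then have "t = 0" by (auto simp: mult_le_0_iff)
    then show ?thesis using x by (auto intro!: eigenI simp: t_def)
  qed
  show ?thesis
  proof (cases "Q = {}")
    case True
    have "\<not> d < card V"
    proof
      assume "d < card V"
      then obtain x where x: "supp V x" "\<exists>u. x u \<noteq> 0" "\<forall>u\<in>V. A x u = l * x u + (\<Sum>u\<in>V. x u) / 2"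
        using rank[of "{}"] by auto
      then show False using kernel True unfolding Q_def by blast
    qed
    then show ?thesis by simp
  next
    case False
    then obtain C0 where C0: "C0 \<in> Q" by blast
    define rep where "rep C = (SOME u. u \<in> C)" for C :: "'a set"
    have rep: "rep C \<in> C" if "C \<in> Q" for C
    proof -
      have "\<exists>u. u \<in> C" using that comp_self unfolding Q_def by blast
      then show ?thesis unfolding rep_def by (rule someI_ex)
    qed
    \<comment> \<open>\<open>C0\<close> needs no condition: a vector living on it alone has constant
      sign there, and its coefficient sum is zero. This saves the 1 in
      \<open>card V + 1\<close>.\<close>
    define \<Phi> where "\<Phi> = (\<lambda>C. ind (rep C)) ` (Q - {C0})"
    have "card \<Phi> \<le> card (Q - {C0})" unfolding \<Phi>_def using fQ by (intro card_image_le) auto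
    also have "\<dots> = card Q - 1" using C0 fQ by simp
    finally have c\<Phi>: "card \<Phi> \<le> card Q - 1" .
    have cQ: "card Q > 0" using C0 fQ by (auto simp: card_gt_0_iff)
    have "\<not> card \<Phi> + d < card V"
    proof
      assume "card \<Phi> + d < card V"
      moreover have "finite \<Phi>" unfolding \<Phi>_def using fQ by simp
      ultimately obtain x where x: "supp V x" "\<exists>u. x u \<noteq> 0" "\<forall>\<phi>\<in>\<Phi>. ip \<phi> x = 0"
        "\<forall>u\<in>V. A x u = l * x u + (\<Sum>u\<in>V. x u) / 2"
        using rank[of \<Phi>] by blast
      have ex: "eigen l x" and sx: "(\<Sum>u\<in>V. x u) = 0" using kernel x by blast+
      have out: "x u = 0" if u: "u \<notin> C0" for u
      proof (rule ccontr)
        assume nz: "x u \<noteq> 0"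
        then have CQ: "comp u \<in> Q" using ex unfolding Q_def by blast
        moreover have "comp u \<noteq> C0" using u comp_self by blast
        ultimately have "ip (ind (rep (comp u))) x = 0" using x(3) unfolding \<Phi>_def by blast
        moreover have r: "rep (comp u) \<in> comp u" using rep CQ by blast
        ultimately have "x (rep (comp u)) = 0" using ip_ind sub[OF CQ] by auto
        moreover have "u \<in> comp (rep (comp u))" using comp_eq[OF r] comp_self by simp
        ultimately show False using eigen_zero_propagates[OF q ex] nz by blast
      qed
      have xsign: "(\<forall>w\<in>V. x w \<ge> 0) \<or> (\<forall>w\<in>V. x w \<le> 0)"
      proof -
        obtain u0 where "C0 = comp u0" using C0 unfolding Q_def by blast
        then have "(\<forall>w\<in>C0. x w \<ge> 0) \<or> (\<forall>w\<in>C0. x w \<le> 0)" using eigen_constant_sign[OF q ex] by blast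
        then show ?thesis using out by (metis order_refl)
      qed
      have "\<forall>w\<in>V. x w = 0"
      proof (cases "\<forall>w\<in>V. x w \<ge> 0")
        case True
        then show ?thesis using sx fin by (simp add: sum_nonneg_eq_0_iff)
      next
        case False
        then have "\<forall>w\<in>V. - x w \<ge> 0" "(\<Sum>u\<in>V. - x u) = 0" using xsign sx by (auto simp: sum_negf)
        then show ?thesis using fin by (simp add: sum_nonneg_eq_0_iff del: neg_0_le_iff_le)
      qed
      then show False using x(1,2) by (auto simp: supp_def)
    qed
    then have "card V + 1 \<le> d + card Q" using c\<Phi> cQ by simp
    then show ?thesis using cQ kQ by blast
  qed
qed

text \<open>The part of \<open>x\<close> outside the violating component, taken in absolute value,
  would be a second violator (with equality), separated from the first.\<close>

lemma eigen_supported: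
  assumes u: "u \<in> V" "\<not> qle l (comp u)" and x: "eigen l x"
  shows "supp (comp u) x"
proof (rule ccontr)
  assume "\<not> supp (comp u) x"
  then obtain v where v: "v \<notin> comp u" "x v \<noteq> 0" by (auto simp: supp_def)
  define y where "y = cut (V - comp u) x"
  define z where "z = (\<lambda>u. \<bar>y u\<bar>)"
  have cl: "closed_set (comp u)" using u by (intro comp_closed)
  have y: "eigen l y" unfolding y_def by (intro eigen_cut closed_compl cl x)
  obtain c where c: "supp (comp u) c" "\<And>u. 0 \<le> c u" "l * ip c c < ip c (A c)"
    using not_qle_witness u by blast
  have vV: "v \<in> V" using x v unfolding eigen_def supp_def by blast
  have sz: "supp (V - comp u) z" unfolding z_def y_def by (auto simp: supp_def cut_def)
  have "\<And>u. 0 \<le> z u" "z v \<noteq> 0" unfolding z_def y_def using v vV by (auto simp: cut_def)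
  moreover have "l * ip z z \<le> ip z (A z)"
    using abs_ip_A_le[of y] eigen_ip[OF y] unfolding z_def ip_abs by linarith
  moreover have "ip z c = 0" using c sz by (intro orth_disjoint) auto
  moreover have "ip z (A c) = 0"
    using cl E_sym unfolding closed_set_def by (intro orth_no_edges[OF c(1) sz]) blast
  moreover have "supp V c" "supp V z" using c sz comp_subset[OF u(1)] supp_mono by blast+
  ultimately show False using no_two_violators c by blast
qed

text \<open>Orthogonalization by counting conditions: coefficient sum zero (which makes a kernel
  vector an eigenvector), vanishing on \<open>T\<close>, and orthogonality to the vectors found so
  far.\<close>

lemma orthonormal_eigenfamily:
  assumes u: "u \<in> V" "\<not> qle l (comp u)" and T: "T \<subseteq> comp u"
    and m: "d + 1 + card T + m \<le> card V"
  shows "\<exists>e. orthonormal m e \<and> (\<forall>i<m. supp (comp u - T) (e i)) \<and> (\<forall>i<m. \<forall>u\<in>V. A (e i) u = l * e i u)"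
  using m
proof (induction m)
  case 0 then show ?case by (simp add: orthonormal_def)
next
  case (Suc m)
  then obtain e where e: "orthonormal m e" "\<forall>i<m. supp (comp u - T) (e i)" "\<forall>i<m. \<forall>u\<in>V. A (e i) u = l * e i u"
    by auto
  define \<Phi> where "\<Phi> = insert (\<lambda>_. 1) (ind ` T \<union> e ` {..<m})"
  have TV: "T \<subseteq> V" using T comp_subset[OF u(1)] by blast
  then have fT: "finite T" using fin finite_subset by blast
  have f\<Phi>: "finite \<Phi>" unfolding \<Phi>_def using fT by simp
  have "card (ind ` T) \<le> card T" "card (e ` {..<m}) \<le> m"
    using card_image_le[OF fT] card_image_le[of "{..<m}" e] by auto
  then have "card \<Phi> \<le> 1 + (card T + m)"
    unfolding \<Phi>_def using card_Un_le[of "ind ` T" "e ` {..<m}"] fT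
    by (subst card_insert_if) auto
  then have "card \<Phi> + d < card V" using Suc.prems by simp
  then obtain x where x: "supp V x" "\<exists>u. x u \<noteq> 0" "\<forall>\<phi>\<in>\<Phi>. ip \<phi> x = 0"
      "\<forall>u\<in>V. A x u = l * x u + (\<Sum>u\<in>V. x u) / 2"
    using rank[OF f\<Phi>] by blast
  have "ip (\<lambda>_. 1) x = 0" using x(3) unfolding \<Phi>_def by blast
  then have s0: "(\<Sum>u\<in>V. x u) = 0" by (simp add: ip_def)
  have ex: "eigen l x" using x s0 by (intro eigenI) auto
  have xT: "x t = 0" if "t \<in> T" for t
  proof -
    have "ip (ind t) x = 0" using x(3) that unfolding \<Phi>_def by blast
    then show ?thesis using ip_ind TV that by auto
  qed
  have sx: "supp (comp u - T) x" using eigen_supported[OF u ex] xT by (auto simp: supp_def)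
  have ox: "ip (e i) x = 0" if "i < m" for i using x(3) that unfolding \<Phi>_def by blast
  define n where "n = sqrt (ip x x)"
  have n: "n > 0" "n * n = ip x x" using ip_self_pos[OF x(1)] x(2) unfolding n_def by (auto simp: ip_self_nonneg)
  define e' where "e' = e(m := (\<lambda>u. x u / n))"
  have e'm: "e' m = (\<lambda>u. x u / n)" "\<And>i. i < m \<Longrightarrow> e' i = e i" by (auto simp: e'_def)
  have ipn: "ip y (\<lambda>u. x u / n) = ip y x / n" for y
    unfolding ip_def by (simp add: sum_divide_distrib)
  have "orthonormal (Suc m) e'"
    unfolding orthonormal_def
  proof (intro allI impI)
    fix i j assume ij: "i < Suc m" "j < Suc m"
    consider "i < m" "j < m" | "i = m" "j = m" | "i = m" "j < m" | "i < m" "j = m" using ij by linarith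
    then show "ip (e' i) (e' j) = (if i = j then 1 else 0)"
    proof cases
      case 1 then show ?thesis using e(1) e'm by (simp add: orthonormal_def)
    next
      case 2
      have "ip (\<lambda>u. x u / n) (\<lambda>u. x u / n) = ip x x / n / n"
        unfolding ipn using ipn[of x] ip_commute by metis
      then show ?thesis using 2 n(1) by (simp add: e'm n(2)[symmetric])
    next
      case 3 then show ?thesis using ox[of j] by (simp add: e'm ip_commute[of _ "e j"] ipn)
    next
      case 4 then show ?thesis using ox[of i] by (simp add: e'm ipn)
    qed
  qed
  moreover have "\<forall>i<Suc m. supp (comp u - T) (e' i)"
    using e(2) sx e'm by (auto simp: less_Suc_eq supp_def)
  moreover have "A (e' i) v = l * e' i v" if "i < Suc m" "v \<in> V" for i v
  proof (cases "i = m")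
    case True
    have "A (\<lambda>u. x u / n) v = A x v / n" unfolding A_def by (simp add: sum_divide_distrib)
    then show ?thesis using True ex by (simp add: e'm eigen_def)
  qed (use that e(3) e'm in auto)
  ultimately show ?case by blast
qed

lemma bound_if_radius_gt:
  assumes nq: "\<not> qle l V" and deg: "\<And>u. card {w. E u w} \<le> \<Delta>"
  shows "card V \<le> d + 2 + \<rho> + real ((\<Delta> + 1) ^ (4 * \<rho> * (s + 1) + 1))
     + (1 / real (\<rho> + 1) + (max 0 (1 - 1 / l ^ (4 * \<rho>))) ^ s) * card V"
proof -
  define \<kappa> where "\<kappa> = max 0 (1 - 1 / l ^ (4 * \<rho>))"
  define B where "B = real ((\<Delta> + 1) ^ (4 * \<rho> * (s + 1) + 1))"
  have \<kappa>: "\<kappa> \<ge> 0" "B \<ge> 0" unfolding \<kappa>_def B_def by auto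
  obtain u where u: "u \<in> V" "\<not> qle l (comp u)" using violating_component_exists[OF nq] by blast
  define C where "C = comp u"
  have C: "C \<subseteq> V" unfolding C_def using comp_subset[OF u(1)] .
  have cC: "real (card C) \<le> card V" using C fin by (simp add: card_mono)
  have main: "card V \<le> d + 1 + card T + m + 1" if T: "T \<subseteq> C" and
    m: "\<And>k e. orthonormal k e \<Longrightarrow> \<forall>i<k. supp (C - T) (e i) \<Longrightarrow> \<forall>i<k. \<forall>u\<in>V. A (e i) u = l * e i u \<Longrightarrow> real k \<le> m" 
    "0 \<le> m" for T and m :: real
  proof (cases "d + 1 + card T \<le> card V")
    case True
    then obtain k where k: "card V = d + 1 + card T + k" using le_Suc_ex by blast
    then have "real k \<le> m" using orthonormal_eigenfamily[OF u, of T k] T m unfolding C_def by auto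
    then show ?thesis using k by simp
  next
    case False then have "real (card V) \<le> d + 1 + card T" by simp
    then show ?thesis using m by linarith
  qed
  have "real (card V) \<le> d + 2 + \<rho> + B + card V / real (\<rho> + 1) + card V * \<kappa> ^ s"
  proof (cases "\<rho> + 1 \<le> card C")
    case True
    have "conn C" unfolding C_def by (rule comp_conn[OF u(1)])
    show ?thesis
    proof (rule multiplicity_bound[OF deg C \<open>conn C\<close> True, of s])
      fix T assume T: "T \<subseteq> C" "real (card T) \<le> real ((\<Delta> + 1) ^ (4 * \<rho> * (s + 1) + 1)) + card C / real (\<rho> + 1)"
        "\<And>m e. orthonormal m e \<Longrightarrow> \<forall>i<m. supp (C - T) (e i) \<Longrightarrow> \<forall>i<m. \<forall>u\<in>V. A (e i) u = l * e i u \<Longrightarrow>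
          real m \<le> card C * (max 0 (1 - 1 / l ^ (4 * \<rho>))) ^ s"
      note T = T[folded \<kappa>_def B_def]
      have "card V \<le> d + 1 + card T + card C * \<kappa> ^ s + 1" using main[OF T(1,3)] \<kappa> by simp
      moreover have "card C * \<kappa> ^ s \<le> card V * \<kappa> ^ s" using cC \<kappa> by (intro mult_right_mono) auto
      moreover have "card C / real (\<rho> + 1) \<le> card V / real (\<rho> + 1)" using cC by (intro divide_right_mono) auto
      ultimately show ?thesis using T(2) by linarith
    qed
  next
    case False
    \<comment> \<open>A component with at most \<rho> vertices has no useful net; taking all of it
      as \<open>T\<close> leaves no eigenvector at all.\<close>
    have "real (card V) \<le> real (d + 1 + card C) + 0 + 1"
    proof (rule main[of C 0])
      fix k e assume e: "orthonormal k e" "\<forall>i<k. supp (C - C) (e i)"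
      have "k = 0"
      proof (rule ccontr)
        assume "k \<noteq> 0"
        then have "supp {} (e 0)" "ip (e 0) (e 0) = 1" using e unfolding orthonormal_def by auto
        then show False by (simp add: ip_def supp_def)
      qed
      then show "real k \<le> 0" by simp
    qed auto
    moreover have "0 \<le> card V / real (\<rho> + 1)" "0 \<le> card V * \<kappa> ^ s" using \<kappa> by auto
    ultimately show ?thesis using False \<kappa> by linarith
  qed
  then show ?thesis unfolding \<kappa>_def[symmetric] B_def by (simp add: algebra_simps)
qed

end

section \<open>The largest eigenvalue\<close>

context fin_graph
begin

lemma eigen_le_qle:
  assumes "qle \<mu> V" "eigen \<nu> x" "x u \<noteq> 0"
  shows "\<nu> \<le> \<mu>"
proof -
  have s: "supp V x" using assms(2) by (simp add: eigen_def)
  have "\<nu> * ip x x \<le> \<mu> * ip x x" using assms(1) s eigen_ip[OF assms(2)] unfolding qle_def by metis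
  then show ?thesis using ip_self_pos[OF s assms(3)] by (simp add: mult_le_cancel_right)
qed

text \<open>The coefficient of the right side becomes the extra unknown \<open>None\<close>, giving
  one unknown more than equations. Injectivity forces it to be nonzero, and scaling makes it
  1.\<close>

lemma shift_solvable:
  assumes inj: "\<And>x. eigen \<mu> x \<Longrightarrow> \<forall>u. x u = 0" and v: "v \<in> V"
  shows "\<exists>c. supp V c \<and> (\<forall>u\<in>V. \<mu> * c u - A c u = ind v u)"
proof -
  define \<phi> where "\<phi> u z = (case z of None \<Rightarrow> - ind v u | Some w \<Rightarrow> \<mu> * ind u w - of_bool (E u w))" for u z
  define X where "X = insert None (Some ` V)"
  have X: "finite X" "card X = card V + 1" unfolding X_def using fin by (auto simp: card_image)
  have sumX: "(\<Sum>z\<in>X. \<phi> u z * y z) = - ind v u * y None + (\<mu> * y (Some u) - A (\<lambda>w. y (Some w)) u)" if "u \<in> V" for u y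
  proof -
    have "(\<Sum>z\<in>X. \<phi> u z * y z) = - ind v u * y None + (\<Sum>w\<in>V. (\<mu> * ind u w - of_bool (E u w)) * y (Some w))"
      unfolding X_def using fin by (simp add: sum.reindex \<phi>_def)
    also have "(\<Sum>w\<in>V. (\<mu> * ind u w - of_bool (E u w)) * y (Some w)) 
       = \<mu> * ip (ind u) (\<lambda>w. y (Some w)) - A (\<lambda>w. y (Some w)) u"
      unfolding A_def ip_def by (simp add: sum_subtractf sum_distrib_left algebra_simps)
    finally show ?thesis using ip_ind[OF that] by simp
  qed
  have "card (\<phi> ` V) < card X" using card_image_le[OF fin, of \<phi>] X by simp
  then obtain y where y: "\<forall>z. z \<notin> X \<longrightarrow> y z = 0" "\<exists>z. y z \<noteq> 0" "\<forall>f\<in>\<phi> ` V. (\<Sum>z\<in>X. f z * y z) = 0"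
    using underdetermined_system[OF X(1), of "\<phi> ` V"] fin by blast
  define x where "x w = y (Some w)" for w
  have x: "supp V x" using y(1) unfolding supp_def x_def X_def by blast
  have eq: "\<mu> * x u - A x u = ind v u * y None" if "u \<in> V" for u
  proof -
    have "(\<Sum>z\<in>X. \<phi> u z * y z) = 0" using y(3) that by blast
    then show ?thesis using sumX[OF that, of y] unfolding x_def by simp
  qed
  have "y None \<noteq> 0"
  proof
    assume 0: "y None = 0"
    then have "eigen \<mu> x" using eq by (intro eigenI x) simp
    then have "x u = 0" for u using inj by blast
    then have "y z = 0" for z using 0 unfolding x_def by (cases z) auto
    then show False using y(2) by blast
  qed
  then have "\<mu> * (x u / y None) - A (\<lambda>u. x u / y None) u = ind v u" if "u \<in> V" for u
  proof -
    have "A (\<lambda>u. x u / y None) u = A x u / y None" unfolding A_def by (simp add: sum_divide_distrib)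
    then show ?thesis using eq[OF that] \<open>y None \<noteq> 0\<close> by (simp add: field_simps)
  qed
  moreover have "supp V (\<lambda>u. x u / y None)" using x by (simp add: supp_def)
  ultimately show ?thesis by blast
qed

text \<open>If \<open>\<mu> - A\<close> is positive semidefinite and invertible, its inverse bounds it away from zero, so
  that the supremum of the Rayleigh quotients must be an eigenvalue.\<close>

lemma qle_improve:
  assumes q: "qle \<mu> V" and inj: "\<And>x. eigen \<mu> x \<Longrightarrow> \<forall>u. x u = 0"
  shows "\<exists>\<delta>>0. \<forall>x. supp V x \<and> ip x x = 1 \<longrightarrow> ip x (A x) \<le> \<mu> - \<delta>"
proof -
  obtain c where c: "\<And>v. v \<in> V \<Longrightarrow> supp V (c v)" "\<And>v u. v \<in> V \<Longrightarrow> u \<in> V \<Longrightarrow> \<mu> * c v u - A (c v) u = ind v u"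
    using shift_solvable[OF inj] by metis
  \<comment> \<open>An upper bound for the form of the inverse on unit vectors, whose entries are at
    most 1 in absolute value; the added 1 makes it positive.\<close>
  define K where "K = (\<Sum>u\<in>V. \<Sum>v\<in>V. \<bar>c v u\<bar>) + 1"
  have K: "K > 0" unfolding K_def by (intro add_nonneg_pos sum_nonneg) auto
  have "ip x (A x) \<le> \<mu> - 1 / K" if x: "supp V x" "ip x x = 1" for x
  proof -
    \<comment> \<open>\<open>y\<close> is the image of \<open>x\<close> under the inverse of
      \<open>\<mu> - A\<close>, whose columns are the \<open>c v\<close>.\<close>
    define y where "y u = (\<Sum>v\<in>V. x v * c v u)" for u
    have y: "supp V y" using c(1) unfolding supp_def y_def by (auto intro!: sum.neutral)
    have Ay: "A y u = \<mu> * y u - x u" if u: "u \<in> V" for u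
    proof -
      have "A y u = (\<Sum>w\<in>V. \<Sum>v\<in>V. of_bool (E u w) * (x v * c v w))"
        unfolding A_def y_def by (simp add: sum_distrib_left)
      also have "\<dots> = (\<Sum>v\<in>V. \<Sum>w\<in>V. of_bool (E u w) * (x v * c v w))" by (rule sum.swap)
      also have "\<dots> = (\<Sum>v\<in>V. x v * A (c v) u)"
        unfolding A_def sum_distrib_left by (intro sum.cong) auto
      also have "\<dots> = (\<Sum>v\<in>V. \<mu> * (x v * c v u) - x v * ind v u)"
      proof (intro sum.cong refl)
        fix v assume "v \<in> V"
        then have e: "A (c v) u = \<mu> * c v u - ind v u" using c(2)[of v u] u by simp
        show "x v * A (c v) u = \<mu> * (x v * c v u) - x v * ind v u" unfolding e by (simp add: algebra_simps)
      qed
      also have "\<dots> = \<mu> * y u - (\<Sum>v\<in>V. x v * ind v u)"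
        unfolding y_def by (simp add: sum_subtractf sum_distrib_left)
      also have "(\<Sum>v\<in>V. x v * ind v u) = ip (ind u) x"
        unfolding ip_def by (intro sum.cong) (auto simp: ind_def)
      finally show ?thesis using ip_ind[OF u] by simp
    qed
    have ipAy: "ip z (A y) = \<mu> * ip z y - ip z x" for z
    proof -
      have "ip z (A y) = (\<Sum>u\<in>V. \<mu> * (z u * y u) - z u * x u)"
        unfolding ip_def by (intro sum.cong refl) (simp add: Ay algebra_simps)
      then show ?thesis unfolding ip_def by (simp add: sum_subtractf sum_distrib_left)
    qed
    have yx: "ip y x \<le> K"
    proof -
      have x1: "\<bar>x u\<bar> \<le> 1" for u
      proof (cases "u \<in> V")
        case True
        then have "x u * x u \<le> ip x x" unfolding ip_def using fin by (intro member_le_sum) auto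
        then show ?thesis using x by (simp add: power2_eq_square flip: abs_square_le_1)
      qed (use x in \<open>auto simp: supp_def\<close>)
      have "ip y x \<le> (\<Sum>u\<in>V. (\<Sum>v\<in>V. \<bar>c v u\<bar>))"
        unfolding ip_def
      proof (intro sum_mono)
        fix u assume "u \<in> V"
        have "y u * x u \<le> \<bar>y u\<bar> * \<bar>x u\<bar>" by (metis abs_ge_self abs_mult)
        also have "\<dots> \<le> \<bar>y u\<bar> * 1" using x1 by (intro mult_left_mono) auto
        also have "\<bar>y u\<bar> \<le> (\<Sum>v\<in>V. \<bar>x v * c v u\<bar>)" unfolding y_def by (rule sum_abs)
        also have "\<dots> \<le> (\<Sum>v\<in>V. 1 * \<bar>c v u\<bar>)"
          unfolding abs_mult using x1 by (intro sum_mono mult_right_mono) auto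
        finally show "y u * x u \<le> (\<Sum>v\<in>V. \<bar>c v u\<bar>)" by simp
      qed
      then show ?thesis unfolding K_def by simp
    qed
    \<comment> \<open>The minimum of \<open>2 * t + t\<^sup>2 * K\<close>.\<close>
    define t where "t = - 1 / K"
    have "ip (\<lambda>u. 1 * x u + t * y u) (A (\<lambda>u. 1 * x u + t * y u))
       \<le> \<mu> * ip (\<lambda>u. 1 * x u + t * y u) (\<lambda>u. 1 * x u + t * y u)"
      using q supp_comb[OF x(1) y] unfolding qle_def by blast
    moreover have "ip y (A x) = \<mu> * ip y x - 1"
      using ipAy[of x] x(2) by (metis ip_A ip_commute)
    ultimately have "ip x (A x) \<le> \<mu> + 2 * t + t\<^sup>2 * ip y x"
      unfolding ip_A_add ip_self_add ipAy x(2) by (simp add: algebra_simps)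
    also have "\<dots> \<le> \<mu> + 2 * t + t\<^sup>2 * K" using yx by (intro add_left_mono mult_left_mono) auto
    also have "\<dots> = \<mu> - 1 / K" unfolding t_def using K by (simp add: field_simps power2_eq_square)
    finally show ?thesis .
  qed
  then show ?thesis using K by (intro exI[of _ "1 / K"]) auto
qed

lemma top_eigenvector:
  assumes "V \<noteq> {}"
  shows "\<exists>\<mu> x u. qle \<mu> V \<and> eigen \<mu> x \<and> x u \<noteq> 0"
proof -
  define S where "S = {ip x (A x) | x. supp V x \<and> ip x x = 1}"
  obtain v where v: "v \<in> V" using assms by blast
  have "ip (ind v) (ind v) = 1" using ip_ind[OF v] by (simp add: ind_def)
  then have ne: "S \<noteq> {}" unfolding S_def using supp_ind[OF v] by blast
  have bd: "ip x (A x) \<le> real (card V) * real (card V)" if x: "supp V x" "ip x x = 1" for x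
  proof -
    have x1: "\<bar>x u\<bar> \<le> 1" for u
    proof (cases "u \<in> V")
      case True
      then have "x u * x u \<le> ip x x" unfolding ip_def using fin by (intro member_le_sum) auto
      then show ?thesis using x by (simp add: power2_eq_square flip: abs_square_le_1)
    qed (use x in \<open>auto simp: supp_def\<close>)
    have "ip x (A x) \<le> ip (\<lambda>u. \<bar>x u\<bar>) (A (\<lambda>u. \<bar>x u\<bar>))" using abs_ip_A_le[of x] by linarith
    also have "\<dots> \<le> (\<Sum>u\<in>V. 1 * (\<Sum>w\<in>V. 1))"
      unfolding ip_def A_def using x1 by (intro sum_mono mult_mono sum_nonneg) (auto simp: of_bool_def)
    finally show ?thesis by simp
  qed
  have bdd: "bdd_above S" unfolding S_def bdd_above_def using bd by blast
  define \<mu> where "\<mu> = Sup S"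
  have q: "qle \<mu> V" unfolding qle_def
  proof (intro allI impI)
    fix x assume x: "supp V x"
    show "ip x (A x) \<le> \<mu> * ip x x"
    proof (cases "\<exists>u. x u \<noteq> 0")
      case False
      then show ?thesis by (simp add: ip_def)
    next
      case True
      then have p: "ip x x > 0" using ip_self_pos[OF x] by blast
      define a where "a = 1 / sqrt (ip x x)"
      have a: "a\<^sup>2 = 1 / ip x x" unfolding a_def using p by (simp add: power_divide)
      define z where "z = (\<lambda>u. a * x u + 0 * x u)"
      have "supp V z" unfolding z_def by (intro supp_comb x)
      moreover have "ip z z = 1" unfolding z_def ip_self_add using a p by simp
      ultimately have "ip z (A z) \<in> S" unfolding S_def by blast
      then have "ip z (A z) \<le> \<mu>" unfolding \<mu>_def by (rule cSup_upper[OF _ bdd])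
      then show ?thesis unfolding z_def ip_A_add using a p by (simp add: field_simps)
    qed
  qed
  have "\<exists>x u. eigen \<mu> x \<and> x u \<noteq> 0"
  proof (rule ccontr)
    assume "\<not> ?thesis"
    then obtain \<delta> where \<delta>: "\<delta> > 0" "\<And>x. supp V x \<Longrightarrow> ip x x = 1 \<Longrightarrow> ip x (A x) \<le> \<mu> - \<delta>"
      using qle_improve[OF q] by blast
    have "\<mu> \<le> \<mu> - \<delta>" unfolding \<mu>_def
      by (rule cSup_least[OF ne]) (use \<delta>(2) in \<open>auto simp: S_def \<mu>_def\<close>)
    then show False using \<delta> by simp
  qed
  then show ?thesis using q by blast
qed

end

section \<open>Adjacency matrices and \<open>graph_spectral_radius\<close>\<close>

abbreviation nat_graph :: "nat \<Rightarrow> nat pair_pre_digraph \<Rightarrow> bool" where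
  "nat_graph n G \<equiv> pair_graph G \<and> pverts G = {..<n}"

lemma nat_graph_fin_graph:
  assumes "nat_graph n G"
  shows "fin_graph {..<n} (\<lambda>i j. (i, j) \<in> parcs G)"
proof -
  interpret pair_graph G using assms by blast
  show ?thesis
  proof
    show "(j, i) \<in> parcs G" if "(i, j) \<in> parcs G" for i j
      using pair_sym_arcs that by (auto simp: symmetric_def elim: symE)
    show "(i, i) \<notin> parcs G" for i using pair_no_loops[of "(i, i)"] by auto
    show "i \<in> {..<n}" if "(i, j) \<in> parcs G" for i j using in_arcsD1[OF that] assms by auto
  qed simp
qed

lemma eigenvalue_adjacency_iff:
  assumes G: "nat_graph n G"
  shows "eigenvalue (adjacency_matrix n G) \<mu> \<longleftrightarrow>
    (\<exists>x u. fin_graph.eigen {..<n} (\<lambda>i j. (i, j) \<in> parcs G) \<mu> x \<and> x u \<noteq> 0)"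
proof -
  interpret fin_graph "{..<n}" "\<lambda>i j. (i, j) \<in> parcs G" by (rule nat_graph_fin_graph[OF G])
  have dim: "dim_row (adjacency_matrix n G) = n" "dim_col (adjacency_matrix n G) = n"
    by (auto simp: adjacency_matrix_def)
  have mv: "(adjacency_matrix n G *\<^sub>v v) $ i = A (\<lambda>j. if j < n then v $ j else 0) i"
    if "i < n" "v \<in> carrier_vec n" for i v
    using that unfolding A_def adjacency_matrix_def
    by (auto simp: scalar_prod_def lessThan_atLeast0 of_bool_def intro!: sum.cong)
  show ?thesis
  proof
    assume "eigenvalue (adjacency_matrix n G) \<mu>"
    then obtain v where v: "v \<in> carrier_vec n" "v \<noteq> 0\<^sub>v n" "adjacency_matrix n G *\<^sub>v v = \<mu> \<cdot>\<^sub>v v"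
      unfolding eigenvalue_def eigenvector_def dim by blast
    define x where "x j = (if j < n then v $ j else 0)" for j
    have "eigen \<mu> x"
    proof (rule eigenI)
      show "supp {..<n} x" by (auto simp: supp_def x_def)
      fix i assume i: "i \<in> {..<n}"
      then have "A x i = (\<mu> \<cdot>\<^sub>v v) $ i" using mv[of i v] v unfolding x_def by simp
      then show "A x i = \<mu> * x i" using i v by (simp add: x_def)
    qed
    moreover have "\<exists>u. x u \<noteq> 0"
    proof (rule ccontr)
      assume *: "\<not> ?thesis"
      have "v = 0\<^sub>v n"
      proof (rule eq_vecI)
        fix i assume "i < dim_vec (0\<^sub>v n :: real vec)"
        then show "v $ i = 0\<^sub>v n $ i" using * unfolding x_def by (auto split: if_splits)
      qed (use v in auto)
      then show False using v by simp
    qed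
    ultimately show "\<exists>x u. eigen \<mu> x \<and> x u \<noteq> 0" by blast
  next
    assume "\<exists>x u. eigen \<mu> x \<and> x u \<noteq> 0"
    then obtain x u where x: "eigen \<mu> x" "x u \<noteq> 0" by blast
    have sx: "supp {..<n} x" using x by (simp add: eigen_def)
    then have u: "u < n" using x by (auto simp: supp_def)
    have xx: "(\<lambda>j. if j < n then vec n x $ j else 0) = x" using sx by (auto simp: supp_def)
    have "adjacency_matrix n G *\<^sub>v vec n x = \<mu> \<cdot>\<^sub>v vec n x"
    proof (rule eq_vecI)
      fix i assume "i < dim_vec (\<mu> \<cdot>\<^sub>v vec n x)"
      then have i: "i < n" by simp
      have "(adjacency_matrix n G *\<^sub>v vec n x) $ i = A x i" using mv[OF i, of "vec n x"] unfolding xx by simp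
      then show "(adjacency_matrix n G *\<^sub>v vec n x) $ i = (\<mu> \<cdot>\<^sub>v vec n x) $ i"
        using x(1) i by (simp add: eigen_def)
    qed (simp add: dim)
    moreover have "vec n x \<noteq> 0\<^sub>v n" using u x(2) by (metis index_vec index_zero_vec(1))
    ultimately show "eigenvalue (adjacency_matrix n G) \<mu>"
      unfolding eigenvalue_def eigenvector_def dim by (intro exI[of _ "vec n x"]) auto
  qed
qed

lemma graph_spectral_radius_eqI:
  assumes G: "nat_graph n G" and q: "fin_graph.qle {..<n} (\<lambda>i j. (i, j) \<in> parcs G) \<mu> {..<n}"
    and x: "fin_graph.eigen {..<n} (\<lambda>i j. (i, j) \<in> parcs G) \<mu> x" "x u \<noteq> 0"
  shows "graph_spectral_radius n G = \<mu>"
proof -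
  interpret fin_graph "{..<n}" "\<lambda>i j. (i, j) \<in> parcs G" by (rule nat_graph_fin_graph[OF G])
  have fin_spec: "finite (spectrum (adjacency_matrix n G))"
    by (rule card_finite_spectrum[of _ n]) (simp add: adjacency_matrix_def)
  show ?thesis unfolding graph_spectral_radius_def
  proof (rule Max_eqI[OF fin_spec])
    show "\<mu> \<in> spectrum (adjacency_matrix n G)"
      unfolding spectrum_def mem_Collect_eq eigenvalue_adjacency_iff[OF G] using x by blast
    show "\<nu> \<le> \<mu>" if "\<nu> \<in> spectrum (adjacency_matrix n G)" for \<nu>
      using that eigen_le_qle[OF q] unfolding spectrum_def mem_Collect_eq eigenvalue_adjacency_iff[OF G] by blast
  qed
qed

text \<open>A form bound attained by an eigenvector exists by \<open>top_eigenvector\<close> and is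
  the spectral radius by \<open>graph_spectral_radius_eqI\<close>, so it must be \<mu>.\<close>

lemma graph_spectral_radius_top:
  assumes G: "nat_graph n G" and n: "n > 0" and r: "graph_spectral_radius n G = \<mu>"
  shows "fin_graph.qle {..<n} (\<lambda>i j. (i, j) \<in> parcs G) \<mu> {..<n}"
    and "\<exists>x u. fin_graph.eigen {..<n} (\<lambda>i j. (i, j) \<in> parcs G) \<mu> x \<and> x u \<noteq> 0"
proof -
  interpret fin_graph "{..<n}" "\<lambda>i j. (i, j) \<in> parcs G" by (rule nat_graph_fin_graph[OF G])
  obtain \<nu> x u where *: "qle \<nu> {..<n}" "eigen \<nu> x" "x u \<noteq> 0" using top_eigenvector n by blast
  then have "\<nu> = \<mu>" using graph_spectral_radius_eqI[OF G] r by blast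
  then show "qle \<mu> {..<n}" "\<exists>x u. eigen \<mu> x \<and> x u \<noteq> 0" using * by blast+
qed

text \<open>The component of \<open>u\<close>, relabelled by the bijection \<open>h\<close>, is
  itself a competitor in the infimum: it inherits the form bound from \<open>V\<close> and an
  eigenvector by cutting \<open>x\<close>.\<close>

lemma (in fin_graph) spectral_radius_order_le:
  assumes q: "qle \<mu> V" and x: "eigen \<mu> x" "x u \<noteq> 0"
  shows "spectral_radius_order \<mu> \<le> enat (card (comp u))"
proof -
  have uV: "u \<in> V" using x unfolding eigen_def supp_def by blast
  define C where "C = comp u"
  define n where "n = card C"
  have C: "C \<subseteq> V" "finite C" "u \<in> C" "closed_set C"
    unfolding C_def using comp_subset[OF uV] finite_subset[OF _ fin] comp_self comp_closed[OF uV] by auto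
  obtain h where h: "bij_betw h {..<n} C" unfolding n_def using C ex_bij_betw_nat_finite lessThan_atLeast0 by metis
  define G where "G = \<lparr>pverts = {..<n}, parcs = {(i, j). i < n \<and> j < n \<and> E (h i) (h j)}\<rparr>"
  have G: "nat_graph n G"
  proof -
    have "parcs G \<subseteq> {..<n} \<times> {..<n}" unfolding G_def by auto
    then have "finite (parcs G)" using finite_subset by blast
    have "sym (parcs G)" unfolding G_def using E_sym by (auto intro!: symI)
    then have "pair_graph G"
      using \<open>finite (parcs G)\<close> E_irrefl by unfold_locales (auto simp: symmetric_def G_def)
    then show ?thesis by (simp add: G_def)
  qed
  have GE: "(i, j) \<in> parcs G \<longleftrightarrow> i < n \<and> j < n \<and> E (h i) (h j)" for i j by (simp add: G_def)
  interpret N: fin_graph "{..<n}" "\<lambda>i j. (i, j) \<in> parcs G" by (rule nat_graph_fin_graph[OF G])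
  have reindex: "(\<Sum>i<n. F (h i)) = (\<Sum>w\<in>C. F w)" for F :: "'a \<Rightarrow> real"
    using sum.reindex_bij_betw[OF h] .
  have hC: "h i \<in> C" if "i < n" for i using h that by (auto dest: bij_betwE)
  have NA: "N.A (\<lambda>i. if i < n then y (h i) else 0) i = A y (h i)" if i: "i < n" and y: "supp C y" for i y
  proof -
    have "N.A (\<lambda>i. if i < n then y (h i) else 0) i = (\<Sum>j<n. of_bool (E (h i) (h j)) * y (h j))"
      unfolding N.A_def using i by (intro sum.cong refl) (simp add: GE)
    also have "\<dots> = (\<Sum>w\<in>C. of_bool (E (h i) w) * y w)" by (rule reindex)
    also have "\<dots> = A y (h i)"
      unfolding A_def using C fin y by (intro sum.mono_neutral_left) (auto simp: supp_def)
    finally show ?thesis .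
  qed
  have "N.qle \<mu> {..<n}" unfolding N.qle_def
  proof (intro allI impI)
    fix z :: "nat \<Rightarrow> real" assume z: "supp {..<n} z"
    define y where "y w = (if w \<in> C then z (inv_into {..<n} h w) else 0)" for w
    have y: "supp C y" by (auto simp: supp_def y_def)
    have yh: "y (h i) = z i" if "i < n" for i
      using that hC[OF that] h unfolding y_def by (simp add: bij_betw_inv_into_left)
    have zy: "z = (\<lambda>i. if i < n then y (h i) else 0)" using z yh by (auto simp: supp_def)
    have cut_sum: "(\<Sum>w\<in>V. y w * F w) = (\<Sum>w\<in>C. y w * F w)" for F :: "'a \<Rightarrow> real"
      using C fin y by (intro sum.mono_neutral_right) (auto simp: supp_def)
    have "N.ip z (N.A z) = (\<Sum>i<n. y (h i) * A y (h i))"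
      unfolding N.ip_def using yh NA[OF _ y] zy by (intro sum.cong) auto
    also have "\<dots> = ip y (A y)" unfolding ip_def cut_sum by (rule reindex)
    finally have 1: "N.ip z (N.A z) = ip y (A y)" .
    have "N.ip z z = (\<Sum>i<n. y (h i) * y (h i))"
      unfolding N.ip_def using yh by (intro sum.cong) auto
    also have "\<dots> = ip y y" unfolding ip_def cut_sum by (rule reindex)
    finally have 2: "N.ip z z = ip y y" .
    have "supp V y" using y C(1) by (rule supp_mono)
    then show "N.ip z (N.A z) \<le> \<mu> * N.ip z z" unfolding 1 2 using q by (simp add: qle_def)
  qed
  moreover define y where "y = cut C x"
  have y: "eigen \<mu> y" "supp C y" "y u \<noteq> 0"
    unfolding y_def using eigen_cut[OF C(4) x(1)] x(2) C(3) by (auto simp: cut_def supp_def)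
  define z where "z i = (if i < n then y (h i) else 0)" for i
  have "N.eigen \<mu> z"
  proof (rule N.eigenI)
    show "supp {..<n} z" by (auto simp: supp_def z_def)
    show "N.A z i = \<mu> * z i" if "i \<in> {..<n}" for i
      using NA[OF _ y(2), of i] that y(1) unfolding z_def by (simp add: eigen_def)
  qed
  moreover obtain i where "i < n" "h i = u" using h C(3) by (metis bij_betw_imp_surj_on imageE lessThan_iff)
  then have "z i \<noteq> 0" using y by (simp add: z_def)
  ultimately have "graph_spectral_radius n G = \<mu>" using graph_spectral_radius_eqI[OF G] by blast
  moreover have "n > 0" unfolding n_def using C by (auto simp: card_gt_0_iff)
  ultimately have "enat n \<in> {enat n | n. n > 0 \<and>
       (\<exists>G. pair_graph G \<and> pverts G = {..<n} \<and> graph_spectral_radius n G = \<mu>)}" using G by blast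
  then show ?thesis unfolding spectral_radius_order_def n_def C_def by (rule Inf_lower)
qed

section \<open>Gram representations\<close>

text \<open>Only the leading block enters the form, while symmetry is asked everywhere; so induction
  on \<open>n\<close> can work with functions on all indices.\<close>

definition psd_form :: "nat \<Rightarrow> (nat \<Rightarrow> nat \<Rightarrow> real) \<Rightarrow> bool" where
  "psd_form n g \<longleftrightarrow> (\<forall>i j. g i j = g j i) \<and> (\<forall>x. 0 \<le> (\<Sum>i<n. \<Sum>j<n. x i * x j * g i j))"

definition schur :: "nat \<Rightarrow> (nat \<Rightarrow> nat \<Rightarrow> real) \<Rightarrow> nat \<Rightarrow> nat \<Rightarrow> real" where
  "schur n g i j = g i j - g i n * g j n / g n n"

lemma form_Suc:
  fixes g :: "nat \<Rightarrow> nat \<Rightarrow> real"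
  assumes "\<And>i j. g i j = g j i"
  shows "(\<Sum>i<Suc n. \<Sum>j<Suc n. x i * x j * g i j)
    = (\<Sum>i<n. \<Sum>j<n. x i * x j * g i j) + 2 * x n * (\<Sum>i<n. g i n * x i) + (x n)\<^sup>2 * g n n"
proof -
  have "(\<Sum>j<n. x n * x j * g n j) = x n * (\<Sum>i<n. g i n * x i)"
    by (subst sum_distrib_left, intro sum.cong refl) (simp add: assms[of n] mult_ac)
  moreover have "(\<Sum>i<n. x i * x n * g i n) = x n * (\<Sum>i<n. g i n * x i)"
    by (subst sum_distrib_left, intro sum.cong refl) (simp add: mult_ac)
  ultimately show ?thesis by (simp add: sum.distrib power2_eq_square)
qed

text \<open>Junk value: for \<open>g n n = 0\<close> the Schur complement is \<open>g\<close> itself, as division by zero gives zero.\<close>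

lemma psd_schur:
  assumes g: "psd_form (Suc n) g"
  shows "psd_form n (schur n g)" and "0 \<le> g n n" and "g n n = 0 \<Longrightarrow> i < n \<Longrightarrow> g i n = 0"
proof -
  have s: "\<And>i j. g i j = g j i" and p: "\<And>x. 0 \<le> (\<Sum>i<Suc n. \<Sum>j<Suc n. x i * x j * g i j)"
    using g unfolding psd_form_def by blast+
  have "0 \<le> (\<Sum>i<n. \<Sum>j<n. x i * x j * schur n g i j)" for x
  proof -
    define t where "t = (\<Sum>i<n. g i n * x i)"
    \<comment> \<open>Minimizing over the last coordinate completes the square.\<close>
    define y where "y = x(n := - t / g n n)"
    have "0 \<le> (\<Sum>i<n. \<Sum>j<n. y i * y j * g i j) + 2 * y n * (\<Sum>i<n. g i n * y i) + (y n)\<^sup>2 * g n n"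
      using p[of y] unfolding form_Suc[OF s] .
    also have "(\<Sum>i<n. \<Sum>j<n. y i * y j * g i j) = (\<Sum>i<n. \<Sum>j<n. x i * x j * g i j)"
      by (intro sum.cong) (auto simp: y_def)
    also have "(\<Sum>i<n. g i n * y i) = t" unfolding t_def by (intro sum.cong) (auto simp: y_def)
    also have "(\<Sum>i<n. \<Sum>j<n. x i * x j * g i j) + 2 * y n * t + (y n)\<^sup>2 * g n n
      = (\<Sum>i<n. \<Sum>j<n. x i * x j * g i j) - t * t / g n n"
      by (simp add: y_def power2_eq_square)
    also have "t * t = (\<Sum>i<n. \<Sum>j<n. x i * x j * (g i n * g j n))"
      unfolding t_def sum_product by (intro sum.cong) (auto simp: mult_ac)
    finally show ?thesis
      unfolding schur_def by (simp add: sum_divide_distrib sum_subtractf algebra_simps)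
  qed
  then show "psd_form n (schur n g)" unfolding psd_form_def schur_def using s by (auto simp: mult_ac)
  show "0 \<le> g n n" using p[of "ind n"] unfolding form_Suc[OF s] by (simp add: ind_def)
  assume 0: "g n n = 0" "i < n"
  \<comment> \<open>The form at \<open>t\<close> times the \<open>i\<close>-th unit vector plus the
    \<open>n\<close>-th one; its constant term \<open>g n n\<close> is zero.\<close>
  have "0 \<le> 2 * t * g i n + t\<^sup>2 * g i i" for t
  proof -
    define y where "y j = (if j = i then t else if j = n then 1 else 0)" for j
    have "0 \<le> (\<Sum>i<n. \<Sum>j<n. y i * y j * g i j) + 2 * y n * (\<Sum>i<n. g i n * y i) + (y n)\<^sup>2 * g n n"
      using p[of y] unfolding form_Suc[OF s] .
    also have "(\<Sum>k<n. \<Sum>j<n. y k * y j * g k j) = (\<Sum>k<n. if k = i then t * t * g i i else 0)"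
    proof (intro sum.cong refl)
      fix k assume k: "k \<in> {..<n}"
      have "(\<Sum>j<n. y k * y j * g k j) = (\<Sum>j<n. if j = i then y k * t * g k i else 0)"
        by (intro sum.cong) (auto simp: y_def)
      then show "(\<Sum>j<n. y k * y j * g k j) = (if k = i then t * t * g i i else 0)"
        using 0 k by (auto simp: y_def)
    qed
    also have "\<dots> = t\<^sup>2 * g i i" using 0 by (simp add: power2_eq_square)
    also have "(\<Sum>k<n. g k n * y k) = (\<Sum>k<n. if k = i then g i n * t else 0)"
      by (intro sum.cong) (auto simp: y_def)
    also have "\<dots> = g i n * t" using 0 by simp
    finally show ?thesis using 0 by (simp add: y_def mult_ac add_ac)
  qed
  then show "g i n = 0" by (rule linear_term_vanishes)
qed

text \<open>One step of a Cholesky factorization: the new coordinate is the last column divided by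
  \<open>sqrt (g n n)\<close>. If \<open>g n n = 0\<close> that column vanishes, in agreement with
  division by zero.\<close>

lemma gram_Suc:
  assumes g: "psd_form (Suc n) g" and f: "\<And>i j. i < n \<Longrightarrow> j < n \<Longrightarrow> schur n g i j = dot k (f i) (f j)"
  shows "\<exists>f'. \<forall>i<Suc n. \<forall>j<Suc n. g i j = dot (Suc k) (f' i) (f' j)"
proof -
  define f' where "f' i c = (if c < k then (if i < n then f i c else 0) else g i n / sqrt (g n n))" for i c
  have s: "\<And>i j. g i j = g j i" using g unfolding psd_form_def by blast
  have "dot (Suc k) (f' i) (f' j) = (if i < n \<and> j < n then dot k (f i) (f j) else 0) + g i n * g j n / g n n" for i j
  proof -
    have "(\<Sum>c<k. f' i c * f' j c) = (if i < n \<and> j < n then dot k (f i) (f j) else 0)"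
      unfolding dot_def f'_def by auto
    then show ?thesis unfolding dot_def using psd_schur(2)[OF g] by (simp add: f'_def)
  qed
  moreover have "g i j = (if i < n \<and> j < n then dot k (f i) (f j) else 0) + g i n * g j n / g n n"
    if ij: "i < Suc n" "j < Suc n" for i j
  proof (cases "i < n \<and> j < n")
    case True then show ?thesis using f[of i j] by (simp add: schur_def)
  next
    case False
    have z: "g n n = 0 \<longrightarrow> g i n = 0 \<and> g j n = 0"
      using psd_schur(3)[OF g, of i] psd_schur(3)[OF g, of j] ij by (auto simp: less_Suc_eq)
    have "i = n \<or> j = n" using False ij by linarith
    then have "g i j = g i n * g j n / g n n" using z s[of n j] by auto
    with False show ?thesis by auto
  qed
  ultimately have "\<forall>i<Suc n. \<forall>j<Suc n. g i j = dot (Suc k) (f' i) (f' j)" by metis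
  then show ?thesis by (intro exI[of _ f'])
qed

lemma gram_exists: "psd_form n g \<Longrightarrow> \<exists>f. \<forall>i<n. \<forall>j<n. g i j = dot n (f i) (f j)"
proof (induction n arbitrary: g)
  case (Suc n)
  then obtain f where "\<forall>i<n. \<forall>j<n. schur n g i j = dot n (f i) (f j)" using psd_schur(1) by blast
  then show ?case using gram_Suc[OF Suc.prems] by blast
qed simp

text \<open>A kernel vector passes to the Schur complement unless it lives on the last index alone.
  In that case the last row and column are zero, and the last vector can be zero at no cost in
  dimension.\<close>

lemma gram_exists_singular:
  assumes "psd_form n g" "\<And>i. i < n \<Longrightarrow> (\<Sum>j<n. g i j * x j) = 0" "\<exists>i<n. x i \<noteq> 0"
  shows "\<exists>f. \<forall>i<n. \<forall>j<n. g i j = dot (n - 1) (f i) (f j)"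
  using assms
proof (induction n arbitrary: g)
  case (Suc n)
  have s: "\<And>i j. g i j = g j i" using Suc.prems unfolding psd_form_def by blast
  have last: "(\<Sum>j<n. g i j * x j) = - g i n * x n" if "i < Suc n" for i using Suc.prems(2)[OF that] by simp
  show ?case
  proof (cases "\<exists>i<n. x i \<noteq> 0")
    case True
    have *: "(\<Sum>j<n. schur n g i j * x j) = 0" if i: "i < n" for i
    proof -
      have "(\<Sum>j<n. schur n g i j * x j) = (\<Sum>j<n. g i j * x j) - g i n / g n n * (\<Sum>j<n. g n j * x j)"
      proof -
        have "schur n g i j * x j = g i j * x j - g i n / g n n * (g n j * x j)" for j
          unfolding schur_def s[of j n] by (simp add: algebra_simps)
        then show ?thesis by (simp add: sum_subtractf sum_distrib_left)
      qed
      also have "\<dots> = 0" using last[of i] last[of n] i psd_schur(3)[OF Suc.prems(1) _ i]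
        by (cases "g n n = 0") auto
      finally show ?thesis .
    qed
    have "\<exists>f. \<forall>i<n. \<forall>j<n. schur n g i j = dot (n - 1) (f i) (f j)"
      by (rule Suc.IH[OF psd_schur(1)[OF Suc.prems(1)] * True])
    then obtain f where "\<forall>i<n. \<forall>j<n. schur n g i j = dot (n - 1) (f i) (f j)" by blast
    then have "\<exists>f'. \<forall>i<Suc n. \<forall>j<Suc n. g i j = dot (Suc (n - 1)) (f' i) (f' j)"
      by (intro gram_Suc[OF Suc.prems(1), of _ f]) simp
    moreover have "Suc (n - 1) = Suc n - 1" using True by auto
    ultimately show ?thesis by simp
  next
    case False
    then have xn: "x n \<noteq> 0" using Suc.prems(3) by (auto simp: less_Suc_eq)
    have gn: "g i n = 0" if "i < Suc n" for i
      using last[OF that] False xn by simp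
    have "psd_form n g" using psd_schur(1)[OF Suc.prems(1)] gn[of n] unfolding schur_def by simp
    then obtain f where f: "\<forall>i<n. \<forall>j<n. g i j = dot n (f i) (f j)" using gram_exists by blast
    define f' where "f' i = (if i < n then f i else (\<lambda>_. 0))" for i
    have "g i j = dot n (f' i) (f' j)" if "i < Suc n" "j < Suc n" for i j
      using that f gn[of i] gn[of j] s[of i j] unfolding f'_def by (auto simp: less_Suc_eq dot_def)
    then show ?thesis by (intro exI[of _ f']) simp
  qed
qed simp

section \<open>Lower bound\<close>

text \<open>For some graph on \<open>N\<close> vertices with adjacency matrix \<open>A\<close>, the matrix \<open>l * I - A\<close> is the Gram matrix
  of \<open>N\<close> vectors in dimension \<open>d\<close>.\<close>

definition realizable :: "real \<Rightarrow> nat \<Rightarrow> nat \<Rightarrow> bool" where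
  "realizable l N d \<longleftrightarrow> (\<exists>f. (\<forall>i<N. dot d (f i) (f i) = l) \<and>
     (\<forall>i<N. \<forall>j<N. i \<noteq> j \<longrightarrow> dot d (f i) (f j) = 0 \<or> dot d (f i) (f j) = -1))"

lemma dot_append: "dot (d + e) p q = dot d p q + dot e (\<lambda>c. p (d + c)) (\<lambda>c. q (d + c))"
  unfolding dot_def by (induction e) auto

lemma dot_cong: "(\<And>c. c < d \<Longrightarrow> p c = p' c) \<Longrightarrow> (\<And>c. c < d \<Longrightarrow> q c = q' c) \<Longrightarrow> dot d p q = dot d p' q'"
  unfolding dot_def by simp

text \<open>Disjoint union of graphs corresponds to an orthogonal sum of the vector systems.\<close>

lemma realizable_add:
  assumes "realizable l N d" "realizable l M e"
  shows "realizable l (N + M) (d + e)"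
proof -
  obtain f where f: "\<And>i. i < N \<Longrightarrow> dot d (f i) (f i) = l"
    "\<And>i j. i < N \<Longrightarrow> j < N \<Longrightarrow> i \<noteq> j \<Longrightarrow> dot d (f i) (f j) = 0 \<or> dot d (f i) (f j) = -1"
    using assms(1) unfolding realizable_def by metis
  obtain g where g: "\<And>i. i < M \<Longrightarrow> dot e (g i) (g i) = l"
    "\<And>i j. i < M \<Longrightarrow> j < M \<Longrightarrow> i \<noteq> j \<Longrightarrow> dot e (g i) (g j) = 0 \<or> dot e (g i) (g j) = -1"
    using assms(2) unfolding realizable_def by metis
  define h where "h i c = (if i < N then (if c < d then f i c else 0) else (if c < d then 0 else g (i - N) (c - d)))" for i c
  have h: "dot (d + e) (h i) (h j) = (if i < N \<and> j < N then dot d (f i) (f j)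
      else if \<not> i < N \<and> \<not> j < N then dot e (g (i - N)) (g (j - N)) else 0)" for i j
  proof -
    have "dot d (h i) (h j) = (if i < N \<and> j < N then dot d (f i) (f j) else 0)"
      unfolding dot_def h_def by auto
    moreover have "dot e (\<lambda>c. h i (d + c)) (\<lambda>c. h j (d + c)) =
      (if \<not> i < N \<and> \<not> j < N then dot e (g (i - N)) (g (j - N)) else 0)"
      unfolding dot_def h_def by auto
    ultimately show ?thesis unfolding dot_append by auto
  qed
  have "dot (d + e) (h i) (h i) = l" if "i < N + M" for i
    using f(1)[of i] g(1)[of "i - N"] that by (simp add: h)
  moreover have "dot (d + e) (h i) (h j) = 0 \<or> dot (d + e) (h i) (h j) = -1"
    if "i < N + M" "j < N + M" "i \<noteq> j" for i j
    using f(2)[of i j] g(2)[of "i - N" "j - N"] that by (auto simp: h)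
  ultimately show ?thesis unfolding realizable_def by (intro exI[of _ h]) blast
qed

lemma realizable_0: "realizable l 0 0"
  unfolding realizable_def by simp

lemma realizable_1: "l \<ge> 0 \<Longrightarrow> realizable l 1 1"
  unfolding realizable_def by (intro exI[of _ "\<lambda>_ _. sqrt l"]) (simp add: dot_def)

lemma realizable_mult: "realizable l N d \<Longrightarrow> realizable l (q * N) (q * d)"
proof (induction q)
  case 0
  show ?case using realizable_0 by simp
next
  case (Suc q)
  then show ?case using realizable_add[of l N d "q * N" "q * d"] by simp
qed

lemma realizable_diag: "l \<ge> 0 \<Longrightarrow> realizable l r r"
  using realizable_mult[OF realizable_1, of l r] by simp

text \<open>The form bound makes \<open>l * I - A\<close> positive semidefinite, and the top
  eigenvector in its kernel saves one dimension.\<close>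

lemma realizable_graph:
  assumes G: "nat_graph k G" and k: "k > 0" and r: "graph_spectral_radius k G = l"
  shows "realizable l k (k - 1)"
proof -
  interpret fin_graph "{..<k}" "\<lambda>i j. (i, j) \<in> parcs G" by (rule nat_graph_fin_graph[OF G])
  have q: "qle l {..<k}" using graph_spectral_radius_top(1)[OF G k r] .
  obtain x u where x: "eigen l x" "x u \<noteq> 0" using graph_spectral_radius_top(2)[OF G k r] by blast
  have sx: "supp {..<k} x" using x by (simp add: eigen_def)
  define g where "g i j = (if i = j then l else 0) - of_bool ((i, j) \<in> parcs G)" for i j :: nat
  have row: "(\<Sum>j<k. g i j * y j) = l * y i - A y i" if "i < k" for i and y :: "nat \<Rightarrow> real"
  proof -
    have "(\<Sum>j<k. g i j * y j) = (\<Sum>j<k. (if j = i then l * y i else 0) - of_bool ((i, j) \<in> parcs G) * y j)"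
      by (intro sum.cong) (auto simp: g_def algebra_simps)
    then show ?thesis using that by (simp add: sum_subtractf A_def)
  qed
  have psd: "psd_form k g" unfolding psd_form_def
  proof (intro conjI allI)
    show "g i j = g j i" for i j using E_sym by (auto simp: g_def of_bool_def)
    fix y :: "nat \<Rightarrow> real"
    define z where "z = cut {..<k} y"
    have z: "z i = y i" if "i < k" for i using that by (simp add: z_def cut_def)
    have "(\<Sum>i<k. \<Sum>j<k. y i * y j * g i j) = (\<Sum>i<k. z i * (\<Sum>j<k. g i j * z j))"
      unfolding sum_distrib_left using z by (intro sum.cong refl) (simp add: mult_ac)
    also have "\<dots> = (\<Sum>i<k. z i * (l * z i - A z i))"
      using row by (intro sum.cong) auto
    also have "\<dots> = l * ip z z - ip z (A z)"
      unfolding ip_def by (simp add: sum_subtractf sum_distrib_left algebra_simps)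
    finally show "0 \<le> (\<Sum>i<k. \<Sum>j<k. y i * y j * g i j)"
      using q unfolding qle_def z_def by simp
  qed
  have "(\<Sum>j<k. g i j * x j) = 0" if "i < k" for i
    using row[OF that] x(1) by (simp add: eigen_def)
  moreover have "\<exists>i<k. x i \<noteq> 0" using x(2) sx by (auto simp: supp_def)
  ultimately obtain f where f: "\<forall>i<k. \<forall>j<k. g i j = dot (k - 1) (f i) (f j)"
    using gram_exists_singular[OF psd] by metis
  have "dot (k - 1) (f i) (f i) = l" if "i < k" for i
    using f that E_irrefl[of i] by (metis (full_types) diff_zero g_def of_bool_eq(1))
  moreover have "dot (k - 1) (f i) (f j) = 0 \<or> dot (k - 1) (f i) (f j) = -1" if "i < k" "j < k" "i \<noteq> j" for i j
  proof -
    have "g i j = dot (k - 1) (f i) (f j)" using f that by blast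
    then show ?thesis using that by (auto simp: g_def of_bool_def split: if_splits)
  qed
  ultimately show ?thesis unfolding realizable_def by (intro exI[of _ f]) blast
qed

section \<open>Equiangular lines and Gram vectors\<close>

lemma scalar_prod_vec_dot: "scalar_prod (vec d p) (vec d q) = dot d p q"
  unfolding scalar_prod_def dot_def by (simp add: lessThan_atLeast0)

lemma scalar_prod_dot: "v \<in> carrier_vec d \<Longrightarrow> scalar_prod u v = dot d (\<lambda>c. u $ c) (\<lambda>c. v $ c)"
  unfolding scalar_prod_def dot_def by (auto simp: lessThan_atLeast0)

text \<open>Scaling by \<open>sqrt (2 * \<alpha>)\<close> and appending a common coordinate
  \<open>sqrt \<alpha>\<close> adds \<alpha> to every inner product: 0 and -1 become \<alpha> and
  \<open>- \<alpha>\<close>, and \<open>l\<close> becomes 1. The appended coordinate is the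
  additional dimension.\<close>

lemma realizable_lines:
  assumes \<alpha>: "0 < \<alpha>" "\<alpha> < 1" and l: "l = (1 - \<alpha>) / (2 * \<alpha>)" and R: "realizable l N d"
  shows "\<exists>S. finite S \<and> card S = N \<and> equiangular_lines (d + 1) (arccos \<alpha>) S"
proof -
  obtain f where f: "\<And>i. i < N \<Longrightarrow> dot d (f i) (f i) = l"
    "\<And>i j. i < N \<Longrightarrow> j < N \<Longrightarrow> i \<noteq> j \<Longrightarrow> dot d (f i) (f j) = 0 \<or> dot d (f i) (f j) = -1"
    using R unfolding realizable_def by metis
  define h where "h i c = (if c < d then sqrt (2 * \<alpha>) * f i c else sqrt \<alpha>)" for i c
  define w where "w i = vec (d + 1) (h i)" for i
  have "dot (d + 1) (h i) (h j) = 2 * \<alpha> * dot d (f i) (f j) + \<alpha>" for i j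
  proof -
    have "dot d (h i) (h j) = dot d (\<lambda>c. sqrt (2 * \<alpha>) * f i c) (\<lambda>c. sqrt (2 * \<alpha>) * f j c)"
      by (rule dot_cong) (auto simp: h_def)
    then have 1: "dot d (h i) (h j) = 2 * \<alpha> * dot d (f i) (f j)" using \<alpha> by (simp add: dot_scale)
    have "dot 1 (\<lambda>c. h i (d + c)) (\<lambda>c. h j (d + c)) = \<alpha>" using \<alpha> by (simp add: dot_def h_def)
    with 1 show ?thesis unfolding dot_append by simp
  qed
  then have ww: "scalar_prod (w i) (w j) = 2 * \<alpha> * dot d (f i) (f j) + \<alpha>" for i j
    unfolding w_def scalar_prod_vec_dot .
  have wc: "w i \<in> carrier_vec (d + 1)" for i by (simp add: w_def)
  have w1: "scalar_prod (w i) (w i) = 1" if "i < N" for i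
    unfolding ww using f(1)[OF that] \<alpha> by (simp add: l)
  have w2: "\<bar>scalar_prod (w i) (w j)\<bar> = \<alpha>" if "i < N" "j < N" "i \<noteq> j" for i j
    unfolding ww using f(2)[OF that] \<alpha> by auto
  define L where "L i = range (\<lambda>c. c \<cdot>\<^sub>v w i)" for i
  have sp: "scalar_prod (a \<cdot>\<^sub>v w i) (b \<cdot>\<^sub>v w j) = a * b * scalar_prod (w i) (w j)" for a b i j
    using wc[of i] wc[of j] by simp
  have inj: "inj_on L {..<N}"
  proof (rule inj_onI, rule ccontr)
    fix i j assume ij: "i \<in> {..<N}" "j \<in> {..<N}" "L i = L j" "i \<noteq> j"
    have "w i = 1 \<cdot>\<^sub>v w i" by simp
    then have "w i \<in> L i" unfolding L_def by blast
    then obtain c where c: "w i = c \<cdot>\<^sub>v w j" using ij unfolding L_def by blast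
    have "scalar_prod (w i) (w i) = c * c * scalar_prod (w j) (w j)" unfolding c by (rule sp)
    then have "c * c = 1" using w1 ij by simp
    moreover have "scalar_prod (w i) (w j) = c * scalar_prod (w j) (w j)"
      unfolding c using sp[of c j 1 j] by simp
    then have "scalar_prod (w i) (w j) = c" using w1 ij by simp
    ultimately have "\<alpha> * \<alpha> = 1" using w2[of i j] ij by (metis abs_mult_self_eq lessThan_iff)
    moreover have "\<alpha> * \<alpha> < 1 * 1" using \<alpha> by (intro mult_strict_mono) auto
    ultimately show False by simp
  qed
  have norm: "euclid_norm (a \<cdot>\<^sub>v w i) = \<bar>a\<bar>" if "i < N" for a i
    unfolding euclid_norm_def sp using w1[OF that] by simp
  have "equiangular_lines (d + 1) (arccos \<alpha>) (L ` {..<N})"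
    unfolding equiangular_lines_def
  proof (intro conjI ballI impI)
    show "L ` {..<N} \<subseteq> lines_through_origin (d + 1)"
    proof
      fix M assume "M \<in> L ` {..<N}"
      then obtain i where i: "i < N" "M = L i" by blast
      have "w i \<noteq> 0\<^sub>v (d + 1)" using w1[OF i(1)] wc[of i] by (metis scalar_prod_left_zero zero_neq_one)
      then show "M \<in> lines_through_origin (d + 1)"
        unfolding lines_through_origin_def i(2) L_def using wc by blast
    qed
    fix M M' assume "M \<in> L ` {..<N}" "M' \<in> L ` {..<N}" "M \<noteq> M'"
    then obtain i j where ij: "i < N" "j < N" "M = L i" "M' = L j" "i \<noteq> j" by blast
    show "lines_form_angle (d + 1) (arccos \<alpha>) M M'"
      unfolding lines_form_angle_def
    proof (intro ballI)
      fix u v assume u: "u \<in> M - {0\<^sub>v (d + 1)}" and v: "v \<in> M' - {0\<^sub>v (d + 1)}"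
      obtain a b where ab: "u = a \<cdot>\<^sub>v w i" "v = b \<cdot>\<^sub>v w j" using u v ij unfolding L_def by blast
      have "0 \<cdot>\<^sub>v w i = 0\<^sub>v (d + 1)" for i using wc[of i] by (intro eq_vecI) auto
      then have "a \<noteq> 0" "b \<noteq> 0" using u v ab by auto
      then have "\<bar>scalar_prod u v\<bar> / (euclid_norm u * euclid_norm v) = \<alpha>"
        unfolding ab sp norm[OF ij(1)] norm[OF ij(2)] using w2[OF ij(1,2,5)] by (simp add: abs_mult)
      then show "arccos (\<bar>scalar_prod u v\<bar> / (euclid_norm u * euclid_norm v)) = arccos \<alpha>" by simp
    qed
  qed
  then show ?thesis using inj by (intro exI[of _ "L ` {..<N}"]) (simp add: card_image)
qed

lemma lines_unit_vectors:
  assumes \<alpha>: "0 < \<alpha>" "\<alpha> < 1" and S: "equiangular_lines d (arccos \<alpha>) S"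
  shows "\<exists>f. (\<forall>L\<in>S. dot d (f L) (f L) = 1) \<and> (\<forall>L\<in>S. \<forall>M\<in>S. L \<noteq> M \<longrightarrow> \<bar>dot d (f L) (f M)\<bar> = \<alpha>)"
proof -
  have "\<forall>L\<in>S. \<exists>v. v \<in> carrier_vec d \<and> v \<noteq> 0\<^sub>v d \<and> L = range (\<lambda>c. c \<cdot>\<^sub>v v)"
    using S unfolding equiangular_lines_def lines_through_origin_def by blast
  then obtain w where w: "\<And>L. L \<in> S \<Longrightarrow> w L \<in> carrier_vec d" "\<And>L. L \<in> S \<Longrightarrow> w L \<noteq> 0\<^sub>v d"
    "\<And>L. L \<in> S \<Longrightarrow> L = range (\<lambda>c. c \<cdot>\<^sub>v w L)" by metis
  define p where "p L = (\<lambda>c. w L $ c)" for L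
  have sp: "scalar_prod (w L) (w M) = dot d (p L) (p M)" if "M \<in> S" for L M
    unfolding p_def using w(1)[OF that] by (rule scalar_prod_dot)
  have pos: "dot d (p L) (p L) > 0" if "L \<in> S" for L
  proof -
    have "dot d (p L) (p L) \<noteq> 0"
    proof
      assume "dot d (p L) (p L) = 0"
      then have "w L = 0\<^sub>v d" unfolding dot_self_eq_0_iff p_def using w(1)[OF that] by (intro eq_vecI) auto
      then show False using w(2) that by blast
    qed
    then show ?thesis using dot_self_nonneg[of d "p L"] by linarith
  qed
  have mem: "w L \<in> L - {0\<^sub>v d}" if "L \<in> S" for L
  proof -
    have "w L = 1 \<cdot>\<^sub>v w L" by simp
    then have "w L \<in> range (\<lambda>c. c \<cdot>\<^sub>v w L)" by blast
    then show ?thesis using w(2,3)[OF that] by simp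
  qed
  define n where "n L = sqrt (dot d (p L) (p L))" for L
  have n: "n L > 0" "n L * n L = dot d (p L) (p L)" if "L \<in> S" for L
    using pos[OF that] unfolding n_def by auto
  define f where "f L = (\<lambda>c. (1 / n L) * p L c)" for L
  have ff: "dot d (f L) (f M) = dot d (p L) (p M) / (n L * n M)" for L M
    unfolding f_def dot_scale by simp
  have f1: "dot d (f L) (f L) = 1" if "L \<in> S" for L
    unfolding ff using n[OF that] pos[OF that] by simp
  have "\<bar>dot d (f L) (f M)\<bar> = \<alpha>" if LM: "L \<in> S" "M \<in> S" "L \<noteq> M" for L M
  proof -
    have "lines_form_angle d (arccos \<alpha>) L M" using S LM unfolding equiangular_lines_def by blast
    then have "arccos (\<bar>scalar_prod (w L) (w M)\<bar> / (euclid_norm (w L) * euclid_norm (w M))) = arccos \<alpha>"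
      unfolding lines_form_angle_def using mem LM by blast
    moreover have "\<bar>scalar_prod (w L) (w M)\<bar> / (euclid_norm (w L) * euclid_norm (w M)) = \<bar>dot d (f L) (f M)\<bar>"
      unfolding euclid_norm_def ff n_def using sp LM by (simp add: abs_mult dot_self_nonneg)
    ultimately have "arccos \<bar>dot d (f L) (f M)\<bar> = arccos \<alpha>" by simp
    \<comment> \<open>Cauchy-Schwarz places the argument in the range where \<open>arccos\<close> is
      injective.\<close>
    moreover have "\<bar>dot d (f L) (f M)\<bar> \<le> 1"
      using dot_Cauchy_Schwarz[of d "f L" "f M"] f1 LM by (simp add: abs_square_le_1)
    ultimately show ?thesis using \<alpha> by (subst (asm) arccos_eq_iff) auto
  qed
  then show ?thesis using f1 by blast
qed

section \<open>Upper bound\<close>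

text \<open>\<open>psd\<close> is nonnegativity of the squared length of the combination
  \<open>\<sigma> x\<close>. For \<open>rank\<close>, the vanishing of the \<open>d\<close>
  coordinates of \<open>\<sigma> x\<close> is imposed as \<open>d\<close> linear conditions, which
  puts \<open>x\<close> into the kernel of the Gram matrix.\<close>

lemma bounded_degree_gram_graph:
  fixes h :: "'a \<Rightarrow> nat \<Rightarrow> real"
  assumes \<alpha>: "0 < \<alpha>" "\<alpha> < 1" and l: "l = (1 - \<alpha>) / (2 * \<alpha>)" and S: "finite S"
    and h: "\<And>u. u \<in> S \<Longrightarrow> dot d (h u) (h u) = 1"
      "\<And>u w. u \<in> S \<Longrightarrow> w \<in> S \<Longrightarrow> u \<noteq> w \<Longrightarrow> \<bar>dot d (h u) (h w)\<bar> = \<alpha>"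
  shows "gram_graph S (\<lambda>u w. u \<in> S \<and> w \<in> S \<and> u \<noteq> w \<and> dot d (h u) (h w) < 0) l d"
proof -
  define E where "E u w \<longleftrightarrow> u \<in> S \<and> w \<in> S \<and> u \<noteq> w \<and> dot d (h u) (h w) < 0" for u w
  interpret fin_graph S E by unfold_locales (auto simp: E_def S dot_commute)
  have lp: "l > 0" "2 * \<alpha> * l = 1 - \<alpha>" using \<alpha> unfolding l by auto
  have dot: "dot d (h u) (h w) = 2 * \<alpha> * ((if w = u then l else 0) + 1 / 2 - of_bool (E u w))"
    if "u \<in> S" "w \<in> S" for u w
  proof (cases "u = w")
    case True
    have "2 * \<alpha> * (l + 1 / 2) = 1" using lp by (simp add: algebra_simps)
    then show ?thesis using True h(1) that by (simp add: E_irrefl)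
  next
    case False
    then show ?thesis using h(2)[of u w] that \<alpha> by (auto simp: E_def of_bool_def)
  qed
  define \<sigma> where "\<sigma> x = (\<lambda>c. \<Sum>w\<in>S. x w * h w c)" for x :: "'a \<Rightarrow> real"
  have row: "dot d (h u) (\<sigma> x) = 2 * \<alpha> * (l * x u + (\<Sum>w\<in>S. x w) / 2 - A x u)" if u: "u \<in> S" for u x
  proof -
    have "dot d (h u) (\<sigma> x) = (\<Sum>w\<in>S. x w * dot d (h u) (h w))" unfolding \<sigma>_def by (rule dot_sum_right)
    also have "\<dots> = (\<Sum>w\<in>S. 2 * \<alpha> * ((if w = u then l * x u else 0) + x w / 2 - of_bool (E u w) * x w))"
    proof (intro sum.cong refl)
      fix w assume w: "w \<in> S"
      show "x w * dot d (h u) (h w) = 2 * \<alpha> * ((if w = u then l * x u else 0) + x w / 2 - of_bool (E u w) * x w)"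
        unfolding dot[OF u w] by (cases "w = u") (simp_all add: algebra_simps)
    qed
    also have "\<dots> = 2 * \<alpha> * (\<Sum>w\<in>S. (if w = u then l * x u else 0) + x w / 2 - of_bool (E u w) * x w)"
      by (simp only: sum_distrib_left)
    also have "(\<Sum>w\<in>S. (if w = u then l * x u else 0) + x w / 2 - of_bool (E u w) * x w)
      = l * x u + (\<Sum>w\<in>S. x w) / 2 - A x u"
      using u S unfolding A_def by (simp add: sum.distrib sum_subtractf sum_divide_distrib)
    finally show ?thesis .
  qed
  have form: "dot d (\<sigma> x) (\<sigma> x) = 2 * \<alpha> * (l * ip x x + (\<Sum>u\<in>S. x u)\<^sup>2 / 2 - ip x (A x))" for x
  proof -
    have "dot d (\<sigma> x) (\<sigma> x) = (\<Sum>u\<in>S. x u * dot d (h u) (\<sigma> x))"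
      unfolding \<sigma>_def[of x] dot_sum_sum dot_sum_right by (simp add: sum_distrib_left mult_ac)
    also have "\<dots> = (\<Sum>u\<in>S. 2 * \<alpha> * (l * (x u * x u) + x u * ((\<Sum>w\<in>S. x w) / 2) - x u * A x u))"
    proof (intro sum.cong refl)
      fix u assume u: "u \<in> S"
      show "x u * dot d (h u) (\<sigma> x) = 2 * \<alpha> * (l * (x u * x u) + x u * ((\<Sum>w\<in>S. x w) / 2) - x u * A x u)"
        unfolding row[OF u] by (simp add: algebra_simps)
    qed
    also have "\<dots> = 2 * \<alpha> * (l * ip x x + (\<Sum>u\<in>S. x u) * ((\<Sum>w\<in>S. x w) / 2) - ip x (A x))"
      unfolding ip_def sum_distrib_left[symmetric] sum_subtractf sum.distrib sum_distrib_right[symmetric] ..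
    finally show ?thesis by (simp add: power2_eq_square)
  qed
  have "gram_graph S E l d"
  proof unfold_locales
    show "l > 0" by (rule lp)
    fix x show "ip x (A x) \<le> l * ip x x + (\<Sum>u\<in>S. x u)\<^sup>2 / 2"
    proof -
      have "0 \<le> 2 * \<alpha> * (l * ip x x + (\<Sum>u\<in>S. x u)\<^sup>2 / 2 - ip x (A x))"
        unfolding form[symmetric] by (rule dot_self_nonneg)
      then show ?thesis using \<alpha> by (simp add: zero_le_mult_iff)
    qed
  next
    fix \<Phi> :: "('a \<Rightarrow> real) set" assume \<Phi>: "finite \<Phi>" "card \<Phi> + d < card S"
    define \<Psi> where "\<Psi> = \<Phi> \<union> (\<lambda>c u. h u c) ` {..<d}"
    have "card \<Psi> \<le> card \<Phi> + card ((\<lambda>c u. h u c) ` {..<d})" unfolding \<Psi>_def by (rule card_Un_le)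
    moreover have "card ((\<lambda>c u. h u c) ` {..<d}) \<le> d" using card_image_le[of "{..<d}" "\<lambda>c u. h u c"] by simp
    ultimately have "card \<Psi> < card S" using \<Phi> by linarith
    moreover have "finite \<Psi>" unfolding \<Psi>_def using \<Phi> by simp
    ultimately obtain x where x: "\<forall>u. u \<notin> S \<longrightarrow> x u = 0" "\<exists>u. x u \<noteq> 0" "\<forall>\<phi>\<in>\<Psi>. (\<Sum>u\<in>S. \<phi> u * x u) = 0"
      using underdetermined_system[OF S, of \<Psi>] by blast
    have "\<sigma> x c = 0" if "c < d" for c
    proof -
      have "(\<lambda>u. h u c) \<in> \<Psi>" unfolding \<Psi>_def using that by blast
      from bspec[OF x(3) this] have "(\<Sum>u\<in>S. h u c * x u) = 0" .
      then show ?thesis unfolding \<sigma>_def by (simp add: mult.commute)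
    qed
    then have "dot d (h u) (\<sigma> x) = 0" for u unfolding dot_def by simp
    then have "A x u = l * x u + (\<Sum>u\<in>S. x u) / 2" if "u \<in> S" for u using row[OF that, of x] \<alpha> by simp
    moreover have "ip \<phi> x = 0" if "\<phi> \<in> \<Phi>" for \<phi> using x(3) that unfolding \<Psi>_def ip_def by blast
    ultimately show "\<exists>x. supp S x \<and> (\<exists>u. x u \<noteq> 0) \<and> (\<forall>\<phi>\<in>\<Phi>. ip \<phi> x = 0) \<and>
        (\<forall>u\<in>S. A x u = l * x u + (\<Sum>u\<in>S. x u) / 2)"
      using x(1,2) unfolding supp_def by blast
  qed
  then show ?thesis unfolding E_def .
qed

text \<open>First \<rho> makes the net sparse; the base of the power is then a fixed number below 1,
  and \<open>s\<close> is chosen for it.\<close>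

lemma net_and_power_parameters:
  fixes l \<epsilon> :: real assumes "l > 0" "\<epsilon> > 0"
  shows "\<exists>\<rho> s. 1 / real (\<rho> + 1) + (max 0 (1 - 1 / l ^ (4 * \<rho>))) ^ s \<le> \<epsilon>"
proof -
  obtain \<rho> where \<rho>: "1 / real (Suc \<rho>) < \<epsilon> / 2" using nat_approx_posE[of "\<epsilon> / 2"] assms by auto
  define \<kappa> where "\<kappa> = max 0 (1 - 1 / l ^ (4 * \<rho>))"
  have "0 < 1 / l ^ (4 * \<rho>)" using assms by simp
  then have "0 \<le> \<kappa>" "\<kappa> < 1" unfolding \<kappa>_def by auto
  then obtain s where "\<kappa> ^ s < \<epsilon> / 2" using real_arch_pow_inv[of "\<epsilon> / 2" \<kappa>] assms by auto
  then show ?thesis using \<rho> unfolding \<kappa>_def by (intro exI[of _ \<rho>] exI[of _ s]) simp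
qed

text \<open>\<open>K\<close> depends on \<alpha> and \<epsilon> only, not on \<open>d\<close>,
  \<open>S\<close> or \<open>k\<close>. Any lower bound \<open>k\<close> of the order is allowed, so
  one statement serves both finite and infinite order.\<close>

theorem equiangular_upper_bound:
  fixes \<alpha> l \<epsilon> :: real
  assumes \<alpha>: "0 < \<alpha>" "\<alpha> < 1" and l: "l = (1 - \<alpha>) / (2 * \<alpha>)" and \<epsilon>: "\<epsilon> > 0"
  shows "\<exists>K::real. \<forall>d S k. finite S \<and> equiangular_lines d (arccos \<alpha>) S \<and> enat k \<le> spectral_radius_order l \<longrightarrow>
    card S \<le> d \<or> (\<exists>c>0. card S + 1 \<le> d + c \<and> k * c \<le> card S) \<or> real (card S) \<le> d + K + \<epsilon> * card S"
proof -
  have lp: "l > 0" using \<alpha> unfolding l by simp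
  from bounded_degree_switching[OF \<alpha>, where 'a="real vec set"]
  obtain \<Delta> where \<Delta>: "\<forall>(V::real vec set set) f d. finite V \<and> (\<forall>u\<in>V. dot d (f u) (f u) = 1) \<and>
    (\<forall>u\<in>V. \<forall>w\<in>V. u \<noteq> w \<longrightarrow> \<bar>dot d (f u) (f w)\<bar> = \<alpha>) \<longrightarrow>
    (\<exists>\<sigma>. (\<forall>u. \<sigma> u = 1 \<or> \<sigma> u = (-1::real)) \<and>
      (\<forall>u\<in>V. card {w \<in> V. w \<noteq> u \<and> dot d (\<lambda>c. \<sigma> u * f u c) (\<lambda>c. \<sigma> w * f w c) < 0} \<le> \<Delta>))"
    ..
  obtain \<rho> s where rs: "1 / real (\<rho> + 1) + (max 0 (1 - 1 / l ^ (4 * \<rho>))) ^ s \<le> \<epsilon>"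
    using net_and_power_parameters[OF lp \<epsilon>] by blast
  define K where "K = 2 + \<rho> + real ((\<Delta> + 1) ^ (4 * \<rho> * (s + 1) + 1))"
  have "card S \<le> d \<or> (\<exists>c>0. card S + 1 \<le> d + c \<and> k * c \<le> card S) \<or> real (card S) \<le> d + K + \<epsilon> * card S"
    if S: "finite S" "equiangular_lines d (arccos \<alpha>) S" and k: "enat k \<le> spectral_radius_order l" for d S k
  proof -
    obtain f where f: "\<forall>u\<in>S. dot d (f u) (f u) = 1" "\<forall>u\<in>S. \<forall>w\<in>S. u \<noteq> w \<longrightarrow> \<bar>dot d (f u) (f w)\<bar> = \<alpha>"
      using lines_unit_vectors[OF \<alpha> S(2)] by blast
    have "\<exists>\<sigma>. (\<forall>u. \<sigma> u = 1 \<or> \<sigma> u = (-1::real)) \<and>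
      (\<forall>u\<in>S. card {w \<in> S. w \<noteq> u \<and> dot d (\<lambda>c. \<sigma> u * f u c) (\<lambda>c. \<sigma> w * f w c) < 0} \<le> \<Delta>)"
      by (intro \<Delta>[THEN spec, of S, THEN spec, of f, THEN spec, of d, THEN mp] conjI S(1) f)
    then obtain \<sigma> where \<sigma>: "\<And>u. \<sigma> u = 1 \<or> \<sigma> u = (-1::real)"
      "\<And>u. u \<in> S \<Longrightarrow> card {w \<in> S. w \<noteq> u \<and> dot d (\<lambda>c. \<sigma> u * f u c) (\<lambda>c. \<sigma> w * f w c) < 0} \<le> \<Delta>"
      by blast
    define h where "h u = (\<lambda>c. \<sigma> u * f u c)" for u
    have hh: "dot d (h u) (h w) = \<sigma> u * \<sigma> w * dot d (f u) (f w)" for u w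
      unfolding h_def by (rule dot_scale)
    have h1: "dot d (h u) (h u) = 1" if "u \<in> S" for u
      unfolding hh using \<sigma>(1)[of u] f(1) that by auto
    have h2: "\<bar>dot d (h u) (h w)\<bar> = \<alpha>" if "u \<in> S" "w \<in> S" "u \<noteq> w" for u w
    proof -
      have "\<bar>dot d (h u) (h w)\<bar> = \<bar>dot d (f u) (f w)\<bar>"
        unfolding hh using \<sigma>(1)[of u] \<sigma>(1)[of w] by auto
      then show ?thesis using f(2) that by simp
    qed
    define E where "E u w \<longleftrightarrow> u \<in> S \<and> w \<in> S \<and> u \<noteq> w \<and> dot d (h u) (h w) < 0" for u w
    interpret gram_graph S E l d
      unfolding E_def by (rule bounded_degree_gram_graph[OF \<alpha> l S(1) h1 h2])
    show ?thesis
    proof (cases "qle l S")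
      case True
      have "k \<le> card (comp u)" if "eigen l x" "x u \<noteq> 0" for u x
        using spectral_radius_order_le[OF True that] k order_trans by fastforce
      then show ?thesis using bound_if_radius_le[OF True, of k] by blast
    next
      case False
      have deg: "card {w. E u w} \<le> \<Delta>" for u
      proof (cases "u \<in> S")
        case True
        have "{w. E u w} = {w \<in> S. w \<noteq> u \<and> dot d (h u) (h w) < 0}" using True by (auto simp: E_def)
        then show ?thesis using \<sigma>(2)[OF True] unfolding h_def by simp
      next
        case False then show ?thesis by (simp add: E_def)
      qed
      have "real (card S) \<le> d + K + (1 / real (\<rho> + 1) + (max 0 (1 - 1 / l ^ (4 * \<rho>))) ^ s) * card S"
        using bound_if_radius_gt[OF False deg, of \<rho> s] unfolding K_def by (simp add: add_ac)
      also have "\<dots> \<le> d + K + \<epsilon> * card S" using rs by (intro add_left_mono mult_right_mono) auto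
      finally show ?thesis by blast
    qed
  qed
  then show ?thesis by (intro exI[of _ K]) blast
qed

section \<open>From sets of lines to \<open>max_equiangular\<close>\<close>

text \<open>The second claim relies on the bound \<open>B\<close> as well: it makes the set of sizes
  finite, without which \<open>Max\<close> says nothing.\<close>

lemma max_equiangular_bounds:
  assumes B: "\<And>S. finite S \<Longrightarrow> equiangular_lines d (arccos \<alpha>) S \<Longrightarrow> real (card S) \<le> B"
  shows "real (max_equiangular \<alpha> d) \<le> B"
    and "finite S \<Longrightarrow> equiangular_lines d (arccos \<alpha>) S \<Longrightarrow> card S \<le> max_equiangular \<alpha> d"
proof -
  define C where "C = {card S | S. finite S \<and> equiangular_lines d (arccos \<alpha>) S}"
  have "n \<le> nat \<lfloor>B\<rfloor>" if "n \<in> C" for n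
    using that B unfolding C_def by (auto simp: le_nat_iff le_floor_iff intro!: order_trans[OF _ le_nat_floor])
  then have "finite C" using finite_subset[of C "{..nat \<lfloor>B\<rfloor>}"] by auto
  have "equiangular_lines d (arccos \<alpha>) {}" by (simp add: equiangular_lines_def)
  then have "C \<noteq> {}" unfolding C_def by blast
  have max: "max_equiangular \<alpha> d = Max C" unfolding max_equiangular_def C_def ..
  have "Max C \<in> C" using \<open>finite C\<close> \<open>C \<noteq> {}\<close> by (rule Max_in)
  then show "real (max_equiangular \<alpha> d) \<le> B" unfolding max using B by (auto simp: C_def)
  show "card S \<le> max_equiangular \<alpha> d" if "finite S" "equiangular_lines d (arccos \<alpha>) S"
    unfolding max using \<open>finite C\<close> that by (intro Max_ge) (auto simp: C_def)
qed

lemma spectral_radius_order_witness: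
  assumes "spectral_radius_order l = enat k"
  shows "\<exists>G. nat_graph k G \<and> k > 0 \<and> graph_spectral_radius k G = l"
proof -
  define X where "X = {enat n | n. n > 0 \<and>
       (\<exists>G. pair_graph G \<and> pverts G = {..<n} \<and> graph_spectral_radius n G = l)}"
  have "Inf X = enat k" using assms unfolding spectral_radius_order_def X_def .
  moreover from this have "X \<noteq> {}" by (auto simp: Inf_enat_def)
  ultimately have "enat k \<in> X" by (metis Inf_enat_def LeastI ex_in_conv)
  then show ?thesis unfolding X_def by auto
qed

lemma max_equiangular_eq:
  fixes \<alpha> l :: real
  assumes \<alpha>: "0 < \<alpha>" "\<alpha> < 1" and l: "l = (1 - \<alpha>) / (2 * \<alpha>)" and k: "spectral_radius_order l = enat k"
  shows "\<exists>d\<^sub>0. \<forall>d>d\<^sub>0. int (max_equiangular \<alpha> d) = \<lfloor>real k * (real d - 1) / (real k - 1)\<rfloor>"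
proof -
  have lp: "l > 0" using \<alpha> unfolding l by simp
  obtain G where G: "nat_graph k G" "k > 0" "graph_spectral_radius k G = l"
    using spectral_radius_order_witness[OF k] by blast
  have Rk: "realizable l k (k - 1)" using realizable_graph G by blast
  \<comment> \<open>A single vertex would be realized in dimension 0, forcing \<open>l = 0\<close>;
    so \<open>k - 1\<close> is a legitimate divisor.\<close>
  have "k \<noteq> 1"
  proof
    assume "k = 1"
    then obtain f where "dot 0 (f (0::nat)) (f 0) = l" using Rk unfolding realizable_def by auto
    then show False using lp by (simp add: dot_def)
  qed
  then have k2: "k \<ge> 2" using G(2) by simp
  \<comment> \<open>Then \<open>1 / (1 - \<epsilon>) = 2 * k / (2 * k - 1)\<close> is less than
    \<open>k / (k - 1)\<close>, so the third alternative of the upper bound loses for large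
    \<open>d\<close>.\<close>
  define \<epsilon> where "\<epsilon> = 1 / (2 * real k)"
  have "\<epsilon> > 0" using k2 unfolding \<epsilon>_def by simp
  then obtain K :: real where K: "\<And>d S. finite S \<Longrightarrow> equiangular_lines d (arccos \<alpha>) S \<Longrightarrow>
    card S \<le> d \<or> (\<exists>c>0. card S + 1 \<le> d + c \<and> k * c \<le> card S) \<or> real (card S) \<le> d + K + \<epsilon> * card S"
    using equiangular_upper_bound[OF \<alpha> l] k by (metis order_refl)
  \<comment> \<open>\<open>k\<close> handles the alternative \<open>card S \<le> d\<close>; the
    other number absorbs the constant \<open>K\<close> in the third alternative.\<close>
  define d0 where "d0 = max k (nat \<lceil>2 * (real k - 1) * K + 2 * real k\<rceil>)"
  have "int (max_equiangular \<alpha> d) = \<lfloor>real k * (real d - 1) / (real k - 1)\<rfloor>" if d: "d > d0" for d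
  proof -
    have dk: "d \<ge> k" and dK: "real d \<ge> 2 * (real k - 1) * K + 2 * real k"
      using d unfolding d0_def by linarith+
    define F where "F = real k * (real d - 1) / (real k - 1)"
    have kp: "real k - 1 > 0" using k2 by simp
    have up: "real (card S) \<le> F" if S: "finite S" "equiangular_lines d (arccos \<alpha>) S" for S
    proof -
      define n where "n = real (card S)"
      have "n * (real k - 1) \<le> real k * (real d - 1)"
        using K[OF S]
      proof (elim disjE exE conjE)
        assume "card S \<le> d"
        then have "n * (real k - 1) \<le> d * (real k - 1)" unfolding n_def using kp by (intro mult_right_mono) auto
        then show ?thesis using dk by (simp add: algebra_simps)
      next
        fix c assume c: "card S + 1 \<le> d + c" "k * c \<le> card S"
        have "n + 1 \<le> d + real c" unfolding n_def using c(1) by linarith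
        then have "real k * (n + 1) \<le> real k * (d + real c)" by (intro mult_left_mono) auto
        moreover have "real k * real c \<le> n" unfolding n_def using c(2) by (metis of_nat_le_iff of_nat_mult)
        ultimately show ?thesis by (simp add: algebra_simps)
      next
        assume "real (card S) \<le> d + K + \<epsilon> * card S"
        then have "n * (2 * real k - 1) \<le> 2 * real k * (d + K)"
          unfolding n_def \<epsilon>_def using k2 by (simp add: field_simps)
        then have "n * (2 * real k - 1) * (real k - 1) \<le> 2 * real k * (d + K) * (real k - 1)"
          using kp by (intro mult_right_mono) auto
        also have "\<dots> = real k * (2 * (real k - 1) * d + 2 * (real k - 1) * K)" by (simp add: algebra_simps)
        also have "\<dots> \<le> real k * ((2 * real k - 1) * (real d - 1))"
          using dK by (intro mult_left_mono) (auto simp: algebra_simps)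
        finally have "(n * (real k - 1)) * (2 * real k - 1) \<le> (real k * (real d - 1)) * (2 * real k - 1)"
          by (simp add: mult_ac)
        then show ?thesis using k2 by (simp add: mult_le_cancel_right)
      qed
      then show ?thesis unfolding F_def n_def using kp by (simp add: pos_le_divide_eq)
    qed
    \<comment> \<open>\<open>q\<close> copies of the extremal graph and \<open>r\<close> isolated
      vertices fill dimension \<open>d - 1\<close>; the last dimension goes to the common
      coordinate.\<close>
    define q r where "q = (d - 1) div (k - 1)" and "r = (d - 1) mod (k - 1)"
    have qr: "d - 1 = q * (k - 1) + r" "r < k - 1"
      unfolding q_def r_def using k2 by (simp_all only: div_mult_mod_eq) simp
    have "realizable l (q * k + r) (q * (k - 1) + r)"
      using lp by (intro realizable_add realizable_mult Rk realizable_diag) simp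
    then obtain S where S: "finite S" "card S = q * k + r" "equiangular_lines (d - 1 + 1) (arccos \<alpha>) S"
      using realizable_lines[OF \<alpha> l] unfolding qr(1)[symmetric] by blast
    have d1: "d - 1 + 1 = d" using dk k2 by simp
    have low: "q * k + r \<le> max_equiangular \<alpha> d"
      using max_equiangular_bounds(2)[OF up S(1)] S(2,3) unfolding d1 by simp
    have e: "real d - 1 = q * (real k - 1) + r"
    proof -
      have "real (d - 1) = real (q * (k - 1) + r)" using qr by simp
      then show ?thesis using dk k2 by (simp add: of_nat_diff)
    qed
    \<comment> \<open>The excess over the construction is a fraction below 1, as
      \<open>r < k - 1\<close>, so the floor is exactly the number of lines built.\<close>
    then have "F = q * k + r + r / (real k - 1)" unfolding F_def e using kp by (simp add: field_simps)
    moreover have "0 \<le> r / (real k - 1)" "r / (real k - 1) < 1" using qr(2) kp k2 by (auto simp: field_simps)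
    ultimately have "\<lfloor>F\<rfloor> = int (q * k + r)" by (intro floor_unique) auto
    moreover have "int (max_equiangular \<alpha> d) \<le> \<lfloor>F\<rfloor>"
      using max_equiangular_bounds(1)[OF up] by (simp add: le_floor_iff)
    ultimately show ?thesis using low unfolding F_def by linarith
  qed
  then show ?thesis by blast
qed

lemma max_equiangular_smallo:
  fixes \<alpha> l :: real
  assumes \<alpha>: "0 < \<alpha>" "\<alpha> < 1" and l: "l = (1 - \<alpha>) / (2 * \<alpha>)" and inf: "spectral_radius_order l = \<infinity>"
  shows "(\<lambda>d. real (max_equiangular \<alpha> d) - real d) \<in> o[at_top](\<lambda>d. real d)"
proof (rule landau_o.smallI)
  fix \<eta> :: real assume \<eta>: "\<eta> > 0"
  have lp: "l > 0" using \<alpha> unfolding l by simp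
  \<comment> \<open>Chosen so that \<open>1 / (1 - \<epsilon>) = 1 + \<eta> / 2\<close>; the other
    half of \<eta> is left for the constant \<open>K\<close>.\<close>
  define \<epsilon> where "\<epsilon> = \<eta> / (2 + \<eta>)"
  have \<epsilon>: "\<epsilon> > 0" "1 - \<epsilon> = 2 / (2 + \<eta>)" using \<eta> unfolding \<epsilon>_def by (auto simp: field_simps)
  from equiangular_upper_bound[OF \<alpha> l \<epsilon>(1)]
  obtain K :: real where K: "\<forall>d S k. finite S \<and> equiangular_lines d (arccos \<alpha>) S \<and> enat k \<le> spectral_radius_order l \<longrightarrow>
    card S \<le> d \<or> (\<exists>c>0. card S + 1 \<le> d + c \<and> k * c \<le> card S) \<or> real (card S) \<le> d + K + \<epsilon> * card S" ..
  define B where "B d = max (real d) ((d + K) * (1 + \<eta> / 2))" for d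
  have up: "real (card S) \<le> B d" if S: "finite S" "equiangular_lines d (arccos \<alpha>) S" for S d
  proof -
    \<comment> \<open>The order is infinite, so \<open>k = card S + 1\<close> is allowed, and no
      component can be that large.\<close>
    have "\<not> (\<exists>c>0. card S + 1 \<le> d + c \<and> (card S + 1) * c \<le> card S)"
      by (metis Suc_eq_plus1 Suc_leI mult.right_neutral mult_le_mono2 not_less_eq_eq order_trans One_nat_def)
    then have "card S \<le> d \<or> real (card S) \<le> d + K + \<epsilon> * card S"
      using K[THEN spec, of d, THEN spec, of S, THEN spec, of "card S + 1"] S inf by auto
    then show ?thesis
    proof
      assume "real (card S) \<le> d + K + \<epsilon> * card S"
      then have "(1 - \<epsilon>) * card S \<le> d + K" by (simp add: algebra_simps)
      then have "card S \<le> (d + K) * (1 + \<eta> / 2)" unfolding \<epsilon>(2) using \<eta> by (simp add: field_simps)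
      then show ?thesis unfolding B_def by simp
    qed (simp add: B_def)
  qed
  \<comment> \<open>Isolated vertices alone give \<open>d - 1\<close> lines.\<close>
  have low: "d \<le> max_equiangular \<alpha> d + 1" if "d > 0" for d
  proof -
    obtain S where S: "finite S" "card S = d - 1" "equiangular_lines (d - 1 + 1) (arccos \<alpha>) S"
      using realizable_lines[OF \<alpha> l realizable_diag] lp by (metis less_eq_real_def)
    have "d - 1 + 1 = d" using that by simp
    then have "equiangular_lines d (arccos \<alpha>) S" using S(3) by (simp only:)
    then have "card S \<le> max_equiangular \<alpha> d"
      using max_equiangular_bounds(2)[of d \<alpha> "B d", OF up S(1)] by blast
    then show ?thesis using S(2) by simp
  qed
  \<comment> \<open>The first number makes the lower deficit 1 at most \<open>\<eta> * d\<close>,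
    the second makes the contribution of \<open>K\<close> at most
    \<open>\<eta> * d / 2\<close>.\<close>
  define d0 where "d0 = max (nat \<lceil>1 / \<eta>\<rceil>) (nat \<lceil>2 * K * (1 + \<eta> / 2) / \<eta>\<rceil>) + 1"
  have "norm (real (max_equiangular \<alpha> d) - real d) \<le> \<eta> * norm (real d)" if d: "d \<ge> d0" for d
  proof -
    have d1: "d > 0" "1 / \<eta> \<le> d" "2 * K * (1 + \<eta> / 2) / \<eta> \<le> d" using d unfolding d0_def by linarith+
    have "real d - 1 \<le> max_equiangular \<alpha> d" using low[OF d1(1)] by linarith
    moreover have "1 \<le> \<eta> * d" using d1(2) \<eta> by (simp add: field_simps)
    moreover have "B d \<le> d + \<eta> * d"
    proof -
      have "K * (1 + \<eta> / 2) \<le> \<eta> * d / 2" using d1(3) \<eta> by (simp add: field_simps)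
      moreover have "(d + K) * (1 + \<eta> / 2) = d + \<eta> * d / 2 + K * (1 + \<eta> / 2)"
        by (simp add: algebra_simps add_divide_distrib)
      ultimately have "(d + K) * (1 + \<eta> / 2) \<le> d + \<eta> * d" by linarith
      then show ?thesis unfolding B_def using \<eta> by simp
    qed
    moreover have "real (max_equiangular \<alpha> d) \<le> B d" by (rule max_equiangular_bounds(1)) (rule up)
    ultimately show ?thesis by (simp add: abs_le_iff)
  qed
  then show "eventually (\<lambda>d. norm (real (max_equiangular \<alpha> d) - real d) \<le> \<eta> * norm (real d)) at_top"
    unfolding eventually_at_top_linorder by blast
qed

theorem theorem1p2:
  fixes \<alpha> lam :: real
  assumes "0 < \<alpha>" and "\<alpha> < 1"
    and "lam = (1 - \<alpha>) / (2 * \<alpha>)"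
  shows "(\<forall>k::nat. spectral_radius_order lam = enat k \<longrightarrow>
            (\<exists>d\<^sub>0::nat. \<forall>d>d\<^sub>0.
               int (max_equiangular \<alpha> d) = \<lfloor>real k * (real d - 1) / (real k - 1)\<rfloor>))
       \<and> (spectral_radius_order lam = \<infinity> \<longrightarrow>
            (\<lambda>d. real (max_equiangular \<alpha> d) - real d) \<in> o[at_top](\<lambda>d. real d))"
  using max_equiangular_eq[OF assms] max_equiangular_smallo[OF assms] by blast

end
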